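(* Let $n\ge1$ and $0\le m\le n-1$ be integers. The formal power series $\widetilde{H}_{n,m}(x;q,t,u,v)$ is symmetric in the variables $x_1,x_2,\dots$. Moreover, for every partition $\lambda\vdash n$, the coefficient of the Schur function $s_\lambda(x)$ in $\widetilde{H}_{n,m}(x;q,t,u,v)$ equals $$\sum_{T\in\operatorname{SYT}(\lambda)}q^{\operatorname{rlmaj}_{[m+1,n]}(T)}\,t^{\operatorname{maj}_{[1,m]}(T)}\prod_{i=1}^{|\operatorname{Des}(T)\cap[m+1,n]|}\left(1+uq^{-i}\right)\prod_{j=1}^{|\operatorname{Des}(T)\cap[1,m]|}\left(1+vt^{-j}\right).$$
   Context: For a word $\sigma=\sigma_1\cdots\sigma_n$ of positive integers let $x^\sigma=x_{\sigma_1}\cdots x_{\sigma_n}$ and $\operatorname{Des}(\sigma)=\{i\in[1,n-1]:\sigma_i>\sigma_{i+1}\}$. Define $\operatorname{inv}_{[m+1,n]}(\sigma)=\#\{(j,i):m+1\le j<i\le n,\ \sigma_j>\sigma_i\}$; for $m+1\le i\le n$, $\operatorname{inv}^{\Box,i}_{[m+1,n]}(\sigma)=\#\{j:m+1\le j<i,\ \sigma_j>\sigma_i\}$; and $\operatorname{maj}_{[1,m]}(\sigma)=\sum_{i\in\operatorname{Des}(\sigma)\cap[1,m]}i$ (the major index of $\sigma_1\cdots\sigma_{m+1}$). Define $$\widetilde{H}_{n,m}(x;q,t,u,v)=\sum_{\sigma\in\{1,2,\ldots\}^n}q^{\operatorname{inv}_{[m+1,n]}(\sigma)}t^{\operatorname{maj}_{[1,m]}(\sigma)}x^\sigma\prod_{i\in\operatorname{Des}(\sigma)\cap[m+1,n]}\left(1+\frac{u}{q^{\operatorname{inv}^{\Box,i}_{[m+1,n]}(\sigma)+1}}\right)\prod_{j=1}^{|\operatorname{Des}(\sigma)\cap[1,m]|}\left(1+\frac{v}{t^{j}}\right).$$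 $\operatorname{SYT}(\lambda)$ is the set of standard Young tableaux of shape $\lambda$ (French notation). The descent set $\operatorname{Des}(T)$ of $T$ is the set of $i$ such that $i+1$ lies in a row strictly above the row of $i$. For intervals, $\operatorname{maj}_{[1,m]}(T)=\sum_{i\in\operatorname{Des}(T)\cap[1,m]}i$ and $\operatorname{rlmaj}_{[m+1,n]}(T)=\sum_{i\in\operatorname{Des}(T)\cap[m+1,n]}(n-i)$. *)

theory Defs
  imports Complex_Main "HOL-Library.Multiset" "HOL-Library.FuncSet"
    "HOL-Combinatorics.Permutations"
begin

(* A formal power series in x_1, x_2, ... with coefficients in 'a is its coefficient function
   nat multiset => 'a: the monomial x_{i_1} ... x_{i_k} is the multiset {# i_1, ..., i_k #} of its
   indices.  Index 0 is not a variable: every series below vanishes on multisets containing 0. *)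

type_synonym 'a series = "nat multiset \<Rightarrow> 'a"

definition symmetric_series :: "'a series \<Rightarrow> bool" where
  "symmetric_series F \<longleftrightarrow> (\<forall>\<pi> M. \<pi> permutes {1..} \<longrightarrow> F (image_mset \<pi> M) = F M)"


subsection \<open>Words\<close>

text \<open>Positions in words are counted from 1.\<close>

definition letter :: "nat list \<Rightarrow> nat \<Rightarrow> nat" where
  "letter \<sigma> i = \<sigma> ! (i - 1)"

definition words :: "nat \<Rightarrow> nat list set" where
  "words n = {\<sigma>. length \<sigma> = n \<and> set \<sigma> \<subseteq> {1..}}"

definition Des :: "nat list \<Rightarrow> nat set" where
  "Des \<sigma> = {i \<in> {1..length \<sigma> - 1}. letter \<sigma> i > letter \<sigma> (i + 1)}"

definition inv_word :: "nat \<Rightarrow> nat \<Rightarrow> nat list \<Rightarrow> nat" where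
  "inv_word a b \<sigma> = card {(j, i). a \<le> j \<and> j < i \<and> i \<le> b \<and> letter \<sigma> j > letter \<sigma> i}"

text \<open>\<open>inv_box a i \<sigma>\<close> is the statistic with superscript \<open>\<box>,i\<close> on an interval starting at \<open>a\<close>;
  it does not depend on the right end of the interval.\<close>

definition inv_box :: "nat \<Rightarrow> nat \<Rightarrow> nat list \<Rightarrow> nat" where
  "inv_box a i \<sigma> = card {j. a \<le> j \<and> j < i \<and> letter \<sigma> j > letter \<sigma> i}"

definition maj_word :: "nat \<Rightarrow> nat \<Rightarrow> nat list \<Rightarrow> nat" where
  "maj_word a b \<sigma> = (\<Sum>i \<in> Des \<sigma> \<inter> {a..b}. i)"

text \<open>The parameters \<open>q, t, u, v\<close> are elements of an arbitrary field, \<open>q\<close> and \<open>t\<close> being nonzero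
  where it matters; indeterminates are the instance of a field of rational functions.\<close>

definition word_weight :: "nat \<Rightarrow> nat \<Rightarrow> 'a::field \<Rightarrow> 'a \<Rightarrow> 'a \<Rightarrow> 'a \<Rightarrow> nat list \<Rightarrow> 'a" where
  "word_weight n m q t u v \<sigma> =
     q ^ inv_word (m + 1) n \<sigma> * t ^ maj_word 1 m \<sigma>
     * (\<Prod>i \<in> Des \<sigma> \<inter> {m+1..n}. 1 + u / q ^ (inv_box (m + 1) i \<sigma> + 1))
     * (\<Prod>j = 1..card (Des \<sigma> \<inter> {1..m}). 1 + v / t ^ j)"

text \<open>The coefficient of the monomial \<open>M\<close> is the total weight of the (finitely many) words
  \<open>\<sigma>\<close> with \<open>x\<^sup>\<sigma> = M\<close>.\<close>

definition H_tilde :: "nat \<Rightarrow> nat \<Rightarrow> 'a::field \<Rightarrow> 'a \<Rightarrow> 'a \<Rightarrow> 'a \<Rightarrow> 'a series" where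
  "H_tilde n m q t u v M = (\<Sum>\<sigma> | \<sigma> \<in> words n \<and> mset \<sigma> = M. word_weight n m q t u v \<sigma>)"


subsection \<open>Partitions, tableaux and Schur functions\<close>

definition is_partition :: "nat list \<Rightarrow> bool" where
  "is_partition \<mu> \<longleftrightarrow> sorted_wrt (\<ge>) \<mu> \<and> (\<forall>p \<in> set \<mu>. p > 0)"

definition partition_of :: "nat \<Rightarrow> nat list \<Rightarrow> bool" where
  "partition_of n \<mu> \<longleftrightarrow> is_partition \<mu> \<and> sum_list \<mu> = n"

text \<open>French notation: the cell \<open>(r, c)\<close> lies in row \<open>r\<close> counted from the bottom, starting
  at 0.\<close>

definition cells :: "nat list \<Rightarrow> (nat \<times> nat) set" where
  "cells \<mu> = {(r, c). r < length \<mu> \<and> c < \<mu> ! r}"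

definition SSYT :: "nat list \<Rightarrow> (nat \<times> nat \<Rightarrow> nat) set" where
  "SSYT \<mu> = {T \<in> cells \<mu> \<rightarrow>\<^sub>E {1..}.
     (\<forall>r c c'. (r, c) \<in> cells \<mu> \<and> (r, c') \<in> cells \<mu> \<and> c < c' \<longrightarrow> T (r, c) \<le> T (r, c')) \<and>
     (\<forall>r r' c. (r, c) \<in> cells \<mu> \<and> (r', c) \<in> cells \<mu> \<and> r < r' \<longrightarrow> T (r, c) < T (r', c))}"

definition SYT :: "nat list \<Rightarrow> (nat \<times> nat \<Rightarrow> nat) set" where
  "SYT \<mu> = {T \<in> SSYT \<mu>. bij_betw T (cells \<mu>) {1..sum_list \<mu>}}"

definition Des_tab :: "nat list \<Rightarrow> (nat \<times> nat \<Rightarrow> nat) \<Rightarrow> nat set" where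
  "Des_tab \<mu> T = {i. \<exists>r c r' c'. (r, c) \<in> cells \<mu> \<and> (r', c') \<in> cells \<mu> \<and>
     T (r, c) = i \<and> T (r', c') = i + 1 \<and> r < r'}"

definition maj_tab :: "nat \<Rightarrow> nat \<Rightarrow> nat list \<Rightarrow> (nat \<times> nat \<Rightarrow> nat) \<Rightarrow> nat" where
  "maj_tab a b \<mu> T = (\<Sum>i \<in> Des_tab \<mu> T \<inter> {a..b}. i)"

definition rlmaj_tab :: "nat \<Rightarrow> nat \<Rightarrow> nat list \<Rightarrow> (nat \<times> nat \<Rightarrow> nat) \<Rightarrow> nat" where
  "rlmaj_tab a b \<mu> T = (\<Sum>i \<in> Des_tab \<mu> T \<inter> {a..b}. b - i)"

definition schur :: "nat list \<Rightarrow> 'a::comm_ring_1 series" where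
  "schur \<mu> M = of_nat (card {T \<in> SSYT \<mu>. image_mset T (mset_set (cells \<mu>)) = M})"

definition schur_expansion :: "'a::comm_ring_1 series \<Rightarrow> (nat list \<Rightarrow> 'a) \<Rightarrow> bool" where
  "schur_expansion F c \<longleftrightarrow>
     finite {\<mu>. c \<mu> \<noteq> 0} \<and> (\<forall>\<mu>. c \<mu> \<noteq> 0 \<longrightarrow> is_partition \<mu>) \<and>
     (\<forall>M. F M = (\<Sum>\<mu> | c \<mu> \<noteq> 0. c \<mu> * schur \<mu> M))"

text \<open>The coefficient of \<open>s\<^sub>\<mu>\<close> in \<open>F\<close>; meaningful when \<open>F\<close> has exactly one Schur expansion.\<close>

definition schur_coeff :: "'a::comm_ring_1 series \<Rightarrow> nat list \<Rightarrow> 'a" where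
  "schur_coeff F \<mu> = (THE c. schur_expansion F c) \<mu>"

end

theory Submission
  imports Defs "HOL-Computational_Algebra.Polynomial" "HOL-Computational_Algebra.Formal_Power_Series"
    "HOL-Combinatorics.Multiset_Permutations"
begin

text \<open>
  Two ingredients. First, over the rearrangements of a word whose first letter is kept, the statistic
  built from inversions and the one built from the reverse major index have the same distribution:
  inserting all copies of a new largest letter \<open>N\<close> acts on both by the same linear operator on
  polynomials in \<open>u\<close>. Applied to \<open>\<sigma>\<^sub>m\<^sub>+\<^sub>1 \<dots> \<sigma>\<^sub>n\<close>, with the first \<open>m + 1\<close> letters fixed, this turns the
  weight of a word into a function of its descent set alone.

  Second, the words with content \<open>M\<close> and descent set \<open>D\<close> are equinumerous with the pairs of tableaux
  \<open>(P, Q)\<close> of the same shape, \<open>P\<close> semistandard of content \<open>M\<close> and \<open>Q\<close> standard with descent set \<open>D\<close>. By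
  inclusion and exclusion it suffices to allow all descent sets contained in \<open>D\<close>; then both sides can
  be cut at the last element of \<open>D\<close>, and the comparison reduces to a Pieri rule, which follows from the
  local rule of growth diagrams.
\<close>

section \<open>The generating function of insertions\<close>

text \<open>A position with \<open>b\<close> larger letters to its left has weight
  \<open>q^b\<close>, or \<open>q^b + u/q\<close> if it is a descent. Choosing \<open>u/q\<close>
  marks the descent: the letter then ignores its inversions, and no new letter may be put directly
  behind it, as this would destroy the descent. So \<open>u^j\<close> records that the word is glued
  into \<open>k + 1 - j\<close> blocks, and inserting copies of \<open>N\<close> depends on nothing
  else; \<open>row_gf\<close> collects the contributions of the gaps. For the major index no such
  picture is used: the same operator is recognised through q-difference equations of
  \<open>row_gf\<close>. The obstacle is that \<open>N\<close> must exceed the kept first letter. An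
  artificial first letter 0 is always small enough and yields the identity for all rearrangements,
  from which the excluded case follows. The field may have positive characteristic. Words and
  tableaux are therefore compared by natural numbers, cast only afterwards, and uniqueness of the
  Schur expansion rests on a coefficient equal to 1. Symmetry is read off the words, not off the
  Schur functions.\<close>

unbundle fps_syntax

text \<open>Polynomials are in \<open>u\<close>; \<open>qshift q\<close> sends \<open>\<Prod>i=1..d. 1 + u q\<^sup>-\<^sup>i\<close> to the same product with \<open>d + 1\<close> factors.\<close>

definition qshift :: "'a::field \<Rightarrow> 'a poly \<Rightarrow> 'a poly" where
  "qshift q p = [:1, inverse q:] * pcompose p [:0, inverse q:]"

lemma smult_sum_right: "smult a (\<Sum>i\<in>A. f i) = (\<Sum>i\<in>A. smult a (f i))"
  by (induction A rule: infinite_finite_induct) (simp_all add: smult_add_right)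

lemma qshift_add: "qshift q (p + r) = qshift q p + qshift q r"
  by (simp add: qshift_def pcompose_add distrib_left)

lemma pcompose_monom_scale: "pcompose (monom (a :: 'a::field) j) [:0, c:] = monom (a * c ^ j) j"
proof (induction j)
  case 0
  show ?case by (simp add: monom_0)
next
  case (Suc j)
  then show ?case
    by (simp add: monom_Suc pcompose_pCons smult_monom mult_ac)
qed

lemma qshift_monom_mult:
  "qshift q (monom a j * p) = monom (a * inverse q ^ j) j * qshift q p"
  unfolding qshift_def pcompose_mult pcompose_monom_scale by (rule mult.left_commute)

text \<open>As a series in \<open>y\<close>, \<open>row_gf q k\<close> is \<open>(\<Prod>p<k. 1 + u q\<^sup>p y) / (\<Prod>p\<le>k. 1 - q\<^sup>p y)\<close>; the last factor below is
  \<open>(1 + u q\<^sup>k y) / (1 - q\<^sup>k\<^sup>+\<^sup>1 y)\<close>, expanded.\<close>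

primrec row_gf :: "'a::field \<Rightarrow> nat \<Rightarrow> 'a poly fps" where
  "row_gf q 0 = Abs_fps (\<lambda>_. 1)"
| "row_gf q (Suc k) =
     row_gf q k * Abs_fps (\<lambda>i. if i = 0 then 1 else smult (q ^ (i * Suc k)) [:1, inverse q:])"

text \<open>The substitution of \<open>q y\<close> for \<open>y\<close> and \<open>u / q\<close> for
  \<open>u\<close>. It fixes every numerator factor \<open>1 + u q^p y\<close> of
  \<open>row_gf\<close> and moves every denominator factor \<open>1 - q^p y\<close> to the next one.
  Times \<open>1 + u/q\<close>, it is \<open>qshift\<close> on each coefficient, with the extra
  power of \<open>q\<close> needed for the major index.\<close>

definition qdilate :: "'a::field \<Rightarrow> 'a poly fps \<Rightarrow> 'a poly fps" where
  "qdilate q f = Abs_fps (\<lambda>c. smult (q ^ c) (pcompose (f $ c) [:0, inverse q:]))"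

lemma qdilate_mult: "qdilate q (f * g) = qdilate q f * qdilate q g"
proof (rule fps_ext)
  fix n
  have "qdilate q (f * g) $ n =
     (\<Sum>i=0..n. smult (q ^ n) (pcompose (f $ i) [:0, inverse q:] * pcompose (g $ (n - i)) [:0, inverse q:]))"
    by (simp add: qdilate_def fps_mult_nth pcompose_sum pcompose_mult smult_sum_right)
  also have "\<dots> = (\<Sum>i=0..n. qdilate q f $ i * qdilate q g $ (n - i))"
    by (intro sum.cong refl) (simp add: qdilate_def flip: power_add)
  finally show "qdilate q (f * g) $ n = (qdilate q f * qdilate q g) $ n"
    by (simp add: fps_mult_nth)
qed

abbreviation fps_lin :: "'a::comm_ring_1 \<Rightarrow> 'a fps" where
  "fps_lin a \<equiv> 1 + fps_const a * fps_X"

lemma qdilate_lin: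
  assumes "q \<noteq> 0"
  shows "qdilate q (fps_lin [:a, b:]) = fps_lin [:q * a, b:]"
proof (rule fps_ext)
  fix n
  show "qdilate q (fps_lin [:a, b:]) $ n = fps_lin [:q * a, b:] $ n"
    using assms by (cases n) (auto simp: qdilate_def fps_X_nth pcompose_pCons pcompose_1)
qed

lemma fps_lin_mult_nth_Suc: "(fps_lin a * f) $ Suc n = f $ Suc n + a * f $ n"
proof -
  have "fps_lin a * f = f + fps_const a * (fps_X * f)" by (simp add: algebra_simps)
  then show ?thesis by simp
qed

lemma fps_lin_mult_nth_0: "(fps_lin a * f) $ 0 = f $ 0"
  by simp

lemma fps_lin_nonzero: "fps_lin (a :: 'a::idom) \<noteq> 0"
  by (metis fps_lin_mult_nth_0 mult.right_neutral fps_one_nth fps_zero_nth zero_neq_one)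

lemma row_gf_0: "fps_lin (-1) * row_gf q 0 = 1"
  by (rule fps_ext, case_tac n) (simp_all add: fps_lin_mult_nth_Suc del: fps_const_neg fps_const_1_eq_1 fps_const_minus)

text \<open>The last factor of \<open>row_gf\<close>, with its denominator cleared. Here and below,
  division of series over a polynomial ring is replaced by cancelling nonzero factors
  \<open>fps_lin a\<close>.\<close>

lemma row_gf_Suc:
  assumes q: "q \<noteq> 0"
  shows "fps_lin [:- (q ^ Suc k):] * row_gf q (Suc k) = fps_lin [:0, q ^ k:] * row_gf q k"
proof -
  let ?B = "Abs_fps (\<lambda>i. if i = 0 then 1 else smult (q ^ (i * Suc k)) [:1, inverse q:])"
  have "fps_lin [:- (q ^ Suc k):] * ?B = fps_lin [:0, q ^ k:]"
  proof (rule fps_ext)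
    fix n
    show "(fps_lin [:- (q ^ Suc k):] * ?B) $ n = fps_lin [:0, q ^ k:] $ n"
    proof (cases n)
      case (Suc i)
      then show ?thesis
        using q by (cases i) (simp_all add: fps_lin_mult_nth_Suc fps_X_nth power_add del: fps_const_neg)
    qed simp
  qed
  then show ?thesis
    by (simp only: row_gf.simps mult.left_commute) (simp only: mult.commute)
qed

text \<open>Telescoping: dilation keeps the numerator and trades only the denominator factor
  \<open>1 - y\<close> for \<open>1 - q^(k+1) y\<close>.\<close>

lemma row_gf_dilate:
  assumes q: "q \<noteq> 0"
  shows "fps_lin (-1) * row_gf q k = fps_lin [:- (q ^ Suc k):] * qdilate q (row_gf q k)"
proof (induction k)
  case 0
  have "fps_lin [:- q, 0:] * qdilate q (row_gf q 0) = qdilate q (fps_lin [:-1, 0:] * row_gf q 0)"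
    using qdilate_lin[OF q, of "-1" 0] by (simp add: qdilate_mult)
  also have "fps_lin [:-1, 0:] * row_gf q 0 = fps_lin (-1) * row_gf q 0"
    by (simp add: one_pCons)
  also have "\<dots> = 1" by (rule row_gf_0)
  also have "qdilate q 1 = 1"
    by (rule fps_ext) (simp add: qdilate_def pcompose_1)
  finally show ?case using row_gf_0[of q] by simp
next
  case (Suc k)
  let ?P = "fps_lin [:0, q ^ k:]" and ?Q1 = "fps_lin [:- (q ^ Suc k):]" and ?Q2 = "fps_lin [:- (q ^ Suc (Suc k)):]"
  have "qdilate q (?Q1 * row_gf q (Suc k)) = qdilate q (?P * row_gf q k)"
    by (simp only: row_gf_Suc[OF q])
  then have T: "?Q2 * qdilate q (row_gf q (Suc k)) = ?P * qdilate q (row_gf q k)"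
    using qdilate_lin[OF q, of "- (q ^ Suc k)" 0] qdilate_lin[OF q, of 0 "q ^ k"]
    by (simp only: qdilate_mult) (simp add: mult_ac)
  have "?Q1 * (?Q2 * qdilate q (row_gf q (Suc k))) = ?P * (?Q1 * qdilate q (row_gf q k))"
    by (simp only: T mult.left_commute)
  also have "\<dots> = ?P * (fps_lin (-1) * row_gf q k)" by (simp only: Suc.IH)
  also have "\<dots> = fps_lin (-1) * (?Q1 * row_gf q (Suc k))"
    by (simp only: row_gf_Suc[OF q] mult.left_commute)
  finally have "?Q1 * (?Q2 * qdilate q (row_gf q (Suc k))) = ?Q1 * (fps_lin (-1) * row_gf q (Suc k))"
    by (simp only: mult.left_commute)
  with fps_lin_nonzero show ?case
    by (metis mult_left_cancel)
qed

text \<open>Taking partial sums is division by \<open>1 - y\<close>, so the series \<open>F\<close>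
  of the right-hand sides has to satisfy \<open>(1 - y) F = (1 + u/q) qdilate (row_gf q k)\<close>.
  By \<open>row_gf_dilate\<close> this follows from
  \<open>(1 - q^(k+1) y) F = (1 + u/q) row_gf q k\<close>, where the terms \<open>u q^k y\<close>
  and \<open>(u/q) q^(k+1) y\<close> cancel.\<close>

lemma sum_qshift_row_gf:
  assumes q: "q \<noteq> 0"
  shows "(\<Sum>s\<le>c. smult (q ^ s) (qshift q (row_gf q k $ s))) =
    row_gf q (Suc k) $ c + [:0, inverse q:] * row_gf q k $ c"
proof -
  define F where "F = row_gf q (Suc k) + fps_const [:0, inverse q:] * row_gf q k"
  let ?Q1 = "fps_lin [:- (q ^ Suc k):]"
  have "?Q1 * F = fps_lin [:0, q ^ k:] * row_gf q k + ?Q1 * (fps_const [:0, inverse q:] * row_gf q k)"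
    unfolding F_def by (simp only: distrib_left row_gf_Suc[OF q])
  also have "\<dots> = (fps_lin [:0, q ^ k:] + ?Q1 * fps_const [:0, inverse q:]) * row_gf q k"
    by (simp only: distrib_right mult.assoc)
  also have "fps_lin [:0, q ^ k:] + ?Q1 * fps_const [:0, inverse q:] = fps_const [:1, inverse q:]"
  proof (rule fps_ext)
    fix n
    show "(fps_lin [:0, q ^ k:] + ?Q1 * fps_const [:0, inverse q:]) $ n = fps_const [:1, inverse q:] $ n"
      using q by (cases n) (simp_all add: fps_lin_mult_nth_Suc fps_X_nth one_pCons field_simps del: fps_const_neg)
  qed
  finally have 1: "?Q1 * F = fps_const [:1, inverse q:] * row_gf q k" .
  have "?Q1 * (fps_lin (-1) * F) = fps_lin (-1) * (?Q1 * F)" by (rule mult.left_commute)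
  also have "\<dots> = fps_const [:1, inverse q:] * (fps_lin (-1) * row_gf q k)"
    by (simp only: 1 mult.left_commute)
  also have "\<dots> = ?Q1 * (fps_const [:1, inverse q:] * qdilate q (row_gf q k))"
    by (simp only: row_gf_dilate[OF q] mult.left_commute)
  finally have 2: "fps_lin (-1) * F = fps_const [:1, inverse q:] * qdilate q (row_gf q k)"
    using fps_lin_nonzero by (metis mult_left_cancel)
  have H: "(fps_const [:1, inverse q:] * qdilate q (row_gf q k)) $ s =
      smult (q ^ s) (qshift q (row_gf q k $ s))" for s
    by (simp add: qdilate_def qshift_def)
  have "(\<Sum>s\<le>c. smult (q ^ s) (qshift q (row_gf q k $ s))) = F $ c"
  proof (induction c)
    case 0
    show ?case using H[of 0] fps_lin_mult_nth_0[of "-1" F] unfolding 2 by simp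
  next
    case (Suc c)
    show ?case using H[of "Suc c"] fps_lin_mult_nth_Suc[of "-1" F c] unfolding 2 by (simp add: Suc)
  qed
  then show ?thesis by (simp add: F_def)
qed

text \<open>One of two recursions for the same series. This one matches the major index: comparing
  coefficients in \<open>row_gf_Suc\<close>, the terms carried over from \<open>y^(c-1)\<close> are
  exactly the partial sum just computed. The convolution in \<open>row_gf_Suc_conv\<close> matches
  inversions.\<close>

lemma row_gf_Suc_shift:
  assumes q: "q \<noteq> 0"
  shows "row_gf q (Suc k) $ c =
    row_gf q k $ c + (\<Sum>s<c. smult (q ^ (Suc k + s)) (qshift q (row_gf q k $ s)))"
proof (cases c)
  case 0
  then show ?thesis by simp
next
  case (Suc d)
  have "(fps_lin [:- (q ^ Suc k):] * row_gf q (Suc k)) $ Suc d = (fps_lin [:0, q ^ k:] * row_gf q k) $ Suc d"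
    by (simp only: row_gf_Suc[OF q])
  then have "row_gf q (Suc k) $ Suc d =
      row_gf q k $ Suc d + smult (q ^ Suc k) (row_gf q (Suc k) $ d + [:0, inverse q:] * row_gf q k $ d)"
    unfolding fps_lin_mult_nth_Suc using q
    by (simp add: smult_add_right add_ac field_simps del: row_gf.simps)
  also have "smult (q ^ Suc k) (row_gf q (Suc k) $ d + [:0, inverse q:] * row_gf q k $ d) =
      (\<Sum>s<c. smult (q ^ (Suc k + s)) (qshift q (row_gf q k $ s)))"
    unfolding sum_qshift_row_gf[OF q, symmetric] smult_sum_right Suc lessThan_Suc_atMost
    by (simp add: power_add mult_ac)
  finally show ?thesis by (simp add: Suc)
qed

lemma row_gf_Suc_conv:
  "row_gf q (Suc k) $ c =
    row_gf q k $ c + (\<Sum>s<c. smult (q ^ ((c - s) * Suc k)) [:1, inverse q:] * row_gf q k $ s)"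
proof -
  let ?B = "Abs_fps (\<lambda>i. if i = 0 then 1 else smult (q ^ (i * Suc k)) [:1, inverse q:])"
  have "row_gf q (Suc k) $ c = (\<Sum>s<Suc c. row_gf q k $ s * ?B $ (c - s))"
    by (simp only: row_gf.simps fps_mult_nth) (rule sum.cong, auto)
  also have "\<dots> = row_gf q k $ c + (\<Sum>s<c. row_gf q k $ s * ?B $ (c - s))"
    by simp
  also have "(\<Sum>s<c. row_gf q k $ s * ?B $ (c - s)) =
      (\<Sum>s<c. smult (q ^ ((c - s) * Suc k)) [:1, inverse q:] * row_gf q k $ s)"
    by (intro sum.cong) (auto simp: mult.commute[of "row_gf q k $ _"])
  finally show ?thesis .
qed

text \<open>The effect, on the polynomial of a word of length \<open>k + 1\<close>, of inserting \<open>c\<close> copies of a larger letter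
  behind the first letter, while \<open>s\<close> further copies stand to the left of the word. The monomial \<open>u\<^sup>j\<close> stands
  for \<open>j\<close> marked descents, which glue the word into \<open>k + 1 - j\<close> blocks.\<close>

definition lift_ins :: "'a::field \<Rightarrow> nat \<Rightarrow> nat \<Rightarrow> nat \<Rightarrow> 'a poly \<Rightarrow> 'a poly" where
  "lift_ins q s k c p =
     (\<Sum>j\<le>k. smult (q ^ (s * (Suc k - j))) (monom (coeff p j) j * row_gf q (k - j) $ c))"

section \<open>Linearity and recursions of the insertion operator\<close>

lemma lift_ins_add: "lift_ins q s k c (p + r) = lift_ins q s k c p + lift_ins q s k c r"
  by (simp add: lift_ins_def sum.distrib smult_add_right distrib_right flip: add_monom)

lemma lift_ins_0 [simp]: "lift_ins q s k c 0 = 0"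
  by (simp add: lift_ins_def)

lemma lift_ins_smult: "lift_ins q s k c (smult a p) = smult a (lift_ins q s k c p)"
  by (simp add: lift_ins_def smult_sum_right mult_ac flip: smult_monom)

lemma lift_ins_sum: "lift_ins q s k c (\<Sum>i\<in>A. f i) = (\<Sum>i\<in>A. lift_ins q s k c (f i))"
  by (induction A rule: infinite_finite_induct) (simp_all add: lift_ins_add)

lemma lift_ins_monom:
  assumes "j \<le> k"
  shows "lift_ins q s k c (monom a j) =
    smult (q ^ (s * (Suc k - j))) (monom a j * row_gf q (k - j) $ c)"
proof -
  have "lift_ins q s k c (monom a j) = (\<Sum>i\<le>k. if i = j then
      smult (q ^ (s * (Suc k - j))) (monom a j * row_gf q (k - j) $ c) else 0)"
    unfolding lift_ins_def by (intro sum.cong) auto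
  also have "\<dots> = smult (q ^ (s * (Suc k - j))) (monom a j * row_gf q (k - j) $ c)"
    using assms by (subst sum.delta) auto
  finally show ?thesis .
qed

text \<open>Both sides of the identities below are linear in \<open>p\<close>, so monomials suffice.
  The degree bound matters because \<open>lift_ins\<close> with parameter \<open>k\<close> drops all
  coefficients beyond \<open>k\<close>.\<close>

lemma poly_degree_le_induct [consumes 1, case_names monom add]:
  assumes "degree p \<le> k"
    and monom: "\<And>a j. j \<le> k \<Longrightarrow> P (monom a j)"
    and add: "\<And>p r. P p \<Longrightarrow> P r \<Longrightarrow> P (p + r)"
  shows "P p"
proof -
  have "P (\<Sum>i\<in>A. monom (coeff p i) i)" if "finite A" "A \<subseteq> {..k}" for A
    using that
  proof (induction A rule: finite_induct)
    case empty
    show ?case using monom[of 0 0] by simp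
  qed (auto intro: add monom)
  from this[of "{..k}"] show ?thesis
    using poly_as_sum_of_monoms'[OF assms(1)] by simp
qed

lemma monom_times_lin: "monom a j * [:g, h:] = monom (a * g) j + monom (a * h) (Suc j)"
  by (simp add: monom_Suc flip: monom_0 mult_monom) (simp add: monom_0 mult.commute smult_monom)

text \<open>The step for a letter in front of a smaller one: \<open>s\<close> copies go behind the
  second letter, \<open>c - s\<close> between the first two. In every case, \<open>s = c\<close>
  included, there is a descent just before the second letter, with \<open>k + 1 + s\<close> letters
  after it, so all terms have the same form.\<close>

lemma lift_ins_descent:
  assumes q: "q \<noteq> 0" and "degree p \<le> k"
  shows "(\<Sum>s\<le>c. smult (q ^ (Suc k + s)) (qshift q (lift_ins q 0 k s p))) =
    lift_ins q 0 (Suc k) c (smult (q ^ Suc k) (qshift q p))"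
  using assms(2)
proof (induction rule: poly_degree_le_induct)
  case (monom a j)
  let ?m = "monom (a * inverse q ^ j) j"
  have sh: "qshift q (monom a j) = ?m + monom (a * inverse q ^ j * inverse q) (Suc j)"
    using qshift_monom_mult[of q a j 1] by (simp add: qshift_def pcompose_1 monom_times_lin del: mult_pCons_right)
  have "(\<Sum>s\<le>c. smult (q ^ (Suc k + s)) (qshift q (lift_ins q 0 k s (monom a j)))) =
     smult (q ^ Suc k) (?m * (\<Sum>s\<le>c. smult (q ^ s) (qshift q (row_gf q (k - j) $ s))))"
    unfolding lift_ins_monom[OF monom] by (simp add: qshift_monom_mult power_add smult_sum_right sum_distrib_left mult_ac)
  also have "\<dots> = smult (q ^ Suc k) (?m * (row_gf q (Suc (k - j)) $ c) + (?m * [:0, inverse q:]) * row_gf q (k - j) $ c)"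
    unfolding sum_qshift_row_gf[OF q] by (simp only: distrib_left mult.assoc)
  also have "\<dots> = lift_ins q 0 (Suc k) c (smult (q ^ Suc k) (qshift q (monom a j)))"
    using monom unfolding lift_ins_smult sh lift_ins_add monom_times_lin
    by (subst (1 2) lift_ins_monom) (auto simp: Suc_diff_le simp del: row_gf.simps)
  finally show ?case .
next
  case (add p r)
  then show ?case
    by (simp add: lift_ins_add qshift_add smult_add_right sum.distrib lift_ins_smult)
qed

text \<open>As for a descent, except that with \<open>s = c\<close> nothing separates the first two
  letters and no descent arises; this term enters unshifted.\<close>

lemma lift_ins_ascent:
  assumes q: "q \<noteq> 0" and "degree p \<le> k"
  shows "lift_ins q 0 k c p + (\<Sum>s<c. smult (q ^ (Suc k + s)) (qshift q (lift_ins q 0 k s p))) =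
    lift_ins q 0 (Suc k) c p"
  using assms(2)
proof (induction rule: poly_degree_le_induct)
  case (monom a j)
  \<comment> \<open>\<open>qshift\<close> divides \<open>u^j\<close> by \<open>q^j\<close>, which
    lowers the exponent from the number of letters to the number of blocks.\<close>
  have pw: "q ^ (Suc k + s) * inverse q ^ j = q ^ (Suc (k - j) + s)" for s
  proof -
    have "q ^ (Suc k + s) = q ^ (Suc (k - j) + s) * q ^ j"
      using monom by (simp flip: power_add)
    with q show ?thesis by (simp add: power_inverse)
  qed
  have sh: "smult (q ^ (Suc k + s)) (qshift q (monom a j * row_gf q (k - j) $ s)) =
     monom a j * smult (q ^ (Suc (k - j) + s)) (qshift q (row_gf q (k - j) $ s))" for s
    unfolding qshift_monom_mult pw[symmetric] by (simp add: smult_monom mult_ac flip: mult_smult_left)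
  have "lift_ins q 0 k c (monom a j) + (\<Sum>s<c. smult (q ^ (Suc k + s)) (qshift q (lift_ins q 0 k s (monom a j)))) =
     monom a j * (row_gf q (k - j) $ c + (\<Sum>s<c. smult (q ^ (Suc (k - j) + s)) (qshift q (row_gf q (k - j) $ s))))"
    unfolding lift_ins_monom[OF monom] using sh by (simp add: distrib_left sum_distrib_left)
  also have "\<dots> = lift_ins q 0 (Suc k) c (monom a j)"
    unfolding row_gf_Suc_shift[OF q, symmetric]
    using monom by (subst lift_ins_monom) (auto simp: Suc_diff_le simp del: row_gf.simps)
  finally show ?case .
next
  case (add p r)
  show ?case
    unfolding lift_ins_add qshift_add smult_add_right sum.distrib add[symmetric] by (simp only: add_ac)
qed

text \<open>Prefixing a letter on the inversion side; \<open>g\<close> and \<open>h\<close> are its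
  unmarked and marked weights. The mark survives only if no copy directly follows, and a marked
  letter ignores the \<open>s\<close> copies on its left. If \<open>c - i > 0\<close> copies follow,
  the last of them starts a descent and has nothing larger on its left, hence the weight
  \<open>1 + u/q\<close>, and all of them join the copies standing to the left of the rest.\<close>

lemma lift_ins_context:
  assumes "degree p \<le> k"
  shows "[:q ^ s * g, h:] * lift_ins q s k c p
      + (\<Sum>i<c. smult (q ^ s * g) [:1, inverse q:] * lift_ins q (s + (c - i)) k i p) =
    lift_ins q s (Suc k) c ([:g, h:] * p)"
  using assms
proof (induction rule: poly_degree_le_induct)
  case (monom a j)
  let ?k = "Suc k - j" and ?m = "monom a j" and ?R = "\<lambda>i. row_gf q (k - j) $ i"
  have pw: "smult (q ^ s * g) [:1, inverse q:] * lift_ins q (s + (c - i)) k i ?m =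
     smult (q ^ (s * ?k)) (smult (q ^ s * g) ?m * (smult (q ^ ((c - i) * ?k)) [:1, inverse q:] * ?R i))" for i
    unfolding lift_ins_monom[OF monom] by (simp add: distrib_left distrib_right power_add mult_ac del: mult_pCons_left mult_pCons_right smult_pCons)
  have S: "Suc (k - j) = ?k" using monom by simp
  have "(\<Sum>i<c. smult (q ^ s * g) [:1, inverse q:] * lift_ins q (s + (c - i)) k i ?m) =
     smult (q ^ (s * ?k)) (smult (q ^ s * g) ?m * (\<Sum>i<c. (smult (q ^ ((c - i) * ?k)) [:1, inverse q:] * ?R i)))"
    unfolding pw by (simp only: sum_distrib_left smult_sum_right)
  moreover have "[:q ^ s * g, h:] * lift_ins q s k c ?m =
     smult (q ^ (s * ?k)) (smult (q ^ s * g) ?m * ?R c) + smult (q ^ (s * ?k)) (monom (a * h) (Suc j) * ?R c)"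
  proof -
    have 1: "[:q ^ s * g, h:] * (?m * ?R c) = (?m * [:q ^ s * g, h:]) * ?R c"
      by (simp only: mult_ac)
    have 2: "smult (q ^ s * g) ?m = monom (a * (q ^ s * g)) j"
      by (simp add: smult_monom mult.commute)
    show ?thesis
      unfolding lift_ins_monom[OF monom] mult_smult_right 1 2 monom_times_lin
      by (simp only: distrib_right smult_add_right)
  qed
  ultimately have "[:q ^ s * g, h:] * lift_ins q s k c ?m
      + (\<Sum>i<c. smult (q ^ s * g) [:1, inverse q:] * lift_ins q (s + (c - i)) k i ?m) =
      smult (q ^ (s * ?k)) (smult (q ^ s * g) ?m * (row_gf q ?k $ c)) + smult (q ^ (s * ?k)) (monom (a * h) (Suc j) * ?R c)"
    unfolding S[symmetric] row_gf_Suc_conv by (simp only: distrib_left smult_add_right ac_simps)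
  also have "\<dots> = lift_ins q s (Suc k) c (?m * [:g, h:])"
  proof -
    have 1: "lift_ins q s (Suc k) c (monom (a * g) j) =
        smult (q ^ (s * Suc ?k)) (monom (a * g) j * row_gf q ?k $ c)"
      using monom by (subst lift_ins_monom) (simp_all only: le_Suc_eq simp_thms Suc_diff_le le_SucI)
    have 2: "lift_ins q s (Suc k) c (monom (a * h) (Suc j)) =
        smult (q ^ (s * ?k)) (monom (a * h) (Suc j) * ?R c)"
      using monom by (subst lift_ins_monom) (simp_all only: Suc_le_mono diff_Suc_Suc)
    have 3: "smult (q ^ (s * ?k)) (smult (q ^ s * g) ?m * (row_gf q ?k $ c)) =
        smult (q ^ (s * Suc ?k)) (monom (a * g) j * row_gf q ?k $ c)"
    proof -
      have g: "monom (a * g) j = smult g ?m" by (simp add: smult_monom mult.commute)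
      have c: "q ^ (s * ?k) * (q ^ s * g) = q ^ (s * Suc ?k) * g" by (simp add: power_add)
      show ?thesis unfolding g mult_smult_left smult_smult c ..
    qed
    show ?thesis
      unfolding monom_times_lin lift_ins_add 1 2 3 ..
  qed
  finally show ?case by (simp only: mult.commute[of "[:g, h:]"])
next
  case (add p r)
  then show ?case
    by (simp add: lift_ins_add distrib_left sum.distrib algebra_simps del: mult_pCons_left mult_pCons_right smult_pCons)
qed

section \<open>Inversions and the major index of words with a fixed first letter\<close>

text \<open>Read from the left end, a descent between \<open>a\<close> and \<open>b\<close> has
  \<open>length (b # w)\<close> letters after it, which is its contribution \<open>n - i\<close> to
  the reverse major index; \<open>qshift\<close> supplies the additional factor in
  \<open>u\<close>.\<close>

fun maj_poly :: "'a::field \<Rightarrow> nat list \<Rightarrow> 'a poly" where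
  "maj_poly q (a # b # w) =
     (if b < a then smult (q ^ length (b # w)) (qshift q (maj_poly q (b # w))) else maj_poly q (b # w))"
| "maj_poly q w = 1"

text \<open>\<open>L\<close> is the content of the part of the word to the left of the given suffix.\<close>

fun inv_poly :: "'a::field \<Rightarrow> nat multiset \<Rightarrow> nat list \<Rightarrow> 'a poly" where
  "inv_poly q L (a # b # w) =
     [:q ^ size {#x \<in># L. a < x#}, if b < a then inverse q else 0:] * inv_poly q (add_mset a L) (b # w)"
| "inv_poly q L [a] = [:q ^ size {#x \<in># L. a < x#}:]"
| "inv_poly q L [] = 1"

section \<open>Inserting copies of a largest letter into words\<close>

definition insertions :: "nat \<Rightarrow> nat list \<Rightarrow> nat \<Rightarrow> nat list set" where
  "insertions N w c = {v. filter (\<lambda>x. x \<noteq> N) v = w \<and> count_list v N = c}"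

lemma count_list_conv_filter: "count_list v N = length (filter (\<lambda>x. x = N) v)"
  by (induction v) auto

lemma count_list_replicate_self: "count_list (replicate c x) x = c"
  by (induction c) auto

lemma size_filter_less_replicate:
  "(a :: nat) < N \<Longrightarrow> size {#x \<in># replicate_mset s N + L. a < x#} = s + size {#x \<in># L. a < x#}"
  by (induction s) auto

lemma insertions_length: "v \<in> insertions N w c \<Longrightarrow> length v = length w + c"
  using sum_length_filter_compl[of "\<lambda>x. x = N" v]
  by (auto simp: insertions_def count_list_conv_filter)

lemma insertions_Nil: "insertions N [] c = {replicate c N}"
proof -
  have "v = replicate (count_list v N) N" if "filter (\<lambda>x. x \<noteq> N) v = []" for v
    using that by (induction v) (auto split: if_splits)
  then show ?thesis by (auto simp: insertions_def count_list_replicate_self)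
qed

lemma finite_insertions [simp]: "finite (insertions N w c)"
proof (rule finite_subset)
  show "insertions N w c \<subseteq> {v. set v \<subseteq> insert N (set w) \<and> length v = length w + c}"
    using insertions_length by (fastforce simp: insertions_def)
qed (simp add: finite_lists_length_eq)

text \<open>Unique decomposition by the run of \<open>c - s\<close> copies of \<open>N\<close> in
  front of \<open>b\<close>.\<close>

lemma sum_insertions_Cons:
  assumes b: "b \<noteq> N"
  shows "sum f (insertions N (b # w) c) =
    (\<Sum>s\<le>c. \<Sum>v\<in>insertions N w s. f (replicate (c - s) N @ b # v))"
proof -
  have "sum f (insertions N (b # w) c) =
     (\<Sum>(s, v)\<in>(SIGMA s:{..c}. insertions N w s). f (replicate (c - s) N @ b # v))"
  proof (rule sum.reindex_bij_witness[where
        i = "\<lambda>(s, v). replicate (c - s) N @ b # v" and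
        j = "\<lambda>v. (count_list (dropWhile (\<lambda>x. x = N) v) N, tl (dropWhile (\<lambda>x. x = N) v))"])
    fix v assume v: "v \<in> insertions N (b # w) c"
    define k where "k = length (takeWhile (\<lambda>x. x = N) v)"
    have tw: "takeWhile (\<lambda>x. x = N) v = replicate k N"
      unfolding k_def by (metis (mono_tags, lifting) replicate_eqI set_takeWhileD)
    have "v = replicate k N @ dropWhile (\<lambda>x. x = N) v"
      using tw by (metis takeWhile_dropWhile_id)
    moreover obtain b' u where d: "dropWhile (\<lambda>x. x = N) v = b' # u" "b' \<noteq> N"
    proof -
      have "dropWhile (\<lambda>x. x = N) v \<noteq> []"
      proof
        assume "dropWhile (\<lambda>x. x = N) v = []"
        then have "filter (\<lambda>x. x \<noteq> N) v = []" by (auto simp: filter_empty_conv)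
        with v show False by (simp add: insertions_def)
      qed
      then show ?thesis using that hd_dropWhile[of "\<lambda>x. x = N" v]
        by (cases "dropWhile (\<lambda>x. x = N) v") auto
    qed
    ultimately have vv: "v = replicate k N @ b' # u" by simp
    note cr = count_list_replicate_self[of k N]
    have "b' = b" "filter (\<lambda>x. x \<noteq> N) u = w" "count_list u N + k = c"
      using v d(2) cr unfolding vv insertions_def by auto
    then show "(case (count_list (dropWhile (\<lambda>x. x = N) v) N, tl (dropWhile (\<lambda>x. x = N) v)) of
        (s, v) \<Rightarrow> replicate (c - s) N @ b # v) = v"
      "(count_list (dropWhile (\<lambda>x. x = N) v) N, tl (dropWhile (\<lambda>x. x = N) v))
         \<in> (SIGMA s:{..c}. insertions N w s)"
      "(case (count_list (dropWhile (\<lambda>x. x = N) v) N, tl (dropWhile (\<lambda>x. x = N) v)) of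
        (s, v) \<Rightarrow> f (replicate (c - s) N @ b # v)) = f v"
      using d vv b by (auto simp: insertions_def)
  next
    fix sv assume "sv \<in> (SIGMA s:{..c}. insertions N w s)"
    then obtain s v where sv: "sv = (s, v)" "s \<le> c" "v \<in> insertions N w s" by auto
    note cr = count_list_replicate_self[of "c - s" N]
    have dw: "dropWhile (\<lambda>x. x = N) (replicate i N @ b # v) = b # v" for i
      using b by (induction i) auto
    show "(count_list (dropWhile (\<lambda>x. x = N) (case sv of (s, v) \<Rightarrow> replicate (c - s) N @ b # v)) N,
            tl (dropWhile (\<lambda>x. x = N) (case sv of (s, v) \<Rightarrow> replicate (c - s) N @ b # v))) = sv"
      "(case sv of (s, v) \<Rightarrow> replicate (c - s) N @ b # v) \<in> insertions N (b # w) c"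
      using sv dw cr b by (auto simp: insertions_def)
  qed
  then show ?thesis by (simp add: sum.Sigma)
qed

lemma maj_poly_replicate: "a \<le> N \<Longrightarrow> maj_poly q (a # replicate c N) = 1"
  by (induction c arbitrary: a) auto

lemma maj_poly_replicate_append:
  assumes "b < N"
  shows "maj_poly q (replicate (Suc i) N @ b # v) =
    smult (q ^ Suc (length v)) (qshift q (maj_poly q (b # v)))"
  using assms by (induction i) auto

lemma degree_qshift: "degree (qshift q p) \<le> Suc (degree p)"
proof -
  have "degree (qshift q p) \<le> degree [:1, inverse q:] + degree (pcompose p [:0, inverse q:])"
    unfolding qshift_def by (rule degree_mult_le)
  also have "\<dots> \<le> 1 + degree p * 1"
    by (intro add_mono order.trans[OF degree_pcompose_le] mult_left_mono) auto
  finally show ?thesis by simp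
qed

lemma degree_maj_poly: "degree (maj_poly q (a # w)) \<le> length w"
proof (induction w arbitrary: a)
  case (Cons b w)
  have "degree (smult (q ^ length (b # w)) (qshift q (maj_poly q (b # w)))) \<le> Suc (length w)"
    using degree_smult_le degree_qshift[of q "maj_poly q (b # w)"] Cons[of b]
    by (meson Suc_le_mono order.trans)
  then show ?case using Cons[of b] by auto
qed simp

lemma degree_inv_poly: "degree (inv_poly q L (a # w)) \<le> length w"
proof (induction w arbitrary: a L)
  case (Cons b w)
  have "degree (inv_poly q L (a # b # w)) \<le> 1 + length w"
    unfolding inv_poly.simps
    by (intro order.trans[OF degree_mult_le] add_mono Cons) auto
  then show ?case by simp
qed simp

text \<open>Induction along the word, with \<open>lift_ins_descent\<close> or
  \<open>lift_ins_ascent\<close> according to the first two letters.\<close>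

lemma sum_insertions_maj_poly:
  assumes q: "q \<noteq> 0" and "a < N" "\<forall>x\<in>set w. x < N"
  shows "(\<Sum>v\<in>insertions N w c. maj_poly q (a # v)) = lift_ins q 0 (length w) c (maj_poly q (a # w))"
  using assms(2,3)
proof (induction w arbitrary: a c)
  case Nil
  have "lift_ins q 0 0 c (monom 1 0) = 1"
    by (subst lift_ins_monom) (simp_all add: monom_0)
  with Nil show ?case
    by (simp add: insertions_Nil maj_poly_replicate monom_0 one_pCons)
next
  case (Cons b w)
  let ?k = "length w" and ?p = "maj_poly q (b # w)"
  have bN: "b < N" and IH: "(\<Sum>v\<in>insertions N w s. maj_poly q (b # v)) = lift_ins q 0 ?k s ?p" for s
    using Cons by auto
  \<comment> \<open>A nonempty run of \<open>N\<close> between \<open>a\<close> and \<open>b\<close>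
    replaces the possible descent at \<open>a\<close> by one just before \<open>b\<close>, so
    \<open>a\<close> leaves no trace here.\<close>
  have T: "(\<Sum>v\<in>insertions N w s. maj_poly q (a # replicate (c - s) N @ b # v)) =
     smult (q ^ (Suc ?k + s)) (qshift q (lift_ins q 0 ?k s ?p))" if sc: "s < c" for s
  proof -
    obtain i where i: "c - s = Suc i" using sc by (metis zero_less_diff gr0_implies_Suc)
    have "(\<Sum>v\<in>insertions N w s. maj_poly q (a # replicate (c - s) N @ b # v)) =
       (\<Sum>v\<in>insertions N w s. smult (q ^ (Suc ?k + s)) (qshift q (maj_poly q (b # v))))"
      unfolding i using Cons.prems maj_poly_replicate_append[OF bN, of q i]
      by (intro sum.cong) (auto dest!: insertions_length)
    also have "\<dots> = smult (q ^ (Suc ?k + s)) (qshift q (lift_ins q 0 ?k s ?p))"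
      unfolding IH[symmetric] smult_sum_right[symmetric]
      by (simp add: qshift_def pcompose_sum sum_distrib_left del: mult_pCons_left)
    finally show ?thesis .
  qed
  have eq: "(\<Sum>v\<in>insertions N (b # w) c. maj_poly q (a # v)) =
     (\<Sum>v\<in>insertions N w c. maj_poly q (a # b # v))
     + (\<Sum>s<c. smult (q ^ (Suc ?k + s)) (qshift q (lift_ins q 0 ?k s ?p)))"
    using bN T by (simp add: sum_insertions_Cons lessThan_Suc_atMost[symmetric])
  have deg: "degree ?p \<le> ?k" by (rule degree_maj_poly)
  show ?case
  proof (cases "b < a")
    case True
    have "(\<Sum>v\<in>insertions N w c. maj_poly q (a # b # v)) =
      (\<Sum>v\<in>insertions N w c. smult (q ^ (Suc ?k + c)) (qshift q (maj_poly q (b # v))))"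
      using True by (intro sum.cong) (auto dest!: insertions_length)
    also have "\<dots> = smult (q ^ (Suc ?k + c)) (qshift q (lift_ins q 0 ?k c ?p))"
      unfolding IH[symmetric] smult_sum_right[symmetric]
      by (simp add: qshift_def pcompose_sum sum_distrib_left del: mult_pCons_left)
    finally show ?thesis
      using True lift_ins_descent[OF q deg, of c] unfolding eq
      by (simp add: lessThan_Suc_atMost[symmetric] add.commute)
  next
    case False
    have "(\<Sum>v\<in>insertions N w c. maj_poly q (a # b # v)) = lift_ins q 0 ?k c ?p"
      using False IH[of c] by simp
    then have "(\<Sum>v\<in>insertions N (b # w) c. maj_poly q (a # v)) = lift_ins q 0 (Suc ?k) c ?p"
      unfolding eq by (simp only: lift_ins_ascent[OF q deg])
    with False show ?thesis by simp
  qed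
qed

lemma inv_poly_replicate:
  assumes "\<forall>x\<in>#L. x \<le> N"
  shows "inv_poly q L (replicate c N) = 1"
  using assms
proof (induction c arbitrary: L)
  case (Suc c)
  have e: "{#x \<in># L. N < x#} = {#}" using Suc.prems by (auto simp: filter_mset_eq_conv)
  then show ?case using Suc.IH[of "add_mset N L"] Suc.prems
    by (cases c) (auto simp: one_pCons e)
qed simp

lemma inv_poly_replicate_append:
  assumes "b < N" "\<forall>x\<in>#L. x \<le> N"
  shows "inv_poly q L (replicate (Suc i) N @ b # v) =
    [:1, inverse q:] * inv_poly q (replicate_mset (Suc i) N + L) (b # v)"
  using assms(2)
proof (induction i arbitrary: L)
  case 0
  have e: "{#x \<in># L. N < x#} = {#}" using 0 by (auto simp: filter_mset_eq_conv)
  then show ?case using assms(1) by (simp add: e)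
next
  case (Suc i)
  have e: "{#x \<in># L. N < x#} = {#}" using Suc.prems by (auto simp: filter_mset_eq_conv)
  then show ?case using Suc.IH[of "add_mset N L"] Suc.prems by (simp add: one_pCons e)
qed

text \<open>The \<open>s\<close> copies of \<open>N\<close> in the context are a necessary
  generalisation: a run of \<open>N\<close> put behind the first letter becomes part of the context
  of the remaining word.\<close>

lemma sum_insertions_inv_poly:
  assumes "a < N" "\<forall>x\<in>set w. x < N" "\<forall>x\<in>#L. x < N"
  shows "(\<Sum>v\<in>insertions N w c. inv_poly q (replicate_mset s N + L) (a # v)) =
    lift_ins q s (length w) c (inv_poly q L (a # w))"
  using assms
proof (induction w arbitrary: a c L s)
  case Nil
  let ?g = "size {#x \<in># L. a < x#}"
  have g: "size {#x \<in># replicate_mset s N + L. a < x#} = s + ?g"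
    using Nil.prems(1) by (rule size_filter_less_replicate)
  have "inv_poly q (replicate_mset s N + L) (a # replicate c N) = [:q ^ (s + ?g):]"
  proof (cases c)
    case (Suc d)
    have "inv_poly q (add_mset a (replicate_mset s N + L)) (replicate c N) = 1"
      using Nil by (intro inv_poly_replicate) (auto simp: less_imp_le)
    then show ?thesis using Nil g Suc by simp
  qed (use g in simp)
  moreover have "lift_ins q s 0 c (monom (q ^ ?g) 0) = [:q ^ (s + ?g):]"
    by (subst lift_ins_monom) (simp_all add: monom_0 power_add)
  ultimately show ?case by (simp add: insertions_Nil monom_0)
next
  case (Cons b w)
  let ?g = "size {#x \<in># L. a < x#}" and ?k = "length w" and ?p = "inv_poly q (add_mset a L) (b # w)"
  let ?h = "if b < a then inverse q else 0"
  have g: "size {#x \<in># replicate_mset s N + L. a < x#} = s + ?g"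
    using Cons.prems(1) by (rule size_filter_less_replicate)
  have bN: "b < N" using Cons by simp
  have IH: "(\<Sum>v\<in>insertions N w i. inv_poly q (replicate_mset r N + add_mset a L) (b # v)) =
      lift_ins q r ?k i ?p" for i r
    by (rule Cons.IH) (use Cons.prems in auto)
  have T: "(\<Sum>v\<in>insertions N w i. inv_poly q (replicate_mset s N + L) (a # replicate (c - i) N @ b # v)) =
     smult (q ^ s * q ^ ?g) [:1, inverse q:] * lift_ins q (s + (c - i)) ?k i ?p" if sc: "i < c" for i
  proof -
    obtain d where d: "c - i = Suc d" using sc by (metis zero_less_diff gr0_implies_Suc)
    have "inv_poly q (replicate_mset s N + L) (a # replicate (c - i) N @ b # v) =
       smult (q ^ s * q ^ ?g) [:1, inverse q:] *
         inv_poly q (replicate_mset (s + (c - i)) N + add_mset a L) (b # v)" for v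
    proof -
      have "inv_poly q (replicate_mset s N + L) (a # replicate (c - i) N @ b # v) =
         [:q ^ (s + ?g):] * inv_poly q (add_mset a (replicate_mset s N + L)) (replicate (Suc d) N @ b # v)"
        unfolding d using Cons.prems g by simp
      also have "\<dots> = [:q ^ (s + ?g):] * ([:1, inverse q:] *
          inv_poly q (replicate_mset (Suc d) N + add_mset a (replicate_mset s N + L)) (b # v))"
        using bN Cons.prems by (subst inv_poly_replicate_append) (auto simp: less_imp_le)
      also have "replicate_mset (Suc d) N + add_mset a (replicate_mset s N + L) =
          replicate_mset (s + (c - i)) N + add_mset a L"
        unfolding d by (simp add: multiset_eq_iff)
      finally show ?thesis
        by (simp only: mult.assoc[symmetric]) (simp add: power_add mult.commute[of _ "inverse q"])
    qed
    then show ?thesis by (simp only: sum_distrib_left[symmetric] IH)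
  qed
  have "(\<Sum>v\<in>insertions N (b # w) c. inv_poly q (replicate_mset s N + L) (a # v)) =
     (\<Sum>v\<in>insertions N w c. inv_poly q (replicate_mset s N + L) (a # b # v))
     + (\<Sum>i<c. smult (q ^ s * q ^ ?g) [:1, inverse q:] * lift_ins q (s + (c - i)) ?k i ?p)"
    using bN T by (simp add: sum_insertions_Cons lessThan_Suc_atMost[symmetric] del: mult_pCons_left smult_pCons inv_poly.simps)
  also have "(\<Sum>v\<in>insertions N w c. inv_poly q (replicate_mset s N + L) (a # b # v)) =
     [:q ^ s * q ^ ?g, ?h:] * lift_ins q s ?k c ?p"
    by (simp only: inv_poly.simps g power_add sum_distrib_left[symmetric] IH[symmetric]
        union_mset_add_mset_right)
  also have "[:q ^ s * q ^ ?g, ?h:] * lift_ins q s ?k c ?p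
     + (\<Sum>i<c. smult (q ^ s * q ^ ?g) [:1, inverse q:] * lift_ins q (s + (c - i)) ?k i ?p) =
     lift_ins q s (Suc ?k) c ([:q ^ ?g, ?h:] * ?p)"
    by (rule lift_ins_context) (rule degree_inv_poly)
  finally show ?case by simp
qed

section \<open>Equidistribution for a fixed first letter\<close>

lemma mset_eq_iff_insertion:
  "mset v = M \<longleftrightarrow>
    mset (filter (\<lambda>x. x \<noteq> N) v) = filter_mset (\<lambda>x. x \<noteq> N) M \<and> count_list v N = count M N"
proof -
  have "mset v = M \<longleftrightarrow>
    filter_mset (\<lambda>x. x \<noteq> N) (mset v) = filter_mset (\<lambda>x. x \<noteq> N) M \<and> count (mset v) N = count M N"
    by (auto simp: multiset_eq_iff)
  moreover have "count (mset v) N = count_list v N"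
    by (induction v) auto
  ultimately show ?thesis by simp
qed

lemma sum_permutations_insertions:
  "(\<Sum>v\<in>permutations_of_multiset M. f v) =
   (\<Sum>w\<in>permutations_of_multiset (filter_mset (\<lambda>x. x \<noteq> N) M). \<Sum>v\<in>insertions N w (count M N). f v)"
proof -
  let ?S = "permutations_of_multiset M" and ?T = "permutations_of_multiset (filter_mset (\<lambda>x. x \<noteq> N) M)"
  have "(\<Sum>v\<in>?S. f v) = (\<Sum>w\<in>?T. \<Sum>v\<in>{v \<in> ?S. filter (\<lambda>x. x \<noteq> N) v = w}. f v)"
  proof (rule sum.group[symmetric])
    show "filter (\<lambda>x. x \<noteq> N) ` ?S \<subseteq> ?T" by (auto simp: permutations_of_multiset_def)
  qed simp_all
  also have "\<dots> = (\<Sum>w\<in>?T. \<Sum>v\<in>insertions N w (count M N). f v)"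
  proof (intro sum.cong refl)
    fix w assume "w \<in> ?T"
    then show "{v \<in> ?S. filter (\<lambda>x. x \<noteq> N) v = w} = insertions N w (count M N)"
      by (auto simp: permutations_of_multiset_def insertions_def mset_eq_iff_insertion[of _ M N])
  qed
  finally show ?thesis .
qed

definition equidistributed :: "'a::field \<Rightarrow> nat \<Rightarrow> nat multiset \<Rightarrow> bool" where
  "equidistributed q a M \<longleftrightarrow>
     (\<Sum>w\<in>permutations_of_multiset M. inv_poly q {#} (a # w)) =
     (\<Sum>w\<in>permutations_of_multiset M. maj_poly q (a # w))"

text \<open>Both sums arise from those for the letters other than \<open>N\<close> by the same
  \<open>lift_ins\<close>, whose parameters depend only on the number of these letters and the
  multiplicity of \<open>N\<close>; by linearity, equality is inherited.\<close>

lemma equidistributed_insert_max: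
  assumes q: "q \<noteq> 0" and aN: "a < N" and M: "\<forall>x\<in>#M. x \<le> N"
    and eq: "equidistributed q a (filter_mset (\<lambda>x. x \<noteq> N) M)"
  shows "equidistributed q a M"
proof -
  let ?M = "filter_mset (\<lambda>x. x \<noteq> N) M" and ?c = "count M N"
  have lt: "\<forall>x\<in>set w. x < N" "length w = size ?M" if "w \<in> permutations_of_multiset ?M" for w
  proof -
    have w: "mset w = ?M" using that by (simp add: permutations_of_multiset_def)
    then have "set w = set_mset ?M" by (metis set_mset_mset)
    then show "\<forall>x\<in>set w. x < N" using M by (auto simp: order.strict_iff_order)
    show "length w = size ?M" using w by (metis size_mset)
  qed
  have "(\<Sum>v\<in>permutations_of_multiset M. inv_poly q {#} (a # v)) =
     (\<Sum>w\<in>permutations_of_multiset ?M. lift_ins q 0 (size ?M) ?c (inv_poly q {#} (a # w)))"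
    unfolding sum_permutations_insertions[of _ M N]
    using lt aN sum_insertions_inv_poly[of a N _ "{#}" q 0] by (intro sum.cong) auto
  also have "\<dots> = (\<Sum>w\<in>permutations_of_multiset ?M. lift_ins q 0 (size ?M) ?c (maj_poly q (a # w)))"
    using eq by (simp add: equidistributed_def flip: lift_ins_sum)
  also have "\<dots> = (\<Sum>v\<in>permutations_of_multiset M. maj_poly q (a # v))"
    unfolding sum_permutations_insertions[of _ M N]
    using lt sum_insertions_maj_poly[OF q aN] by (intro sum.cong) auto
  finally show ?thesis by (simp add: equidistributed_def)
qed

lemma equidistributed_empty: "equidistributed q a {#}"
  by (simp add: equidistributed_def one_pCons)

lemma size_filter_neq_less:
  assumes "N \<in># M"
  shows "size (filter_mset (\<lambda>x. x \<noteq> N) M) < size M"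
proof (rule mset_subset_size)
  have "N \<notin># filter_mset (\<lambda>x. x \<noteq> N) M" by simp
  with assms have "filter_mset (\<lambda>x. x \<noteq> N) M \<noteq> M" by metis
  then show "filter_mset (\<lambda>x. x \<noteq> N) M \<subset># M"
    by (simp add: subset_mset.less_le)
qed

text \<open>The sentinel 0 lies below every letter of \<open>M\<close>, so the largest letter can be
  removed until nothing is left. In front of a positive word it creates neither a descent nor an
  inversion, so this is a statement about unrestricted rearrangements.\<close>

lemma equidistributed_0:
  assumes q: "q \<noteq> 0" and "\<forall>x\<in>#M. 0 < x"
  shows "equidistributed q 0 M"
  using assms(2)
proof (induction "size M" arbitrary: M rule: less_induct)
  case less
  show ?case
  proof (cases "M = {#}")
    case False
    define N where "N = Max (set_mset M)"
    have N: "N \<in># M" "\<forall>x\<in>#M. x \<le> N" using False by (simp_all add: N_def)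
    have "equidistributed q 0 (filter_mset (\<lambda>x. x \<noteq> N) M)"
      using less.prems by (intro less.hyps size_filter_neq_less N) auto
    moreover have "0 < N" using N less.prems by simp
    ultimately show ?thesis by (intro equidistributed_insert_max[OF q _ N(2)])
  qed (simp add: equidistributed_empty)
qed

lemma maj_poly_0_Cons: "maj_poly q (0 # w) = maj_poly q w"
  by (cases w) auto

lemma inv_poly_context_0: "\<forall>x\<in>set w. 0 < x \<Longrightarrow> inv_poly q (add_mset 0 L) w = inv_poly q L w"
  by (induction q L w rule: inv_poly.induct) (simp_all add: add_mset_commute)

lemma inv_poly_0_Cons: "\<forall>x\<in>set w. 0 < x \<Longrightarrow> inv_poly q {#} (0 # w) = inv_poly q {#} w"
  using inv_poly_context_0[of w q "{#}"] by (cases w) (auto simp: one_pCons)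

lemma sum_permutations_Cons:
  assumes "M \<noteq> {#}"
  shows "(\<Sum>w\<in>permutations_of_multiset M. f w) =
    (\<Sum>b\<in>set_mset M. \<Sum>w\<in>permutations_of_multiset (M - {#b#}). f (b # w))"
  unfolding permutations_of_multiset_nonempty[OF assms]
  by (subst sum.UNION_disjoint) (auto simp: sum.reindex)

text \<open>When \<open>a\<close> is a largest letter, the identity for the words starting with \<open>a\<close> is the identity for
  all words with the same content minus the identities for the words starting with a smaller letter.\<close>

lemma equidistributed:
  assumes q: "q \<noteq> 0" and "0 < a" "\<forall>x\<in>#M. 0 < x"
  shows "equidistributed q a M"
  using assms(2,3)
proof (induction "size M" arbitrary: a M rule: less_induct)
  case less
  show ?case
  proof (cases "\<exists>x\<in>#M. a < x")
    case True
    define N where "N = Max (set_mset M)"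
    have N: "N \<in># M" "\<forall>x\<in>#M. x \<le> N" using True by (auto simp: N_def intro!: Max_in)
    have "a < N" using True N(2) by auto
    moreover have "equidistributed q a (filter_mset (\<lambda>x. x \<noteq> N) M)"
      using less.prems by (intro less.hyps size_filter_neq_less N) auto
    ultimately show ?thesis by (intro equidistributed_insert_max[OF q _ N(2)])
  next
    case False
    let ?M = "add_mset a M"
    define X where "X p b = (\<Sum>w\<in>permutations_of_multiset (?M - {#b#}). p (b # w))" for p :: "nat list \<Rightarrow> 'a poly" and b
    have split: "(\<Sum>w\<in>permutations_of_multiset ?M. p w) = X p a + (\<Sum>b\<in>set_mset M - {a}. X p b)" for p
    proof -
      have "(\<Sum>w\<in>permutations_of_multiset ?M. p w) = (\<Sum>b\<in>set_mset ?M. X p b)"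
        unfolding X_def by (rule sum_permutations_Cons) simp
      also have "\<dots> = X p a + (\<Sum>b\<in>set_mset ?M - {a}. X p b)"
        by (rule sum.remove) auto
      finally show ?thesis by simp
    qed
    have pos: "\<forall>x\<in>set w. 0 < x" if "w \<in> permutations_of_multiset ?M" for w
    proof -
      have "mset w = ?M" using that by (simp add: permutations_of_multiset_def)
      then have "set w = set_mset ?M" by (metis set_mset_mset)
      with less.prems show ?thesis by simp
    qed
    have "equidistributed q 0 ?M"
      by (rule equidistributed_0[OF q]) (use less.prems in auto)
    then have total: "(\<Sum>w\<in>permutations_of_multiset ?M. inv_poly q {#} w) =
        (\<Sum>w\<in>permutations_of_multiset ?M. maj_poly q w)"
      using pos by (simp add: equidistributed_def maj_poly_0_Cons inv_poly_0_Cons)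
    have "X (inv_poly q {#}) b = X (maj_poly q) b" if b: "b \<in> set_mset M - {a}" for b
    proof -
      have "b < a" using False b by fastforce
      have "equidistributed q b (?M - {#b#})"
      proof (rule equidistributed_insert_max[OF q \<open>b < a\<close>])
        show "\<forall>x\<in>#?M - {#b#}. x \<le> a"
          using False by (auto dest!: in_diffD simp: not_less)
        \<comment> \<open>\<open>?M - {#b#}\<close> has the same size as \<open>M\<close>; only
          after the copies of \<open>a\<close> are stripped does the induction hypothesis
          apply.\<close>
        have "size (filter_mset (\<lambda>x. x \<noteq> a) (?M - {#b#})) \<le> size (M - {#b#})"
        proof -
          have "?M - {#b#} = add_mset a (M - {#b#})" using b by simp
          then show ?thesis
            using size_filter_mset_lesseq[of "\<lambda>x. x \<noteq> a" "M - {#b#}"] by (simp del: filter_diff_mset)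
        qed
        also have "\<dots> < size M" using b by (simp add: size_Diff1_less)
        finally show "equidistributed q b (filter_mset (\<lambda>x. x \<noteq> a) (?M - {#b#}))"
          using b less by (intro less.hyps) (auto dest!: in_diffD)
      qed
      then show ?thesis by (simp add: X_def equidistributed_def)
    qed
    then have "X (inv_poly q {#}) a = X (maj_poly q) a"
      using total split[of "inv_poly q {#}"] split[of "maj_poly q"] by simp
    then show ?thesis by (simp add: X_def equidistributed_def)
  qed
qed

section \<open>Reduction to descent sets\<close>

definition drops :: "nat list \<Rightarrow> nat set" where
  "drops w = {i. Suc i < length w \<and> w ! Suc i < w ! i}"

lemma finite_drops [simp]: "finite (drops w)"
  by (rule finite_subset[of _ "{..<length w}"]) (auto simp: drops_def)

lemma drops_Cons_Cons: "drops (a # b # w) = (if b < a then {0} else {}) \<union> Suc ` drops (b # w)"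
proof (rule set_eqI)
  fix i
  show "i \<in> drops (a # b # w) \<longleftrightarrow> i \<in> (if b < a then {0} else {}) \<union> Suc ` drops (b # w)"
    by (cases i) (auto simp: drops_def)
qed

lemma Des_drop:
  assumes "length \<sigma> = n" "m < n"
  shows "Des \<sigma> \<inter> {m+1..n} = (\<lambda>i. Suc (m + i)) ` drops (drop m \<sigma>)"
proof (rule set_eqI)
  fix k
  show "k \<in> Des \<sigma> \<inter> {m+1..n} \<longleftrightarrow> k \<in> (\<lambda>i. Suc (m + i)) ` drops (drop m \<sigma>)"
  proof
    assume "k \<in> Des \<sigma> \<inter> {m+1..n}"
    then have "k = Suc (m + (k - Suc m))" "k - Suc m \<in> drops (drop m \<sigma>)"
      using assms by (auto simp: Des_def drops_def letter_def)
    then show "k \<in> (\<lambda>i. Suc (m + i)) ` drops (drop m \<sigma>)" by blast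
  next
    assume "k \<in> (\<lambda>i. Suc (m + i)) ` drops (drop m \<sigma>)"
    then show "k \<in> Des \<sigma> \<inter> {m+1..n}"
      using assms by (auto simp: Des_def drops_def letter_def)
  qed
qed

lemma poly_maj_poly:
  assumes q: "q \<noteq> 0"
  shows "poly (maj_poly q w) u =
    q ^ (\<Sum>i\<in>drops w. length w - Suc i) * (\<Prod>i = 1..card (drops w). 1 + u * q powi (- int i))"
proof (induction w arbitrary: u rule: induct_list012)
  case (3 a b w)
  let ?D = "drops (b # w)"
  have S: "(\<Sum>i\<in>Suc ` ?D. length (a # b # w) - Suc i) = (\<Sum>i\<in>?D. length (b # w) - Suc i)"
    by (simp add: sum.reindex)
  have C: "card (Suc ` ?D) = card ?D" by (simp add: card_image)
  show ?case
  proof (cases "b < a")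
    case True
    have "poly (maj_poly q (a # b # w)) u =
      q ^ length (b # w) * ((1 + u * inverse q) * poly (maj_poly q (b # w)) (u * inverse q))"
      using True by (simp add: qshift_def poly_pcompose algebra_simps)
    also have "(1 + u * inverse q) * poly (maj_poly q (b # w)) (u * inverse q) =
       q ^ (\<Sum>i\<in>?D. length (b # w) - Suc i) *
         ((1 + u * inverse q) * (\<Prod>i = 1..card ?D. 1 + u * inverse q * q powi (- int i)))"
      unfolding 3 by (simp only: mult_ac)
    also have "(1 + u * inverse q) * (\<Prod>i = 1..card ?D. 1 + u * inverse q * q powi (- int i)) =
       (\<Prod>i = 1..Suc (card ?D). 1 + u * q powi (- int i))"
    proof -
      have "(\<Prod>i = 1..Suc (card ?D). 1 + u * q powi (- int i)) =
         (1 + u * q powi (- int 1)) * (\<Prod>i = Suc 1..Suc (card ?D). 1 + u * q powi (- int i))"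
        by (rule prod.atLeast_Suc_atMost) simp
      also have "\<dots> = (1 + u * inverse q) * (\<Prod>i = 1..card ?D. 1 + u * q powi (- int (Suc i)))"
        unfolding prod.shift_bounds_cl_Suc_ivl by (simp add: power_int_minus)
      also have "(\<Prod>i = 1..card ?D. 1 + u * q powi (- int (Suc i))) =
          (\<Prod>i = 1..card ?D. 1 + u * inverse q * q powi (- int i))"
        using q by (intro prod.cong) (auto simp: power_int_minus power_int_def nat_add_distrib)
      finally show ?thesis by simp
    qed
    also have "Suc (card ?D) = card (drops (a # b # w))"
      unfolding drops_Cons_Cons using True C by (simp add: card_insert_if image_iff)
    also have "q ^ length (b # w) * (q ^ (\<Sum>i\<in>?D. length (b # w) - Suc i) * x) =
        q ^ (\<Sum>i\<in>drops (a # b # w). length (a # b # w) - Suc i) * x" for x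
      unfolding drops_Cons_Cons using True S by (subst sum.union_disjoint) (auto simp: power_add)
    finally show ?thesis .
  next
    case False
    then show ?thesis unfolding drops_Cons_Cons using S C 3(2) by (simp add: not_less)
  qed
qed (simp_all add: drops_def)

lemma poly_inv_poly:
  "poly (inv_poly q L w) u = (\<Prod>i<length w.
     q ^ (size {#x \<in># L. w ! i < x#} + card {j. j < i \<and> w ! i < w ! j})
     + (if i \<in> drops w then u / q else 0))"
proof (induction q L w rule: inv_poly.induct)
  case (1 q L a b w)
  let ?w = "b # w"
  have c: "card {j. j < Suc i \<and> ?w ! i < (a # ?w) ! j} =
      (if ?w ! i < a then 1 else 0) + card {j. j < i \<and> ?w ! i < ?w ! j}" for i
  proof -
    have "{j. j < Suc i \<and> ?w ! i < (a # ?w) ! j} =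
       (if ?w ! i < a then {0} else {}) \<union> Suc ` {j. j < i \<and> ?w ! i < ?w ! j}" (is "?A = ?B")
    proof (rule set_eqI)
      fix j show "j \<in> ?A \<longleftrightarrow> j \<in> ?B" by (cases j) auto
    qed
    then show ?thesis by (simp add: card_image card_insert_if)
  qed
  have d: "Suc i \<in> drops (a # ?w) \<longleftrightarrow> i \<in> drops ?w" "0 \<in> drops (a # ?w) \<longleftrightarrow> b < a" for i
    by (auto simp: drops_def)
  have e: "size {#x \<in># add_mset a L. ?w ! i < x#} + card {j. j < i \<and> ?w ! i < ?w ! j} =
     size {#x \<in># L. ?w ! i < x#} + card {j. j < Suc i \<and> ?w ! i < (a # ?w) ! j}" for i
    unfolding c by simp
  have "poly (inv_poly q L (a # ?w)) u = (q ^ size {#x \<in># L. a < x#} + (if b < a then u / q else 0)) *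
     (\<Prod>i<length ?w. q ^ (size {#x \<in># L. ?w ! i < x#} + card {j. j < Suc i \<and> ?w ! i < (a # ?w) ! j})
       + (if Suc i \<in> drops (a # ?w) then u / q else 0))"
    unfolding inv_poly.simps poly_mult 1 e d by (simp add: divide_inverse)
  then show ?case
    unfolding length_Cons[of a] prod.lessThan_Suc_shift by (simp add: d)
qed (simp_all add: drops_def)

lemma inv_word_conv_sum:
  "inv_word a b \<sigma> = (\<Sum>i = a..b. inv_box a i \<sigma>)"
proof -
  have "{(j, i). a \<le> j \<and> j < i \<and> i \<le> b \<and> letter \<sigma> j > letter \<sigma> i} =
     (\<lambda>(i, j). (j, i)) ` (SIGMA i:{a..b}. {j. a \<le> j \<and> j < i \<and> letter \<sigma> j > letter \<sigma> i})"
    by auto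
  moreover have "inj_on (\<lambda>(i, j). (j, i)) X" for X :: "(nat \<times> nat) set"
    by (auto simp: inj_on_def)
  ultimately show ?thesis
    unfolding inv_word_def inv_box_def by (simp add: card_image card_SigmaI)
qed

lemma inv_box_drop:
  assumes "length \<sigma> = n" "m + i < n"
  shows "inv_box (m + 1) (Suc (m + i)) \<sigma> = card {j. j < i \<and> drop m \<sigma> ! i < drop m \<sigma> ! j}"
proof -
  have "{j. m + 1 \<le> j \<and> j < Suc (m + i) \<and> letter \<sigma> j > letter \<sigma> (Suc (m + i))} =
     (\<lambda>j. Suc (m + j)) ` {j. j < i \<and> drop m \<sigma> ! i < drop m \<sigma> ! j}" (is "?A = ?f ` ?B")
  proof
    show "?A \<subseteq> ?f ` ?B"
    proof
      fix j assume "j \<in> ?A"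
      then have "j = ?f (j - Suc m)" "j - Suc m \<in> ?B" using assms by (auto simp: letter_def)
      then show "j \<in> ?f ` ?B" by blast
    qed
  qed (use assms in \<open>auto simp: letter_def\<close>)
  then show ?thesis unfolding inv_box_def by (simp add: card_image inj_on_def)
qed

text \<open>\<open>inv_word\<close> is the sum of the \<open>inv_box\<close> values, so the weight
  factors over positions. With \<open>b\<close> larger letters on the left, a descent contributes
  \<open>q^b (1 + u / q^(b+1)) = q^b + u/q\<close>, the factor used in
  \<open>inv_poly\<close>.\<close>

lemma word_weight_inv_poly:
  assumes q: "q \<noteq> 0" and n: "length \<sigma> = n" "m < n"
  shows "q ^ inv_word (m + 1) n \<sigma> * (\<Prod>i \<in> Des \<sigma> \<inter> {m+1..n}. 1 + u / q ^ (inv_box (m + 1) i \<sigma> + 1)) =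
    poly (inv_poly q {#} (drop m \<sigma>)) u"
proof -
  let ?w = "drop m \<sigma>" and ?f = "\<lambda>i. Suc (m + i)"
  let ?b = "\<lambda>i. card {j. j < i \<and> ?w ! i < ?w ! j}"
  have len: "length ?w = n - m" using n by simp
  have sub: "drops ?w \<subseteq> {..<length ?w}" by (auto simp: drops_def)
  have inj: "inj_on ?f X" for X by (simp add: inj_on_def)
  have "{m+1..n} = ?f ` {..<length ?w}"
  proof -
    have "k \<in> ?f ` {..<n - m}" if "k \<in> {m+1..n}" for k
      using that by (intro image_eqI[of _ _ "k - Suc m"]) auto
    then show ?thesis using n by auto
  qed
  then have "inv_word (m + 1) n \<sigma> = (\<Sum>i<length ?w. inv_box (m + 1) (?f i) \<sigma>)"
    by (simp add: inv_word_conv_sum sum.reindex[OF inj])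
  also have "\<dots> = (\<Sum>i<length ?w. ?b i)"
    using n by (intro sum.cong refl inv_box_drop) auto
  finally have 1: "inv_word (m + 1) n \<sigma> = (\<Sum>i<length ?w. ?b i)" .
  have "(\<Prod>i \<in> Des \<sigma> \<inter> {m+1..n}. 1 + u / q ^ (inv_box (m + 1) i \<sigma> + 1)) =
     (\<Prod>i\<in>drops ?w. 1 + u / q ^ (inv_box (m + 1) (?f i) \<sigma> + 1))"
    unfolding Des_drop[OF n] by (simp add: prod.reindex[OF inj])
  also have "\<dots> = (\<Prod>i\<in>drops ?w. 1 + u / q ^ (?b i + 1))"
    using n sub len by (intro prod.cong refl) (subst inv_box_drop, auto)
  also have "\<dots> = (\<Prod>i<length ?w. if i \<in> drops ?w then 1 + u / q ^ (?b i + 1) else 1)"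
    using sub by (simp add: prod.If_cases Int_absorb1)
  finally have "q ^ inv_word (m + 1) n \<sigma> * (\<Prod>i \<in> Des \<sigma> \<inter> {m+1..n}. 1 + u / q ^ (inv_box (m + 1) i \<sigma> + 1)) =
     (\<Prod>i<length ?w. q ^ ?b i * (if i \<in> drops ?w then 1 + u / q ^ (?b i + 1) else 1))"
    unfolding 1 by (simp only: power_sum prod.distrib)
  also have "\<dots> = poly (inv_poly q {#} ?w) u"
    unfolding poly_inv_poly using q by (intro prod.cong) (auto simp: field_simps)
  finally show ?thesis .
qed

definition des_weight :: "nat \<Rightarrow> nat \<Rightarrow> 'a::field \<Rightarrow> 'a \<Rightarrow> 'a \<Rightarrow> 'a \<Rightarrow> nat set \<Rightarrow> 'a" where
  "des_weight n m q t u v D =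
     q ^ (\<Sum>i \<in> D \<inter> {m+1..n}. n - i) * t ^ (\<Sum>i \<in> D \<inter> {1..m}. i)
     * (\<Prod>i = 1..card (D \<inter> {m+1..n}). 1 + u * q powi (- int i))
     * (\<Prod>j = 1..card (D \<inter> {1..m}). 1 + v * t powi (- int j))"

definition prefix_weight :: "nat \<Rightarrow> 'a::field \<Rightarrow> 'a \<Rightarrow> nat list \<Rightarrow> 'a" where
  "prefix_weight m t v \<sigma> =
     t ^ (\<Sum>i \<in> Des \<sigma> \<inter> {1..m}. i) * (\<Prod>j = 1..card (Des \<sigma> \<inter> {1..m}). 1 + v * t powi (- int j))"

lemma prefix_weight_take:
  assumes "m < length \<sigma>"
  shows "prefix_weight m t v (take (Suc m) \<sigma>) = prefix_weight m t v \<sigma>"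
proof -
  have "Des (take (Suc m) \<sigma>) \<inter> {1..m} = Des \<sigma> \<inter> {1..m}"
    using assms by (auto simp: Des_def letter_def)
  then show ?thesis by (simp add: prefix_weight_def)
qed

text \<open>The two pieces overlap in the letter at position \<open>m + 1\<close>: it ends a
  possible descent at \<open>m\<close> and starts one at \<open>m + 1\<close>. This is why the
  rearrangements must keep the first letter of the suffix.\<close>

lemma word_weight_conv_poly:
  assumes "q \<noteq> 0" "length \<sigma> = n" "m < n"
  shows "word_weight n m q t u v \<sigma> =
    prefix_weight m t v (take (Suc m) \<sigma>) * poly (inv_poly q {#} (drop m \<sigma>)) u"
proof -
  have m: "m < length \<sigma>" using assms by simp
  have "(\<Prod>j = 1..k. 1 + v / t ^ j) = (\<Prod>j = 1..k. 1 + v * t powi (- int j))" for k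
    by (intro prod.cong) (auto simp: power_int_minus divide_inverse)
  then show ?thesis
    unfolding word_weight_def word_weight_inv_poly[OF assms, symmetric] prefix_weight_take[OF m]
    by (simp add: prefix_weight_def maj_word_def mult_ac)
qed

lemma des_weight_conv_poly:
  assumes "q \<noteq> 0" "length \<sigma> = n" "m < n"
  shows "des_weight n m q t u v (Des \<sigma>) =
    prefix_weight m t v (take (Suc m) \<sigma>) * poly (maj_poly q (drop m \<sigma>)) u"
proof -
  have m: "m < length \<sigma>" using assms by simp
  have inj: "inj_on (\<lambda>i. Suc (m + i)) X" for X by (simp add: inj_on_def)
  have "(\<Sum>i \<in> Des \<sigma> \<inter> {m+1..n}. n - i) = (\<Sum>i\<in>drops (drop m \<sigma>). length (drop m \<sigma>) - Suc i)"
    unfolding Des_drop[OF assms(2,3)] using assms by (simp add: sum.reindex[OF inj])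
  moreover have "card (Des \<sigma> \<inter> {m+1..n}) = card (drops (drop m \<sigma>))"
    unfolding Des_drop[OF assms(2,3)] by (rule card_image[OF inj])
  ultimately show ?thesis
    unfolding des_weight_def prefix_weight_take[OF m] poly_maj_poly[OF assms(1)]
    by (simp add: prefix_weight_def mult_ac)
qed

lemma words_content:
  assumes "size M = n" "\<forall>x\<in>#M. 0 < x"
  shows "{\<sigma>. \<sigma> \<in> words n \<and> mset \<sigma> = M} = permutations_of_multiset M"
proof -
  have "set \<sigma> \<subseteq> {1..}" if "mset \<sigma> = M" for \<sigma>
  proof -
    have "set \<sigma> = set_mset M" using that by (metis set_mset_mset)
    then show ?thesis using assms by (auto simp: Suc_le_eq)
  qed
  then show ?thesis using assms by (auto simp: words_def permutations_of_multiset_def)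
qed

lemma words_content_empty:
  assumes "\<not> (size M = n \<and> (\<forall>x\<in>#M. 0 < x))"
  shows "{\<sigma>. \<sigma> \<in> words n \<and> mset \<sigma> = M} = {}"
  using assms by (auto simp: words_def Suc_le_eq)

text \<open>Among the words with given first \<open>m + 1\<close> letters the prefix factor is
  constant, and the rest runs through all rearrangements of the remaining letters behind a fixed
  letter. \<open>equidistributed\<close> therefore applies to each such class, although the weights
  of individual words differ.\<close>

theorem H_tilde_conv_des_weight:
  assumes q: "q \<noteq> 0" and mn: "m < n"
  shows "H_tilde n m q t u v M =
    (\<Sum>\<sigma> | \<sigma> \<in> words n \<and> mset \<sigma> = M. des_weight n m q t u v (Des \<sigma>))"
proof (cases "size M = n \<and> (\<forall>x\<in>#M. 0 < x)")
  case False
  then show ?thesis unfolding H_tilde_def by (simp add: words_content_empty[OF False])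
next
  case True
  define S where "S = permutations_of_multiset M"
  let ?T = "take (Suc m) ` S"
  have len: "length \<sigma> = n" if "\<sigma> \<in> S" for \<sigma>
    using that True unfolding S_def permutations_of_multiset_def by (metis mem_Collect_eq size_mset)
  have group: "(\<Sum>\<sigma>\<in>S. prefix_weight m t v (take (Suc m) \<sigma>) * h (drop m \<sigma>)) =
     (\<Sum>\<rho>\<in>?T. prefix_weight m t v \<rho> * (\<Sum>w\<in>permutations_of_multiset (M - mset \<rho>). h (last \<rho> # w)))"
    for h :: "nat list \<Rightarrow> 'a"
  proof -
    have "(\<Sum>\<sigma>\<in>S. prefix_weight m t v (take (Suc m) \<sigma>) * h (drop m \<sigma>)) =
       (\<Sum>\<rho>\<in>?T. \<Sum>\<sigma>\<in>{\<sigma> \<in> S. take (Suc m) \<sigma> = \<rho>}. prefix_weight m t v (take (Suc m) \<sigma>) * h (drop m \<sigma>))"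
      by (rule sum.group[symmetric]) (auto simp: S_def)
    also have "\<dots> = (\<Sum>\<rho>\<in>?T. prefix_weight m t v \<rho> * (\<Sum>w\<in>permutations_of_multiset (M - mset \<rho>). h (last \<rho> # w)))"
    proof (intro sum.cong refl)
      fix \<rho> assume "\<rho> \<in> ?T"
      then obtain \<sigma> where \<sigma>: "\<sigma> \<in> S" "\<rho> = take (Suc m) \<sigma>" by auto
      have l\<rho>: "length \<rho> = Suc m" using \<sigma> len mn by simp
      have sub: "mset \<rho> \<subseteq># M"
      proof -
        have "M = mset \<rho> + mset (drop (Suc m) \<sigma>)"
          using \<sigma> unfolding S_def permutations_of_multiset_def
          by (metis append_take_drop_id mem_Collect_eq mset_append)
        then show ?thesis by simp
      qed
      have "{\<sigma> \<in> S. take (Suc m) \<sigma> = \<rho>} = (@) \<rho> ` permutations_of_multiset (M - mset \<rho>)" (is "?A = ?B")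
      proof
        show "?A \<subseteq> ?B"
        proof
          fix \<tau> assume "\<tau> \<in> ?A"
          then have \<tau>: "mset \<tau> = M" "\<tau> = \<rho> @ drop (Suc m) \<tau>"
            by (auto simp: S_def permutations_of_multiset_def simp del: append_take_drop_id intro: append_take_drop_id[symmetric])
          then have "mset (drop (Suc m) \<tau>) = M - mset \<rho>"
            by (metis add_diff_cancel_left' mset_append)
          with \<tau>(2) show "\<tau> \<in> ?B" by (auto simp: permutations_of_multiset_def)
        qed
      next
        show "?B \<subseteq> ?A" using sub l\<rho> by (auto simp: S_def permutations_of_multiset_def)
      qed
      moreover have "take (Suc m) (\<rho> @ w) = \<rho>" "drop m (\<rho> @ w) = last \<rho> # w" for w
      proof -
        show "take (Suc m) (\<rho> @ w) = \<rho>" using l\<rho> by simp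
        have "\<rho> = butlast \<rho> @ [last \<rho>]" using l\<rho> by (metis append_butlast_last_id length_0_conv nat.distinct(1))
        moreover have "length (butlast \<rho>) = m" using l\<rho> by simp
        ultimately show "drop m (\<rho> @ w) = last \<rho> # w"
          by (metis append.assoc append_Cons append_Nil append_eq_conv_conj)
      qed
      ultimately show "(\<Sum>\<sigma>\<in>{\<sigma> \<in> S. take (Suc m) \<sigma> = \<rho>}. prefix_weight m t v (take (Suc m) \<sigma>) * h (drop m \<sigma>)) =
         prefix_weight m t v \<rho> * (\<Sum>w\<in>permutations_of_multiset (M - mset \<rho>). h (last \<rho> # w))"
        by (simp add: sum.reindex inj_on_def sum_distrib_left)
    qed
    finally show ?thesis .
  qed
  have eq: "(\<Sum>w\<in>permutations_of_multiset (M - mset \<rho>). poly (inv_poly q {#} (last \<rho> # w)) u) =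
      (\<Sum>w\<in>permutations_of_multiset (M - mset \<rho>). poly (maj_poly q (last \<rho> # w)) u)" if \<rho>: "\<rho> \<in> ?T" for \<rho>
  proof -
    obtain \<sigma> where \<sigma>: "\<sigma> \<in> S" "\<rho> = take (Suc m) \<sigma>" using \<rho> by auto
    have "\<rho> \<noteq> []" using \<sigma> len[OF \<sigma>(1)] mn by auto
    then have "last \<rho> \<in> set \<sigma>" using \<sigma> by (metis last_in_set in_set_takeD)
    also have "set \<sigma> = set_mset M" using \<sigma>(1) unfolding S_def permutations_of_multiset_def by auto
    finally have "0 < last \<rho>" using True by simp
    moreover have "\<forall>x\<in>#M - mset \<rho>. 0 < x" using True by (auto dest: in_diffD)
    ultimately have "equidistributed q (last \<rho>) (M - mset \<rho>)" by (rule equidistributed[OF q])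
    then show ?thesis by (simp add: equidistributed_def flip: poly_sum)
  qed
  have "H_tilde n m q t u v M = (\<Sum>\<sigma>\<in>S. word_weight n m q t u v \<sigma>)"
    unfolding H_tilde_def S_def using True by (simp add: words_content)
  also have "\<dots> = (\<Sum>\<sigma>\<in>S. prefix_weight m t v (take (Suc m) \<sigma>) * poly (inv_poly q {#} (drop m \<sigma>)) u)"
    by (intro sum.cong refl word_weight_conv_poly q len mn)
  also have "\<dots> = (\<Sum>\<sigma>\<in>S. prefix_weight m t v (take (Suc m) \<sigma>) * poly (maj_poly q (drop m \<sigma>)) u)"
    unfolding group[of "\<lambda>w. poly (_ w) u"] using eq by (intro sum.cong refl) simp
  also have "\<dots> = (\<Sum>\<sigma>\<in>S. des_weight n m q t u v (Des \<sigma>))"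
    by (intro sum.cong refl des_weight_conv_poly[symmetric] q len mn)
  finally show ?thesis
    unfolding S_def using True by (simp add: words_content)
qed

section \<open>Horizontal strips\<close>

text \<open>Interlacing of parts: the skew shape \<open>f / g\<close> has at most one cell in each
  column. Shapes are padded with zeros to functions on all rows, so that adding a row needs no
  special treatment.\<close>

definition hstrip :: "(nat \<Rightarrow> nat) \<Rightarrow> (nat \<Rightarrow> nat) \<Rightarrow> bool" where
  "hstrip g f \<longleftrightarrow> (\<forall>i. g i \<le> f i \<and> f (Suc i) \<le> g i)"

definition shape :: "(nat \<Rightarrow> nat) \<Rightarrow> bool" where
  "shape f \<longleftrightarrow> antimono f \<and> (\<exists>B. \<forall>i\<ge>B. f i = 0)"

definition fcells :: "(nat \<Rightarrow> nat) \<Rightarrow> (nat \<times> nat) set" where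
  "fcells f = {(r, c). c < f r}"

definition fsize :: "(nat \<Rightarrow> nat) \<Rightarrow> nat" where
  "fsize f = card (fcells f)"

lemma fcells_conv_Sigma: "\<forall>i\<ge>B. f i = 0 \<Longrightarrow> fcells f = (SIGMA r:{..<B}. {..<f r})"
  by (auto simp: fcells_def) (metis leI less_zeroE)

lemma fsize_conv_sum: "\<forall>i\<ge>B. f i = 0 \<Longrightarrow> fsize f = (\<Sum>i<B. f i)"
  by (simp add: fsize_def fcells_conv_Sigma)

lemma finite_fcells: "shape f \<Longrightarrow> finite (fcells f)"
  by (auto simp: shape_def fcells_conv_Sigma)

lemma shape_antimonoD: "shape f \<Longrightarrow> i \<le> j \<Longrightarrow> f j \<le> f i"
  by (auto simp: shape_def antimono_def)

lemma shape_smaller: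
  assumes "hstrip g f" "shape f" shows "shape g"
  unfolding shape_def
proof
  show "antimono g"
    using assms(1) unfolding hstrip_def antimono_iff_le_Suc by (meson order.trans)
  show "\<exists>B. \<forall>i\<ge>B. g i = 0"
    using assms unfolding hstrip_def shape_def by (metis le_zero_eq)
qed

lemma shape_larger:
  assumes "hstrip f g" "shape f" shows "shape g"
  unfolding shape_def
proof
  show "antimono g"
    using assms(1) unfolding hstrip_def antimono_iff_le_Suc by (meson order.trans)
  obtain B where B: "\<forall>i\<ge>B. f i = 0" using assms(2) by (auto simp: shape_def)
  have "g i = 0" if "i \<ge> Suc B" for i
  proof -
    obtain j where "i = Suc j" "j \<ge> B" using \<open>i \<ge> Suc B\<close> by (cases i) auto
    then show ?thesis using assms(1) B unfolding hstrip_def by (metis le_zero_eq)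
  qed
  then show "\<exists>B. \<forall>i\<ge>B. g i = 0" by blast
qed

lemma finite_bounded_shapes:
  fixes f :: "nat \<Rightarrow> nat"
  assumes "\<forall>i\<ge>B. f i = 0"
  shows "finite {g. \<forall>i. g i \<le> f i}"
proof (rule finite_subset)
  let ?m = "Max (f ` {..<B})"
  show "{g. \<forall>i. g i \<le> f i} \<subseteq> {g. \<forall>i. (i \<in> {..<B} \<longrightarrow> g i \<in> {..?m}) \<and> (i \<notin> {..<B} \<longrightarrow> g i = 0)}"
  proof (clarsimp simp: not_less, intro conjI impI)
    fix g i assume g: "\<forall>i. g i \<le> f i" and i: "i < B"
    have "f i \<le> ?m" using i by (intro Max_ge) auto
    with g show "g i \<le> ?m" using order.trans by blast
  next
    fix g i assume g: "\<forall>i. g i \<le> f i" and i: "B \<le> i"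
    with assms show "g i = 0" by (metis le_zero_eq)
  qed
  show "finite {g. \<forall>i. (i \<in> {..<B} \<longrightarrow> g i \<in> {..?m}) \<and> (i \<notin> {..<B} \<longrightarrow> g i = 0)}"
    by (rule finite_set_of_finite_funs) auto
qed

definition lower_strips :: "(nat \<Rightarrow> nat) \<Rightarrow> nat \<Rightarrow> (nat \<Rightarrow> nat) set" where
  "lower_strips f k = {g. hstrip g f \<and> fsize g + k = fsize f}"

definition upper_strips :: "(nat \<Rightarrow> nat) \<Rightarrow> nat \<Rightarrow> (nat \<Rightarrow> nat) set" where
  "upper_strips f k = {g. hstrip f g \<and> fsize g = fsize f + k}"

lemma finite_lower_strips: "shape f \<Longrightarrow> finite (lower_strips f k)"
  by (auto simp: shape_def lower_strips_def hstrip_def intro: finite_subset[OF _ finite_bounded_shapes])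

lemma finite_upper_strips:
  assumes f: "shape f" shows "finite (upper_strips f k)"
proof -
  obtain B where B: "\<forall>i\<ge>B. f i = 0" using f by (auto simp: shape_def)
  \<comment> \<open>Interlacing bounds row \<open>i + 1\<close> of an upper neighbour by
    \<open>f i\<close>; only its first row can grow freely, and the total size bounds that.\<close>
  let ?h = "\<lambda>i. case i of 0 \<Rightarrow> fsize f + k | Suc i \<Rightarrow> f i"
  have "upper_strips f k \<subseteq> {g. \<forall>i. g i \<le> ?h i}"
  proof (clarsimp simp: upper_strips_def)
    fix g i assume g: "hstrip f g" "fsize g = fsize f + k"
    have "shape g" using shape_larger g(1) f by blast
    then obtain C where C: "\<forall>i\<ge>C. g i = 0" by (auto simp: shape_def)
    then have C': "\<forall>i\<ge>Suc C. g i = 0" by simp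
    have "g 0 \<le> fsize g" unfolding fsize_conv_sum[OF C'] by (rule member_le_sum) auto
    then show "g i \<le> ?h i" using g by (auto simp: hstrip_def split: nat.split)
  qed
  moreover have "\<forall>i\<ge>Suc B. ?h i = 0" using B by (auto split: nat.split)
  ultimately show ?thesis using finite_bounded_shapes finite_subset by blast
qed

text \<open>The local rule of Fomin's growth diagrams, for horizontal strips: given \<open>f\<close> and \<open>e\<close>, the pairs
  \<open>max (f (i + 1)) (e (i + 1)) \<le> min (f i) (e i)\<close> bound the parts of a common upper neighbour
  (shifted by one) as well as those of a common lower neighbour; reflecting these intervals exchanges
  the two, and only the first part of the upper neighbour remains free.\<close>

definition reflect_up :: "(nat \<Rightarrow> nat) \<Rightarrow> (nat \<Rightarrow> nat) \<Rightarrow> nat \<Rightarrow> (nat \<Rightarrow> nat) \<Rightarrow> nat \<Rightarrow> nat" where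
  "reflect_up f e k g i = (case i of 0 \<Rightarrow> max (f 0) (e 0) + k
     | Suc j \<Rightarrow> min (f j) (e j) + max (f (Suc j)) (e (Suc j)) - g j)"

definition reflect_down :: "(nat \<Rightarrow> nat) \<Rightarrow> (nat \<Rightarrow> nat) \<Rightarrow> (nat \<Rightarrow> nat) \<Rightarrow> nat \<Rightarrow> nat" where
  "reflect_down f e h i = min (f i) (e i) + max (f (Suc i)) (e (Suc i)) - h (Suc i)"

lemma hstrip_reflect_up:
  assumes "hstrip g f" "hstrip g e"
  shows "hstrip f (reflect_up f e k g)" "hstrip e (reflect_up f e k g)"
proof -
  have a: "g i \<le> min (f i) (e i)" "max (f (Suc i)) (e (Suc i)) \<le> g i" for i
    using assms by (auto simp: hstrip_def)
  have 1: "max (f (Suc i)) (e (Suc i)) \<le> reflect_up f e k g (Suc i)"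
    "reflect_up f e k g (Suc i) \<le> min (f i) (e i)" for i
    using a[of i] unfolding reflect_up_def nat.case by linarith+
  have 2: "max (f 0) (e 0) \<le> reflect_up f e k g 0" by (simp add: reflect_up_def)
  show "hstrip f (reflect_up f e k g)" "hstrip e (reflect_up f e k g)"
    unfolding hstrip_def
    by (intro allI conjI; (case_tac i)?; use 1 2 in \<open>auto\<close>)+
qed

lemma hstrip_reflect_down:
  assumes "hstrip f h" "hstrip e h"
  shows "hstrip (reflect_down f e h) f" "hstrip (reflect_down f e h) e"
proof -
  have "h (Suc i) \<le> min (f i) (e i)" "max (f i) (e i) \<le> h i" for i
    using assms by (auto simp: hstrip_def)
  note a = this(1) this(2)[of "Suc _"]
  have "max (f (Suc i)) (e (Suc i)) \<le> reflect_down f e h i" "reflect_down f e h i \<le> min (f i) (e i)" for i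
    using a[of i] unfolding reflect_down_def by linarith+
  then show "hstrip (reflect_down f e h) f" "hstrip (reflect_down f e h) e"
    by (auto simp: hstrip_def)
qed

lemma reflect_down_up:
  assumes "hstrip g f" "hstrip g e"
  shows "reflect_down f e (reflect_up f e k g) = g"
proof
  fix i
  have "g i \<le> min (f i) (e i)" using assms by (auto simp: hstrip_def)
  then show "reflect_down f e (reflect_up f e k g) i = g i"
    unfolding reflect_down_def reflect_up_def nat.case by linarith
qed

lemma reflect_up_down:
  assumes "hstrip f h" "hstrip e h" "k = h 0 - max (f 0) (e 0)"
  shows "reflect_up f e k (reflect_down f e h) = h"
proof
  fix i
  have "h (Suc i) \<le> min (f i) (e i)" "max (f i) (e i) \<le> h i" for i
    using assms by (auto simp: hstrip_def)
  then show "reflect_up f e k (reflect_down f e h) i = h i"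
    unfolding reflect_down_def reflect_up_def using assms(3) by (cases i) (simp_all add: trans_le_add1)
qed

text \<open>Row \<open>i\<close> of the lower neighbour and row \<open>i + 1\<close> of
  \<open>h\<close> add up to \<open>min (f i) (e i) + max (f (i + 1)) (e (i + 1))\<close>. Summing
  over \<open>i\<close> gives all of \<open>f\<close> and \<open>e\<close> except
  \<open>max (f 0) (e 0)\<close>, while \<open>h 0\<close> is left over on the other side.\<close>

lemma fsize_reflect:
  assumes h: "shape h" and fh: "hstrip f h" and eh: "hstrip e h"
  shows "fsize (reflect_down f e h) + fsize h = fsize f + fsize e + (h 0 - max (f 0) (e 0))"
proof -
  obtain B where B: "\<forall>i\<ge>B. h i = 0" using h by (auto simp: shape_def)
  have le: "h (Suc i) \<le> min (f i) (e i)" "max (f i) (e i) \<le> h i" for i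
    using fh eh by (auto simp: hstrip_def)
  have fe: "\<forall>i\<ge>B. f i = 0" "\<forall>i\<ge>B. e i = 0" using le B by (metis le_zero_eq max.bounded_iff)+
  then have g0: "\<forall>i\<ge>B. reflect_down f e h i = 0" by (simp add: reflect_down_def)
  have B': "\<forall>i\<ge>Suc B. h i = 0" "\<forall>i\<ge>Suc B. f i = 0" "\<forall>i\<ge>Suc B. e i = 0" using B fe by auto
  have pt: "reflect_down f e h i + h (Suc i) = min (f i) (e i) + max (f (Suc i)) (e (Suc i))" for i
    using le(1)[of i] by (simp add: reflect_down_def trans_le_add1)
  have "fsize (reflect_down f e h) + fsize h = (\<Sum>i<B. reflect_down f e h i) + (h 0 + (\<Sum>i<B. h (Suc i)))"
    unfolding fsize_conv_sum[OF g0] fsize_conv_sum[OF B'(1)] sum.lessThan_Suc_shift ..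
  also have "\<dots> = h 0 + (\<Sum>i<B. min (f i) (e i) + max (f (Suc i)) (e (Suc i)))"
    by (simp flip: pt add: sum.distrib)
  also have "\<dots> = h 0 + ((\<Sum>i<B. min (f i) (e i)) + (\<Sum>i<B. max (f (Suc i)) (e (Suc i))))"
    by (simp add: sum.distrib)
  also have "max (f 0) (e 0) + \<dots> = h 0 + ((\<Sum>i<Suc B. min (f i) (e i)) + (\<Sum>i<Suc B. max (f i) (e i)))"
    unfolding sum.lessThan_Suc_shift[of "\<lambda>i. max (f i) (e i)"] using fe by simp
  also have "(\<Sum>i<Suc B. min (f i) (e i)) + (\<Sum>i<Suc B. max (f i) (e i)) = fsize f + fsize e"
    unfolding fsize_conv_sum[OF B'(2)] fsize_conv_sum[OF B'(3)] sum.distrib[symmetric]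
    by (intro sum.cong) (auto simp: min_def max_def)
  finally show ?thesis using le(2)[of 0] by linarith
qed

section \<open>Semistandard tableaux and the Pieri rule\<close>

definition fSSYT :: "(nat \<Rightarrow> nat) \<Rightarrow> (nat \<times> nat \<Rightarrow> nat) set" where
  "fSSYT f = {T \<in> fcells f \<rightarrow>\<^sub>E {1..}.
     (\<forall>r c c'. (r, c) \<in> fcells f \<and> (r, c') \<in> fcells f \<and> c < c' \<longrightarrow> T (r, c) \<le> T (r, c')) \<and>
     (\<forall>r r' c. (r, c) \<in> fcells f \<and> (r', c) \<in> fcells f \<and> r < r' \<longrightarrow> T (r, c) < T (r', c))}"

definition content :: "(nat \<Rightarrow> nat) \<Rightarrow> (nat \<times> nat \<Rightarrow> nat) \<Rightarrow> nat multiset" where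
  "content f T = image_mset T (mset_set (fcells f))"

definition tabs :: "(nat \<Rightarrow> nat) \<Rightarrow> nat multiset \<Rightarrow> (nat \<times> nat \<Rightarrow> nat) set" where
  "tabs f M = {T \<in> fSSYT f. content f T = M}"

lemma fSSYT_iff:
  "T \<in> fSSYT f \<longleftrightarrow> (\<forall>r c. \<not> c < f r \<longrightarrow> T (r, c) = undefined) \<and> (\<forall>r c. c < f r \<longrightarrow> 0 < T (r, c)) \<and>
     (\<forall>r c c'. c < f r \<and> c' < f r \<and> c < c' \<longrightarrow> T (r, c) \<le> T (r, c')) \<and>
     (\<forall>r r' c. c < f r \<and> c < f r' \<and> r < r' \<longrightarrow> T (r, c) < T (r', c))"
  unfolding fSSYT_def PiE_iff extensional_def fcells_def by (auto simp: Suc_le_eq)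

lemma size_content: "size (content f T) = fsize f"
  by (simp add: content_def fsize_def)

lemma set_mset_content: "shape f \<Longrightarrow> set_mset (content f T) = T ` fcells f"
  by (simp add: content_def finite_fcells)

lemma finite_tabs:
  assumes "shape f" shows "finite (tabs f M)"
proof (rule finite_subset)
  show "tabs f M \<subseteq> fcells f \<rightarrow>\<^sub>E set_mset M"
    using set_mset_content[OF assms] by (auto simp: tabs_def fSSYT_def PiE_iff extensional_def)
  show "finite (fcells f \<rightarrow>\<^sub>E set_mset M)"
    by (intro finite_PiE finite_fcells assms) auto
qed

lemma less_card_downset_iff:
  fixes P :: "nat \<Rightarrow> bool"
  assumes "\<And>c c'. c < c' \<Longrightarrow> c' < n \<Longrightarrow> P c' \<Longrightarrow> P c"
  shows "c < card {c. c < n \<and> P c} \<longleftrightarrow> c < n \<and> P c"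
proof
  assume c: "c < n \<and> P c"
  then have "{..c} \<subseteq> {c. c < n \<and> P c}" using assms by (auto simp: le_less)
  then have "card {..c} \<le> card {c. c < n \<and> P c}" by (intro card_mono) auto
  then show "c < card {c. c < n \<and> P c}" by simp
next
  assume c: "c < card {c. c < n \<and> P c}"
  show "c < n \<and> P c"
  proof (rule ccontr)
    assume "\<not> (c < n \<and> P c)"
    then have "{c. c < n \<and> P c} \<subseteq> {..<c}" using assms by (auto simp: not_le[symmetric]) (metis le_less not_le order.strict_trans1)
    then have "card {c. c < n \<and> P c} \<le> card {..<c}" by (intro card_mono) auto
    with c show False by simp
  qed
qed

text \<open>Rows increase weakly, so the entries below \<open>x\<close> form an initial segment of
  each row and their number determines which cells they occupy.\<close>

definition sub_shape :: "(nat \<Rightarrow> nat) \<Rightarrow> nat \<Rightarrow> (nat \<times> nat \<Rightarrow> nat) \<Rightarrow> nat \<Rightarrow> nat" where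
  "sub_shape f x T r = card {c. c < f r \<and> T (r, c) < x}"

definition extend_tab :: "(nat \<Rightarrow> nat) \<Rightarrow> nat \<Rightarrow> (nat \<Rightarrow> nat) \<Rightarrow> (nat \<times> nat \<Rightarrow> nat) \<Rightarrow> nat \<times> nat \<Rightarrow> nat" where
  "extend_tab f x g T p = (if p \<in> fcells g then T p else if p \<in> fcells f then x else undefined)"

lemma less_sub_shape_iff:
  assumes "T \<in> fSSYT f"
  shows "c < sub_shape f x T r \<longleftrightarrow> c < f r \<and> T (r, c) < x"
  unfolding sub_shape_def
proof (rule less_card_downset_iff)
  fix c c' assume "c < c'" "c' < f r" "T (r, c') < x"
  moreover have "T (r, c) \<le> T (r, c')" using assms \<open>c < c'\<close> \<open>c' < f r\<close> by (auto simp: fSSYT_iff)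
  ultimately show "T (r, c) < x" by simp
qed

text \<open>The copies of the largest letter \<open>x\<close> form a horizontal strip: a cell of
  \<open>f\<close> in row \<open>r + 1\<close> forces the entry below it, in row \<open>r\<close>,
  to be less than \<open>x\<close> by strictness of columns.\<close>

lemma sub_shape_tabs:
  assumes f: "shape f" and M: "\<forall>y\<in>#M. y < x" and T: "T \<in> tabs f (M + replicate_mset b x)"
  defines "g \<equiv> sub_shape f x T"
  shows "g \<in> lower_strips f b" "restrict T (fcells g) \<in> tabs g M" "extend_tab f x g (restrict T (fcells g)) = T"
proof -
  have T': "T \<in> fSSYT f" "content f T = M + replicate_mset b x" using T by (auto simp: tabs_def)
  have g: "c < g r \<longleftrightarrow> c < f r \<and> T (r, c) < x" for r c
    unfolding g_def by (rule less_sub_shape_iff[OF T'(1)])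
  have Tx: "T (r, c) \<le> x" if "c < f r" for r c
  proof -
    have "T (r, c) \<in># content f T" unfolding set_mset_content[OF f] using that by (auto simp: fcells_def)
    then show ?thesis using T'(2) M by (auto split: if_splits)
  qed
  have gf: "g r \<le> f r" for r using g by (metis le_less_linear less_irrefl)
  have hs: "hstrip g f"
    unfolding hstrip_def
  proof (intro allI conjI gf)
    fix r
    have "c < g r" if c: "c < f (Suc r)" for c
    proof -
      have "c < f r" using c shape_antimonoD[OF f, of r "Suc r"] by simp
      moreover have "T (r, c) < T (Suc r, c)" using T'(1) c \<open>c < f r\<close> by (auto simp: fSSYT_iff)
      ultimately show ?thesis using g Tx[OF c] by simp
    qed
    then show "f (Suc r) \<le> g r" by (metis le_less_linear less_irrefl)
  qed
  have sg: "shape g" using shape_smaller hs f by blast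
  have cells: "fcells g = {p \<in> fcells f. T p < x}" using g by (auto simp: fcells_def)
  have "content g (restrict T (fcells g)) = image_mset T (mset_set (fcells g))"
    unfolding content_def by (rule image_mset_cong) (simp add: finite_fcells sg)
  also have "\<dots> = filter_mset (\<lambda>y. y < x) (content f T)"
    unfolding content_def filter_mset_image_mset cells by (simp add: finite_fcells f)
  also have "\<dots> = M"
  proof -
    have "filter_mset (\<lambda>y. y < x) (replicate_mset b x) = {#}" by (induction b) auto
    moreover have "filter_mset (\<lambda>y. y < x) M = M" using M by (simp add: filter_mset_eq_conv)
    ultimately show ?thesis unfolding T'(2) by simp
  qed
  finally have cg: "content g (restrict T (fcells g)) = M" .
  show "g \<in> lower_strips f b"
    using hs size_content[of f T] size_content[of g "restrict T (fcells g)"] unfolding cg T'(2)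
    by (simp add: lower_strips_def)
  have "restrict T (fcells g) \<in> fSSYT g"
    using T'(1) gf unfolding fSSYT_iff by (auto simp: fcells_def g)
  then show "restrict T (fcells g) \<in> tabs g M" using cg by (simp add: tabs_def)
  show "extend_tab f x g (restrict T (fcells g)) = T"
  proof
    fix p :: "nat \<times> nat"
    obtain r c where p: "p = (r, c)" by force
    show "extend_tab f x g (restrict T (fcells g)) p = T p"
      using T'(1) Tx[of c r] g[of c r] unfolding p extend_tab_def fcells_def fSSYT_iff by auto
  qed
qed

lemma extend_tab_tabs:
  assumes f: "shape f" and M: "\<forall>y\<in>#M. y < x" and x: "0 < x"
    and g: "g \<in> lower_strips f b" and T: "T \<in> tabs g M"
  defines "T' \<equiv> extend_tab f x g T"
  shows "T' \<in> tabs f (M + replicate_mset b x)" "sub_shape f x T' = g" "restrict T' (fcells g) = T"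
proof -
  have hs: "hstrip g f" "fsize g + b = fsize f" using g by (auto simp: lower_strips_def)
  have sg: "shape g" using shape_smaller hs f by blast
  have gf: "g r \<le> f r" "f (Suc r) \<le> g r" for r using hs(1) by (auto simp: hstrip_def)
  have T0: "T \<in> fSSYT g" "content g T = M" using T by (auto simp: tabs_def)
  have Tx: "T (r, c) < x" if "c < g r" for r c
  proof -
    have "T (r, c) \<in># content g T" unfolding set_mset_content[OF sg] using that by (auto simp: fcells_def)
    then show ?thesis using T0(2) M by auto
  qed
  have T': "T' (r, c) = (if c < g r then T (r, c) else if c < f r then x else undefined)" for r c
    by (simp add: T'_def extend_tab_def fcells_def)
  have fg: "f r' \<le> g r" if "r < r'" for r r'
    using shape_antimonoD[OF f, of "Suc r" r'] gf(2)[of r] that by simp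
  have ss: "T' \<in> fSSYT f"
    unfolding fSSYT_iff
  proof (intro conjI allI impI)
    fix r c assume "\<not> c < f r" then show "T' (r, c) = undefined"
      using gf(1)[of r] by (simp add: T')
  next
    fix r c assume "c < f r" then show "0 < T' (r, c)"
      using T0(1) x by (simp add: T' fSSYT_iff)
  next
    fix r c c' assume "c < f r \<and> c' < f r \<and> c < c'" then show "T' (r, c) \<le> T' (r, c')"
      using T0(1) Tx[of c r] by (simp add: T' fSSYT_iff less_imp_le)
  next
    fix r r' c assume a: "c < f r \<and> c < f r' \<and> r < r'"
    then have "c < g r" using fg[of r r'] by simp
    then show "T' (r, c) < T' (r', c)"
      using T0(1) Tx[of c r] a by (simp add: T' fSSYT_iff)
  qed
  have sub: "fcells g \<subseteq> fcells f" using gf(1) by (auto simp: fcells_def intro: less_le_trans)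
  have "content f T' = image_mset T' (mset_set (fcells g) + mset_set (fcells f - fcells g))"
    unfolding content_def using sub by (metis finite_fcells f sg mset_set_Diff subset_imp_msubset_mset_set subset_mset.add_diff_inverse)
  also have "\<dots> = image_mset T' (mset_set (fcells g)) + image_mset T' (mset_set (fcells f - fcells g))"
    by simp
  also have "image_mset T' (mset_set (fcells g)) = image_mset T (mset_set (fcells g))"
    by (rule image_mset_cong) (auto simp: finite_fcells sg T'_def extend_tab_def)
  also have "\<dots> = M" using T0(2) by (simp add: content_def)
  also have "image_mset T' (mset_set (fcells f - fcells g)) = image_mset (\<lambda>_. x) (mset_set (fcells f - fcells g))"
    by (rule image_mset_cong) (auto simp: finite_fcells f T'_def extend_tab_def)
  also have "\<dots> = replicate_mset b x"
  proof -
    have "card (fcells f - fcells g) = b"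
      using hs(2) card_Diff_subset[OF finite_fcells[OF sg] sub] by (simp add: fsize_def)
    then show ?thesis by (simp add: image_mset_const_eq)
  qed
  finally have "content f T' = M + replicate_mset b x" by simp
  with ss show "T' \<in> tabs f (M + replicate_mset b x)" by (simp add: tabs_def)
  show "sub_shape f x T' = g"
  proof
    fix r
    have "c < sub_shape f x T' r \<longleftrightarrow> c < g r" for c
      unfolding less_sub_shape_iff[OF ss] using gf(1)[of r] Tx[of c r] by (auto simp: T' split: if_splits)
    then show "sub_shape f x T' r = g r" by (metis less_irrefl nat_neq_iff)
  qed
  show "restrict T' (fcells g) = T"
  proof
    fix p :: "nat \<times> nat"
    obtain r c where p: "p = (r, c)" by force
    show "restrict T' (fcells g) p = T p"
      using T0(1) unfolding p fSSYT_iff by (auto simp: T' fcells_def)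
  qed
qed

lemma card_tabs_remove_max:
  assumes f: "shape f" and M: "\<forall>y\<in>#M. y < x" and x: "0 < x"
  shows "card (tabs f (M + replicate_mset b x)) = (\<Sum>g\<in>lower_strips f b. card (tabs g M))"
proof -
  have "bij_betw (\<lambda>T. (sub_shape f x T, restrict T (fcells (sub_shape f x T))))
     (tabs f (M + replicate_mset b x)) (SIGMA g:lower_strips f b. tabs g M)"
    by (rule bij_betw_byWitness[where f' = "\<lambda>(g, T). extend_tab f x g T"])
       (use sub_shape_tabs[OF f M] extend_tab_tabs[OF f M x] in \<open>auto simp del: restrict_apply\<close>)
  then have "card (tabs f (M + replicate_mset b x)) = card (SIGMA g:lower_strips f b. tabs g M)"
    by (rule bij_betw_same_card)
  also have "\<dots> = (\<Sum>g\<in>lower_strips f b. card (tabs g M))"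
    using f by (intro card_SigmaI finite_lower_strips ballI finite_tabs) (auto simp: lower_strips_def intro: shape_smaller)
  finally show ?thesis .
qed

lemma fsize_eq_0_iff: "shape f \<Longrightarrow> fsize f = 0 \<longleftrightarrow> f = (\<lambda>_. 0)"
proof -
  assume "shape f"
  then have "fsize f = 0 \<longleftrightarrow> fcells f = {}" by (simp add: fsize_def finite_fcells)
  then show ?thesis by (auto simp: fcells_def fun_eq_iff)
qed

lemma tabs_empty:
  assumes "shape f"
  shows "tabs f {#} = (if f = (\<lambda>_. 0) then {\<lambda>_. undefined} else {})"
proof (cases "f = (\<lambda>_. 0)")
  case True
  then have "fcells f = {}" by (simp add: fcells_def)
  then show ?thesis using True by (simp add: tabs_def fSSYT_def content_def)
next
  case False
  have "content f T \<noteq> {#}" for T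
    using False fsize_eq_0_iff[OF assms] size_content[of f T] by auto
  then show ?thesis using False by (simp add: tabs_def)
qed

lemma finite_submultisets: "finite {G. G \<subseteq># M}"
proof (induction M)
  case (add x M)
  have "G \<in> {G. G \<subseteq># M} \<union> add_mset x ` {G. G \<subseteq># M}" if "G \<subseteq># add_mset x M" for G
  proof (cases "x \<in># G")
    case True
    then obtain G' where "G = add_mset x G'" by (metis insert_DiffM)
    then show ?thesis using that by auto
  next
    case False
    then show ?thesis using that by (metis UnI1 add_mset_add_single diff_single_trivial mem_Collect_eq subset_eq_diff_conv)
  qed
  then have "{G. G \<subseteq># add_mset x M} \<subseteq> {G. G \<subseteq># M} \<union> add_mset x ` {G. G \<subseteq># M}" by blast
  then show ?case using add finite_subset by fastforce
qed simp

lemma fcells_mono: "hstrip g f \<Longrightarrow> fcells g \<subseteq> fcells f"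
  by (auto simp: hstrip_def fcells_def intro: less_le_trans)

lemma fsize_mono: "hstrip g f \<Longrightarrow> shape f \<Longrightarrow> fsize g \<le> fsize f"
  unfolding fsize_def by (intro card_mono finite_fcells fcells_mono)

lemma hstrip_fsize_eq:
  assumes "hstrip g f" "shape f" "fsize g = fsize f"
  shows "g = f"
proof
  fix r
  have "fcells g = fcells f"
    using assms fcells_mono finite_fcells by (metis card_subset_eq fsize_def)
  then have "c < g r \<longleftrightarrow> c < f r" for c by (auto simp: fcells_def)
  then show "g r = f r" by (metis less_irrefl nat_neq_iff)
qed

lemma hstrip_refl: "shape f \<Longrightarrow> hstrip f f"
  by (simp add: hstrip_def shape_antimonoD)

lemma upper_strips_0: "shape f \<Longrightarrow> upper_strips f 0 = {f}"
  using hstrip_refl hstrip_fsize_eq shape_larger by (fastforce simp: upper_strips_def)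

text \<open>The commutation relation between adding and removing horizontal strips, obtained from
  the local rule. The index \<open>i\<close> is the excess of the first row of \<open>h\<close> over
  both \<open>f\<close> and \<open>e\<close>; by \<open>fsize_reflect\<close>, both strip sizes drop
  by \<open>i\<close> on passing to the lower neighbour.\<close>

lemma sum_upper_lower_strips:
  assumes f: "shape f"
  shows "(\<Sum>h\<in>upper_strips f k. \<Sum>e\<in>lower_strips h b. w e) =
    (\<Sum>i\<le>min b k. \<Sum>g\<in>lower_strips f (b - i). \<Sum>e\<in>upper_strips g (k - i). w e)" (is "?L = ?R")
proof -
  have fin1: "finite (upper_strips f k)" using f by (rule finite_upper_strips)
  have fin2: "finite (lower_strips h b)" if "h \<in> upper_strips f k" for h
    using that f by (intro finite_lower_strips) (auto simp: upper_strips_def intro: shape_larger)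
  have fin3: "finite (lower_strips f j)" for j using f by (rule finite_lower_strips)
  have fin4: "finite (upper_strips g j)" if "g \<in> lower_strips f i" for g i j
    using that f by (intro finite_upper_strips) (auto simp: lower_strips_def intro: shape_smaller)
  have "?L = (\<Sum>(h, e)\<in>(SIGMA h:upper_strips f k. lower_strips h b). w e)"
    using fin1 fin2 by (simp add: sum.Sigma)
  also have "\<dots> = (\<Sum>(i, g, e)\<in>(SIGMA i:{..min b k}. SIGMA g:lower_strips f (b - i). upper_strips g (k - i)). w e)"
  proof (rule sum.reindex_bij_witness[where
        j = "\<lambda>(h, e). (h 0 - max (f 0) (e 0), reflect_down f e h, e)" and
        i = "\<lambda>(i, g, e). (reflect_up f e i g, e)"])
    fix p assume "p \<in> (SIGMA h:upper_strips f k. lower_strips h b)"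
    then obtain h e where p: "p = (h, e)" and h: "hstrip f h" "fsize h = fsize f + k"
      and e: "hstrip e h" "fsize e + b = fsize h"
      by (auto simp: upper_strips_def lower_strips_def)
    have sh: "shape h" using shape_larger h(1) f by blast
    have se: "shape e" using shape_smaller e(1) sh by blast
    define i where "i = h 0 - max (f 0) (e 0)"
    define g where "g = reflect_down f e h"
    have g: "hstrip g f" "hstrip g e" unfolding g_def using hstrip_reflect_down h(1) e(1) by blast+
    have sz: "fsize g + fsize h = fsize f + fsize e + i"
      unfolding g_def i_def by (rule fsize_reflect[OF sh h(1) e(1)])
    have le: "fsize g \<le> fsize f" "fsize g \<le> fsize e" using fsize_mono g f se by auto
    have up: "reflect_up f e i g = h" unfolding g_def by (rule reflect_up_down[OF h(1) e(1) i_def])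
    show "(case (case p of (h, e) \<Rightarrow> (h 0 - max (f 0) (e 0), reflect_down f e h, e)) of
        (i, g, e) \<Rightarrow> (reflect_up f e i g, e)) = p"
      using up by (simp add: p i_def g_def)
    show "(case p of (h, e) \<Rightarrow> (h 0 - max (f 0) (e 0), reflect_down f e h, e)) \<in>
        (SIGMA i:{..min b k}. SIGMA g:lower_strips f (b - i). upper_strips g (k - i))"
      using g sz le h(2) e(2) unfolding p i_def[symmetric] g_def[symmetric]
      by (simp add: i_def[symmetric] g_def[symmetric] lower_strips_def upper_strips_def)
    show "(case (case p of (h, e) \<Rightarrow> (h 0 - max (f 0) (e 0), reflect_down f e h, e)) of (i, g, e) \<Rightarrow> w e) =
        (case p of (h, e) \<Rightarrow> w e)"
      by (simp add: p)
  next
    fix p assume "p \<in> (SIGMA i:{..min b k}. SIGMA g:lower_strips f (b - i). upper_strips g (k - i))"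
    then obtain i g e where p: "p = (i, g, e)" and i: "i \<le> b" "i \<le> k"
      and g: "hstrip g f" "fsize g + (b - i) = fsize f" and e: "hstrip g e" "fsize e = fsize g + (k - i)"
      by (auto simp: upper_strips_def lower_strips_def)
    define h where "h = reflect_up f e i g"
    have h: "hstrip f h" "hstrip e h" unfolding h_def using hstrip_reflect_up g(1) e(1) by blast+
    have sh: "shape h" using shape_larger h(1) f by blast
    have down: "reflect_down f e h = g" unfolding h_def by (rule reflect_down_up[OF g(1) e(1)])
    have h0: "h 0 - max (f 0) (e 0) = i" by (simp add: h_def reflect_up_def)
    have "fsize g + fsize h = fsize f + fsize e + i"
      using fsize_reflect[OF sh h] unfolding down h0 .
    then show "(case p of (i, g, e) \<Rightarrow> (reflect_up f e i g, e)) \<in> (SIGMA h:upper_strips f k. lower_strips h b)"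
      using h g(2) e(2) i by (simp add: p h_def[symmetric] upper_strips_def lower_strips_def)
    show "(case (case p of (i, g, e) \<Rightarrow> (reflect_up f e i g, e)) of
        (h, e) \<Rightarrow> (h 0 - max (f 0) (e 0), reflect_down f e h, e)) = p"
      using down h0 by (simp add: p h_def)
  qed
  also have "\<dots> = ?R"
    using fin3 fin4 by (subst sum.Sigma[symmetric] sum.cong; simp)+
  finally show ?thesis .
qed

text \<open>Here \<open>i\<close> is the number of copies of \<open>x\<close> in \<open>G\<close>.
  The ranges of \<open>i\<close> and of the sizes agree with those in
  \<open>sum_upper_lower_strips\<close>.\<close>

lemma sum_submultisets_replicate:
  assumes x: "x \<notin># M"
  shows "(\<Sum>G | G \<subseteq># M + replicate_mset b x \<and> size G = k. w (M + replicate_mset b x - G)) =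
    (\<Sum>i\<le>min b k. \<Sum>G | G \<subseteq># M \<and> size G = k - i. w (M - G + replicate_mset (b - i) x))" (is "?L = ?R")
proof -
  have fin: "finite {G. G \<subseteq># M \<and> size G = j}" for j
    by (rule finite_subset[OF _ finite_submultisets[of M]]) auto
  have "?R = (\<Sum>(i, G)\<in>(SIGMA i:{..min b k}. {G. G \<subseteq># M \<and> size G = k - i}). w (M - G + replicate_mset (b - i) x))"
    by (rule sum.Sigma) (use fin in auto)
  also have "\<dots> = ?L"
  proof (rule sum.reindex_bij_witness[where
        j = "\<lambda>(i, G). G + replicate_mset i x" and
        i = "\<lambda>G. (count G x, filter_mset (\<lambda>y. y \<noteq> x) G)"])
    fix p assume "p \<in> (SIGMA i:{..min b k}. {G. G \<subseteq># M \<and> size G = k - i})"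
    then obtain i G where p: "p = (i, G)" "i \<le> b" "i \<le> k" "G \<subseteq># M" "size G = k - i" by auto
    have xG: "x \<notin># G" using p x by (meson mset_subset_eqD)
    then have "filter_mset (\<lambda>y. y \<noteq> x) G = G" by (auto simp: filter_mset_eq_conv)
    moreover have "filter_mset (\<lambda>y. y \<noteq> x) (replicate_mset i x) = {#}" by (induction i) auto
    ultimately show "(count (case p of (i, G) \<Rightarrow> G + replicate_mset i x) x,
        filter_mset (\<lambda>y. y \<noteq> x) (case p of (i, G) \<Rightarrow> G + replicate_mset i x)) = p"
      using xG by (simp add: p not_in_iff)
    have "replicate_mset i x \<subseteq># replicate_mset b x" using p(2) by (simp add: subseteq_mset_def)
    then show "(case p of (i, G) \<Rightarrow> G + replicate_mset i x) \<in>
        {G. G \<subseteq># M + replicate_mset b x \<and> size G = k}"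
      using p by (simp add: subset_mset.add_mono)
    have "M + replicate_mset b x - (G + replicate_mset i x) = M - G + replicate_mset (b - i) x"
      using p(2,4) by (auto simp: multiset_eq_iff subseteq_mset_def)
    then show "w (M + replicate_mset b x - (case p of (i, G) \<Rightarrow> G + replicate_mset i x)) =
        (case p of (i, G) \<Rightarrow> w (M - G + replicate_mset (b - i) x))"
      by (simp add: p)
  next
    fix G assume "G \<in> {G. G \<subseteq># M + replicate_mset b x \<and> size G = k}"
    then have G: "G \<subseteq># M + replicate_mset b x" "size G = k" by auto
    have dec: "filter_mset (\<lambda>y. y \<noteq> x) G + replicate_mset (count G x) x = G"
      by (auto simp: multiset_eq_iff)
    then show "(case (count G x, filter_mset (\<lambda>y. y \<noteq> x) G) of (i, G) \<Rightarrow> G + replicate_mset i x) = G"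
      by simp
    have "size G = size (filter_mset (\<lambda>y. y \<noteq> x) G) + count G x"
      by (subst dec[symmetric]) (simp only: size_union size_replicate_mset)
    moreover have "count G x \<le> b" using G(1) x by (auto simp: subseteq_mset_def not_in_iff dest: spec[of _ x])
    moreover have "filter_mset (\<lambda>y. y \<noteq> x) G \<subseteq># M"
      using G(1) unfolding subseteq_mset_def by (auto split: if_splits)
    ultimately show "(count G x, filter_mset (\<lambda>y. y \<noteq> x) G) \<in> (SIGMA i:{..min b k}. {G. G \<subseteq># M \<and> size G = k - i})"
      using G(2) by auto
  qed
  finally show ?thesis by simp
qed

text \<open>Both sides are the coefficient of \<open>M\<close> in \<open>h_k s_f\<close>, where the
  complete homogeneous function \<open>h_k\<close> contains every monomial \<open>G\<close> of
  degree \<open>k\<close> once. The induction removes all copies of the largest letter: on the left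
  this takes off a strip, which is commuted past the added one; on the right it splits
  \<open>G\<close>.\<close>

theorem pieri:
  assumes "shape f" "\<forall>x\<in>#M. 0 < x"
  shows "(\<Sum>h\<in>upper_strips f k. card (tabs h M)) = (\<Sum>G | G \<subseteq># M \<and> size G = k. card (tabs f (M - G)))"
  using assms
proof (induction "size M" arbitrary: M f k rule: less_induct)
  case less
  show ?case
  proof (cases "M = {#}")
    case True
    show ?thesis
    proof (cases "k = 0")
      case True
      have "{G. G = {#} \<and> size G = 0} = {{#}}" by auto
      then show ?thesis using True less.prems by (simp add: upper_strips_0 \<open>M = {#}\<close>)
    next
      case False
      have "card (tabs h M) = 0" if "h \<in> upper_strips f k" for h
      proof -
        have "shape h" "fsize h \<noteq> 0" using that False less.prems by (auto simp: upper_strips_def intro: shape_larger)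
        then show ?thesis using fsize_eq_0_iff[of h] by (simp add: True tabs_empty)
      qed
      then have "(\<Sum>h\<in>upper_strips f k. card (tabs h M)) = 0" by simp
      moreover have "{G. G \<subseteq># M \<and> size G = k} = {}" using False True by auto
      ultimately show ?thesis by (simp only: sum.empty)
    qed
  next
    case False
    define x where "x = Max (set_mset M)"
    have x: "x \<in># M" "\<forall>y\<in>#M. y \<le> x" using False by (simp_all add: x_def)
    define M0 where "M0 = filter_mset (\<lambda>y. y \<noteq> x) M"
    define b where "b = count M x"
    have M: "M = M0 + replicate_mset b x" by (auto simp: multiset_eq_iff M0_def b_def)
    have x0: "x \<notin># M0" "\<forall>y\<in>#M0. y < x" "0 < x" "\<forall>y\<in>#M0. 0 < y"
      using x less.prems(2) unfolding M0_def by (auto intro: le_neq_trans)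
    have "0 < b" using x(1) by (simp add: b_def)
    then have sz: "size M0 < size M" unfolding M by simp
    have "(\<Sum>h\<in>upper_strips f k. card (tabs h M)) = (\<Sum>h\<in>upper_strips f k. \<Sum>e\<in>lower_strips h b. card (tabs e M0))"
      unfolding M using less.prems
      by (intro sum.cong refl card_tabs_remove_max x0) (auto simp: upper_strips_def intro: shape_larger)
    also have "\<dots> = (\<Sum>i\<le>min b k. \<Sum>g\<in>lower_strips f (b - i). \<Sum>e\<in>upper_strips g (k - i). card (tabs e M0))"
      by (rule sum_upper_lower_strips) (rule less.prems)
    also have "\<dots> = (\<Sum>i\<le>min b k. \<Sum>g\<in>lower_strips f (b - i). \<Sum>G | G \<subseteq># M0 \<and> size G = k - i. card (tabs g (M0 - G)))"
      using less.prems x0 by (intro sum.cong refl less.hyps sz) (auto simp: lower_strips_def intro: shape_smaller)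
    also have "\<dots> = (\<Sum>i\<le>min b k. \<Sum>G | G \<subseteq># M0 \<and> size G = k - i. \<Sum>g\<in>lower_strips f (b - i). card (tabs g (M0 - G)))"
      by (intro sum.cong refl sum.swap)
    also have "\<dots> = (\<Sum>i\<le>min b k. \<Sum>G | G \<subseteq># M0 \<and> size G = k - i. card (tabs f (M0 - G + replicate_mset (b - i) x)))"
      using less.prems x0
      by (intro sum.cong refl card_tabs_remove_max[symmetric]) (auto dest: in_diffD)
    also have "\<dots> = (\<Sum>G | G \<subseteq># M \<and> size G = k. card (tabs f (M - G)))"
      unfolding M by (rule sum_submultisets_replicate[symmetric]) (rule x0)
    finally show ?thesis .
  qed
qed

section \<open>Standard tableaux with restricted descents\<close>

definition fSYT :: "(nat \<Rightarrow> nat) \<Rightarrow> (nat \<times> nat \<Rightarrow> nat) set" where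
  "fSYT f = {T \<in> fSSYT f. bij_betw T (fcells f) {1..fsize f}}"

definition fDes :: "(nat \<Rightarrow> nat) \<Rightarrow> (nat \<times> nat \<Rightarrow> nat) \<Rightarrow> nat set" where
  "fDes f T = {i. \<exists>r c r' c'. (r, c) \<in> fcells f \<and> (r', c') \<in> fcells f \<and>
     T (r, c) = i \<and> T (r', c') = i + 1 \<and> r < r'}"

definition SYT_within :: "nat set \<Rightarrow> (nat \<Rightarrow> nat) \<Rightarrow> (nat \<times> nat \<Rightarrow> nat) set" where
  "SYT_within D f = {T \<in> fSYT f. fDes f T \<subseteq> D}"

text \<open>An entry \<open>n + 1\<close> placed in row \<open>r\<close> creates no descent at
  \<open>n\<close> exactly when \<open>n\<close> lies in row \<open>r\<close> or above; this is all
  that has to be remembered about the previous entry.\<close>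

definition max_from_row :: "(nat \<Rightarrow> nat) \<Rightarrow> nat \<Rightarrow> (nat \<times> nat \<Rightarrow> nat) \<Rightarrow> bool" where
  "max_from_row f r T \<longleftrightarrow> (\<exists>r'\<ge>r. \<exists>c. c < f r' \<and> T (r', c) = fsize f)"

definition remove_corner :: "(nat \<Rightarrow> nat) \<Rightarrow> nat \<Rightarrow> nat \<Rightarrow> nat" where
  "remove_corner f r = f(r := f r - 1)"

lemma fSSYT_undefined: "T \<in> fSSYT f \<Longrightarrow> \<not> c < f r \<Longrightarrow> T (r, c) = undefined"
  unfolding fSSYT_iff by blast

lemma fSSYT_row: "T \<in> fSSYT f \<Longrightarrow> c < c' \<Longrightarrow> c' < f r \<Longrightarrow> T (r, c) \<le> T (r, c')"
  using less_trans[of c c' "f r"] unfolding fSSYT_iff by metis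

lemma fSSYT_col: "T \<in> fSSYT f \<Longrightarrow> c < f r \<Longrightarrow> c < f r' \<Longrightarrow> r < r' \<Longrightarrow> T (r, c) < T (r', c)"
  unfolding fSSYT_iff by blast

lemma finite_fSYT:
  assumes "shape f" shows "finite (fSYT f)"
proof (rule finite_subset)
  show "fSYT f \<subseteq> fcells f \<rightarrow>\<^sub>E {1..fsize f}"
    by (auto simp: fSYT_def fSSYT_def PiE_iff bij_betw_def extensional_def)
  show "finite (fcells f \<rightarrow>\<^sub>E {1..fsize f})"
    by (intro finite_PiE finite_fcells assms) auto
qed

lemma shape_remove_corner:
  assumes f: "shape f" and r: "f (Suc r) < f r"
  shows "shape (remove_corner f r)"
  unfolding shape_def
proof
  show "antimono (remove_corner f r)"
    unfolding antimono_iff_le_Suc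
  proof
    fix i show "remove_corner f r (Suc i) \<le> remove_corner f r i"
      using r shape_antimonoD[OF f, of i "Suc i"] by (auto simp: remove_corner_def)
  qed
  show "\<exists>B. \<forall>i\<ge>B. remove_corner f r i = 0"
    using f unfolding shape_def remove_corner_def by (metis diff_0_eq_0 fun_upd_apply)
qed

lemma fcells_remove_corner:
  assumes "f (Suc r) < f r"
  shows "fcells f = insert (r, f r - 1) (fcells (remove_corner f r))"
    "(r, f r - 1) \<notin> fcells (remove_corner f r)"
  using assms by (auto simp: fcells_def remove_corner_def split: if_splits)

lemma fsize_remove_corner:
  assumes "shape f" "f (Suc r) < f r"
  shows "fsize f = Suc (fsize (remove_corner f r))"
  unfolding fsize_def fcells_remove_corner(1)[OF assms(2)]
  using fcells_remove_corner(2)[OF assms(2)] shape_remove_corner[OF assms] by (simp add: finite_fcells)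

lemma fSYT_le:
  assumes "T \<in> fSYT f" "c < f r" shows "1 \<le> T (r, c)" "T (r, c) \<le> fsize f"
proof -
  have "T (r, c) \<in> {1..fsize f}"
    using assms unfolding fSYT_def bij_betw_def fcells_def by blast
  then show "1 \<le> T (r, c)" "T (r, c) \<le> fsize f" by auto
qed

lemma fSYT_inj:
  "T \<in> fSYT f \<Longrightarrow> c < f r \<Longrightarrow> c' < f r' \<Longrightarrow> T (r, c) = T (r', c') \<Longrightarrow> r = r' \<and> c = c'"
  unfolding fSYT_def bij_betw_def inj_on_def fcells_def by blast

lemma fSYT_surj: "T \<in> fSYT f \<Longrightarrow> 1 \<le> i \<Longrightarrow> i \<le> fsize f \<Longrightarrow> \<exists>r c. c < f r \<and> T (r, c) = i"
proof -
  assume "T \<in> fSYT f" "1 \<le> i" "i \<le> fsize f"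
  then have "i \<in> T ` fcells f" by (simp add: fSYT_def bij_betw_def)
  then show ?thesis by (auto simp: fcells_def)
qed

lemma fSYT_max_corner:
  assumes f: "shape f" and T: "T \<in> fSYT f" and c: "c < f r" "T (r, c) = fsize f"
  shows "f (Suc r) < f r" "c = f r - 1"
proof -
  have ss: "T \<in> fSSYT f" using T by (simp add: fSYT_def)
  show "c = f r - 1"
  proof (rule ccontr)
    assume "c \<noteq> f r - 1"
    then have c': "c < f r - 1" "f r - 1 < f r" using c by auto
    then have "T (r, c) \<le> T (r, f r - 1)" by (rule fSSYT_row[OF ss])
    moreover have "T (r, f r - 1) \<le> fsize f" using T c' by (intro fSYT_le)
    ultimately have "T (r, f r - 1) = T (r, c)" using c by simp
    with fSYT_inj[OF T c'(2) c(1)] c' show False by simp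
  qed
  show "f (Suc r) < f r"
  proof (rule ccontr)
    assume "\<not> f (Suc r) < f r"
    then have c': "c < f (Suc r)" using c by simp
    then have "T (r, c) < T (Suc r, c)" using fSSYT_col[OF ss c(1)] by simp
    moreover have "T (Suc r, c) \<le> fsize f" using T c' by (intro fSYT_le)
    ultimately show False using c by simp
  qed
qed

lemma fSYT_add_corner:
  assumes f: "shape f" and r: "f (Suc r) < f r" and T: "T \<in> fSYT (remove_corner f r)"
  shows "T((r, f r - 1) := fsize f) \<in> fSYT f"
proof -
  let ?g = "remove_corner f r" and ?p = "(r, f r - 1)"
  let ?T = "T(?p := fsize f)"
  have g: "?g i = (if i = r then f r - 1 else f i)" for i by (simp add: remove_corner_def)
  have sz: "fsize f = Suc (fsize ?g)" by (rule fsize_remove_corner[OF f r])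
  have ss: "T \<in> fSSYT ?g" using T by (simp add: fSYT_def)
  have le: "T (i, c) < fsize f" if "c < ?g i" for i c
    using fSYT_le(2)[OF T that] sz by simp
  have "?T \<in> fSSYT f"
    unfolding fSSYT_iff
  proof (intro conjI allI impI)
    fix i c assume "\<not> c < f i"
    then have "\<not> c < ?g i" "(i, c) \<noteq> ?p" using r by (auto simp: g)
    then show "?T (i, c) = undefined" using fSSYT_undefined[OF ss] by auto
  next
    fix i c assume "c < f i"
    then have "c < ?g i \<or> (i, c) = ?p" by (auto simp: g)
    then show "0 < ?T (i, c)" using ss sz unfolding fSSYT_iff by auto
  next
    fix i c c' assume a: "c < f i \<and> c' < f i \<and> c < c'"
    then have c: "c < ?g i" "(i, c) \<noteq> ?p" by (auto simp: g)
    have "c' < ?g i \<or> (i, c') = ?p" using a by (auto simp: g)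
    then show "?T (i, c) \<le> ?T (i, c')" using ss a c le[OF c(1)] unfolding fSSYT_iff by auto
  next
    fix i i' c assume a: "c < f i \<and> c < f i' \<and> i < i'"
    have c: "c < ?g i" "(i, c) \<noteq> ?p"
      using a r shape_antimonoD[OF f, of "Suc i" i'] by (auto simp: g)
    have "c < ?g i' \<or> (i', c) = ?p" using a by (auto simp: g)
    then show "?T (i, c) < ?T (i', c)" using ss a c le[OF c(1)] unfolding fSSYT_iff by auto
  qed
  moreover have "bij_betw ?T (fcells f) {1..fsize f}"
  proof -
    have "bij_betw T (fcells ?g) {1..fsize ?g}" using T by (simp add: fSYT_def)
    then have "bij_betw ?T (fcells ?g) {1..fsize ?g}"
      using fcells_remove_corner(2)[OF r] by (subst bij_betw_cong[of _ _ T]) auto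
    then have "bij_betw ?T (fcells ?g \<union> {?p}) ({1..fsize ?g} \<union> {fsize f})"
      by (rule bij_betw_combine) (auto simp: sz bij_betw_def)
    moreover have "{1..fsize ?g} \<union> {fsize f} = {1..fsize f}" by (auto simp: sz)
    ultimately show ?thesis by (simp add: fcells_remove_corner(1)[OF r])
  qed
  ultimately show ?thesis by (simp add: fSYT_def)
qed

lemma fSYT_delete_corner:
  assumes f: "shape f" and r: "f (Suc r) < f r" and T: "T \<in> fSYT f" and p: "T (r, f r - 1) = fsize f"
  shows "T((r, f r - 1) := undefined) \<in> fSYT (remove_corner f r)"
proof -
  let ?g = "remove_corner f r" and ?p = "(r, f r - 1)"
  let ?T = "T(?p := undefined)"
  have g: "?g i = (if i = r then f r - 1 else f i)" for i by (simp add: remove_corner_def)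
  have sz: "fsize f = Suc (fsize ?g)" by (rule fsize_remove_corner[OF f r])
  have ss: "T \<in> fSSYT f" using T by (simp add: fSYT_def)
  have cell: "c < f i \<and> (i, c) \<noteq> ?p" if "c < ?g i" for i c using that by (auto simp: g split: if_splits)
  have "?T \<in> fSSYT ?g"
    unfolding fSSYT_iff
  proof (intro conjI allI impI)
    fix i c assume "\<not> c < ?g i"
    then have "\<not> c < f i \<or> (i, c) = ?p" by (auto simp: g split: if_splits)
    then show "?T (i, c) = undefined" using ss unfolding fSSYT_iff by auto
  next
    fix i c assume "c < ?g i"
    then show "0 < ?T (i, c)" using ss cell[of c i] unfolding fSSYT_iff by auto
  next
    fix i c c' assume a: "c < ?g i \<and> c' < ?g i \<and> c < c'"
    then show "?T (i, c) \<le> ?T (i, c')" using ss cell[of c i] cell[of c' i] unfolding fSSYT_iff by auto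
  next
    fix i i' c assume a: "c < ?g i \<and> c < ?g i' \<and> i < i'"
    then show "?T (i, c) < ?T (i', c)" using ss cell[of c i] cell[of c i'] unfolding fSSYT_iff by auto
  qed
  moreover have "bij_betw ?T (fcells ?g) {1..fsize ?g}"
  proof -
    have "bij_betw T (insert ?p (fcells ?g)) {1..fsize f}"
      using T unfolding fSYT_def fcells_remove_corner(1)[OF r, symmetric] by simp
    then have "bij_betw T (insert ?p (fcells ?g) - {?p}) ({1..fsize f} - {T ?p})"
      by (rule bij_betw_DiffI) (use p sz in \<open>auto simp: bij_betw_def\<close>)
    moreover have "insert ?p (fcells ?g) - {?p} = fcells ?g" using fcells_remove_corner(2)[OF r] by simp
    moreover have "{1..fsize f} - {T ?p} = {1..fsize ?g}" unfolding p sz by auto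
    ultimately have "bij_betw T (fcells ?g) {1..fsize ?g}" by simp
    then show ?thesis
      using fcells_remove_corner(2)[OF r] by (subst bij_betw_cong[of _ _ T]) auto
  qed
  ultimately show ?thesis by (simp add: fSYT_def)
qed

text \<open>Only the pair \<open>n\<close>, \<open>n + 1\<close> is new. The case
  \<open>n = 0\<close> is separate because the first entry has no predecessor.\<close>

lemma fDes_add_corner:
  assumes f: "shape f" and r: "f (Suc r) < f r" and T: "T \<in> fSYT (remove_corner f r)"
  defines "n \<equiv> fsize (remove_corner f r)"
  shows "fDes f (T((r, f r - 1) := fsize f)) =
    fDes (remove_corner f r) T \<union> (if n = 0 \<or> max_from_row (remove_corner f r) r T then {} else {n})"
    (is "fDes f ?T = ?R")
proof -
  let ?g = "remove_corner f r" and ?p = "(r, f r - 1)"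
  have sz: "fsize f = Suc n" unfolding n_def by (rule fsize_remove_corner[OF f r])
  have cells: "fcells f = insert ?p (fcells ?g)" "?p \<notin> fcells ?g" using fcells_remove_corner[OF r] by auto
  have le: "T x \<le> n \<and> 1 \<le> T x" if "x \<in> fcells ?g" for x
    using fSYT_le[OF T] that unfolding n_def fcells_def by auto
  have key: "i \<in> fDes f ?T \<longleftrightarrow> i \<in> fDes ?g T \<or> (i = n \<and> (\<exists>r' c'. (r', c') \<in> fcells ?g \<and> T (r', c') = n \<and> r' < r))" for i
  proof
    assume "i \<in> fDes f ?T"
    then obtain a b a' b' where ab: "(a, b) \<in> fcells f" "(a', b') \<in> fcells f" "?T (a, b) = i"
      "?T (a', b') = i + 1" "a < a'" by (auto simp: fDes_def)
    have "(a, b) \<noteq> ?p"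
    proof
      assume "(a, b) = ?p"
      then have "i = Suc n" "(a', b') \<noteq> ?p" using ab sz by auto
      then have "(a', b') \<in> fcells ?g" "T (a', b') = Suc (Suc n)" using ab cells by auto
      with le show False by force
    qed
    then have 1: "(a, b) \<in> fcells ?g" "T (a, b) = i" using ab cells by auto
    show "i \<in> fDes ?g T \<or> (i = n \<and> (\<exists>r' c'. (r', c') \<in> fcells ?g \<and> T (r', c') = n \<and> r' < r))"
    proof (cases "(a', b') = ?p")
      case True
      then have "i = n" "a < r" using ab sz by auto
      with 1 show ?thesis by blast
    next
      case False
      then have "(a', b') \<in> fcells ?g" "T (a', b') = i + 1" using ab cells by auto
      with 1 ab(5) have "i \<in> fDes ?g T" unfolding fDes_def by blast
      then show ?thesis ..
    qed
  next
    assume "i \<in> fDes ?g T \<or> (i = n \<and> (\<exists>r' c'. (r', c') \<in> fcells ?g \<and> T (r', c') = n \<and> r' < r))"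
    then show "i \<in> fDes f ?T"
    proof
      assume "i \<in> fDes ?g T"
      then obtain a b a' b' where ab: "(a, b) \<in> fcells ?g" "(a', b') \<in> fcells ?g" "T (a, b) = i"
        "T (a', b') = i + 1" "a < a'" by (auto simp: fDes_def)
      then have "?T (a, b) = i" "?T (a', b') = i + 1" "(a, b) \<in> fcells f" "(a', b') \<in> fcells f"
        using cells by auto
      with ab(5) show ?thesis unfolding fDes_def by blast
    next
      assume "i = n \<and> (\<exists>r' c'. (r', c') \<in> fcells ?g \<and> T (r', c') = n \<and> r' < r)"
      then obtain a b where ab: "i = n" "(a, b) \<in> fcells ?g" "T (a, b) = n" "a < r" by blast
      then have "?T (a, b) = i" "?T ?p = i + 1" "(a, b) \<in> fcells f" "?p \<in> fcells f"
        using cells sz by auto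
      with ab(4) show ?thesis unfolding fDes_def by blast
    qed
  qed
  have "(\<exists>r' c'. (r', c') \<in> fcells ?g \<and> T (r', c') = n \<and> r' < r) \<longleftrightarrow> \<not> (n = 0 \<or> max_from_row ?g r T)"
  proof (cases "n = 0")
    case True
    then show ?thesis using le by fastforce
  next
    case False
    then obtain a b where ab: "b < ?g a" "T (a, b) = n" using fSYT_surj[OF T, of n] unfolding n_def by auto
    have "(a' = a \<and> b' = b)" if "b' < ?g a'" "T (a', b') = n" for a' b'
      using fSYT_inj[OF T that(1) ab(1)] that ab by simp
    then show ?thesis using ab False unfolding max_from_row_def fcells_def n_def[symmetric]
      by (metis (mono_tags, lifting) case_prod_conv mem_Collect_eq not_less)
  qed
  then show ?thesis using key by (intro set_eqI) auto
qed

lemma card_SYT_max_in_row: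
  assumes f: "shape f" and r: "f (Suc r) < f r"
  defines "g \<equiv> remove_corner f r"
  shows "card {T \<in> SYT_within D f. T (r, f r - 1) = fsize f} =
    card {T \<in> SYT_within D g. fsize g = 0 \<or> fsize g \<in> D \<or> max_from_row g r T}"
proof -
  let ?p = "(r, f r - 1)"
  have undef: "T ?p = undefined" if "T \<in> fSYT g" for T
  proof -
    have "\<not> f r - 1 < g r" by (simp add: g_def remove_corner_def)
    then show ?thesis using that unfolding fSYT_def fSSYT_iff by blast
  qed
  have D: "fDes f (T(?p := fsize f)) \<subseteq> D \<longleftrightarrow> fDes g T \<subseteq> D \<and> (fsize g = 0 \<or> fsize g \<in> D \<or> max_from_row g r T)"
    if "T \<in> fSYT g" for T
    using fDes_add_corner[OF f r] that unfolding g_def by (auto split: if_splits)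
  have "bij_betw (\<lambda>T. T(?p := undefined)) {T \<in> SYT_within D f. T ?p = fsize f}
     {T \<in> SYT_within D g. fsize g = 0 \<or> fsize g \<in> D \<or> max_from_row g r T}"
  proof (rule bij_betw_byWitness[where f' = "\<lambda>T. T(?p := fsize f)"])
    show "\<forall>T\<in>{T \<in> SYT_within D f. T ?p = fsize f}. T(?p := undefined, ?p := fsize f) = T"
      by (auto simp: fun_eq_iff)
    show "\<forall>T\<in>{T \<in> SYT_within D g. fsize g = 0 \<or> fsize g \<in> D \<or> max_from_row g r T}.
        T(?p := fsize f, ?p := undefined) = T"
      by (auto simp: fun_eq_iff SYT_within_def undef simp del: One_nat_def)
    show "(\<lambda>T. T(?p := undefined)) ` {T \<in> SYT_within D f. T ?p = fsize f}
        \<subseteq> {T \<in> SYT_within D g. fsize g = 0 \<or> fsize g \<in> D \<or> max_from_row g r T}"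
    proof clarify
      fix T assume T: "T \<in> SYT_within D f" "T ?p = fsize f"
      then have T': "T(?p := undefined) \<in> fSYT g"
        using fSYT_delete_corner[OF f r] unfolding g_def SYT_within_def by simp
      have "(T(?p := undefined))(?p := fsize f) = T" using T(2) by (auto simp: fun_eq_iff)
      then show "T(?p := undefined) \<in> SYT_within D g \<and>
          (fsize g = 0 \<or> fsize g \<in> D \<or> max_from_row g r (T(?p := undefined)))"
        using D[OF T'] T T' by (simp add: SYT_within_def)
    qed
    show "(\<lambda>T. T(?p := fsize f)) ` {T \<in> SYT_within D g. fsize g = 0 \<or> fsize g \<in> D \<or> max_from_row g r T}
        \<subseteq> {T \<in> SYT_within D f. T ?p = fsize f}"
      using fSYT_add_corner[OF f r] D unfolding g_def[symmetric] by (auto simp: SYT_within_def)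
  qed
  then show ?thesis by (rule bij_betw_same_card)
qed

text \<open>Classification by the lowest row \<open>r'\<close> in which \<open>g\<close> is shorter
  than \<open>f\<close>. Interlacing makes its last cell a corner, and after its removal the rows
  below \<open>r'\<close> stay untouched while row \<open>r'\<close> itself may still
  shrink.\<close>

lemma strips_fixing_rows_split:
  assumes f: "shape f" and sz: "p < fsize f"
  defines "A \<equiv> \<lambda>f r. {g. hstrip g f \<and> fsize g = p \<and> (\<forall>i<r. g i = f i)}"
    and "C \<equiv> \<lambda>r. {r'. r \<le> r' \<and> f (Suc r') < f r'}"
  shows "A f r = (\<Union>r'\<in>C r. A (remove_corner f r') r')"
    "r1 \<noteq> r2 \<Longrightarrow> r1 \<in> C r \<Longrightarrow> r2 \<in> C r \<Longrightarrow> A (remove_corner f r1) r1 \<inter> A (remove_corner f r2) r2 = {}"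
proof -
  have rc: "remove_corner f r' i = (if i = r' then f r' - 1 else f i)" for r' i
    by (simp add: remove_corner_def)
  show "A f r = (\<Union>r'\<in>C r. A (remove_corner f r') r')"
  proof (intro set_eqI iffI)
    fix g assume "g \<in> A f r"
    then have g: "hstrip g f" "fsize g = p" "\<forall>i<r. g i = f i" by (auto simp: A_def)
    have "\<exists>i. g i \<noteq> f i" using g(2) sz by (metis ext less_irrefl)
    define r' where "r' = (LEAST i. g i \<noteq> f i)"
    have r': "g r' \<noteq> f r'" "\<forall>i<r'. g i = f i"
      using LeastI_ex[OF \<open>\<exists>i. g i \<noteq> f i\<close>] not_less_Least unfolding r'_def by blast+
    have le: "g i \<le> f i" "f (Suc i) \<le> g i" for i using g(1) by (auto simp: hstrip_def)
    have "g r' < f r'" using r'(1) le(1)[of r'] by simp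
    then have "f (Suc r') < f r'" using le(2)[of r'] by simp
    moreover have "r \<le> r'" using g(3) r'(1) by (metis not_less)
    moreover have "hstrip g (remove_corner f r')"
      unfolding hstrip_def
    proof (intro allI conjI)
      fix i
      show "g i \<le> remove_corner f r' i" using le(1)[of i] \<open>g r' < f r'\<close> by (auto simp: rc)
      show "remove_corner f r' (Suc i) \<le> g i" using le(2)[of i] by (auto simp: rc)
    qed
    ultimately show "g \<in> (\<Union>r'\<in>C r. A (remove_corner f r') r')"
      using g(2) r'(2) by (auto simp: A_def C_def rc)
  next
    fix g assume "g \<in> (\<Union>r'\<in>C r. A (remove_corner f r') r')"
    then obtain r' where r': "r \<le> r'" "f (Suc r') < f r'" and g: "hstrip g (remove_corner f r')"
      "fsize g = p" "\<forall>i<r'. g i = f i"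
      by (auto simp: A_def C_def rc)
    have le: "g i \<le> remove_corner f r' i" "remove_corner f r' (Suc i) \<le> g i" for i
      using g(1) by (auto simp: hstrip_def)
    have "hstrip g f"
      unfolding hstrip_def
    proof (intro allI conjI)
      fix i
      show "g i \<le> f i" using le(1)[of i] by (auto simp: rc split: if_splits)
      show "f (Suc i) \<le> g i"
        using le(2)[of i] g(3) shape_antimonoD[OF f, of i "Suc i"] by (auto simp: rc split: if_splits)
    qed
    then show "g \<in> A f r" using g r' by (auto simp: A_def)
  qed
  assume "r1 \<noteq> r2" and C: "r1 \<in> C r" "r2 \<in> C r"
  have *: "A (remove_corner f r1) r1 \<inter> A (remove_corner f r2) r2 = {}"
    if "r1 < r2" "f (Suc r1) < f r1" for r1 r2
  proof -
    have "g r1 < f r1" if "g \<in> A (remove_corner f r1) r1" for g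
      using that \<open>f (Suc r1) < f r1\<close> by (auto simp: A_def hstrip_def rc dest!: spec[of _ r1])
    moreover have "g r1 = f r1" if "g \<in> A (remove_corner f r2) r2" for g
      using that \<open>r1 < r2\<close> by (auto simp: A_def rc)
    ultimately show ?thesis by fastforce
  qed
  show "A (remove_corner f r1) r1 \<inter> A (remove_corner f r2) r2 = {}"
    using *[of r1 r2] *[of r2 r1] \<open>r1 \<noteq> r2\<close> C unfolding C_def by (cases "r1 < r2") auto
qed

text \<open>The entries \<open>p + 1, ..., p + k\<close> have no descent among them, so each lies
  weakly below its predecessor. They fill a horizontal strip from the top row down, left to right in
  each row, in exactly one way, and the largest entry ends up in the lowest row of the strip. The
  bound \<open>r\<close> carries this order through the induction, which removes the largest
  entry.\<close>

lemma card_SYT_within_strips: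
  assumes p: "p = 0 \<or> p \<in> D" and D: "D \<inter> {p<..<p + k} = {}" and "shape f" "fsize f = p + k"
  shows "card {T \<in> SYT_within D f. k = 0 \<or> max_from_row f r T} =
    (\<Sum>g | hstrip g f \<and> fsize g = p \<and> (\<forall>i<r. g i = f i). card (SYT_within D g))"
  using D assms(3,4)
proof (induction k arbitrary: f r)
  case 0
  then have "{g. hstrip g f \<and> fsize g = p \<and> (\<forall>i<r. g i = f i)} = {f}"
    using hstrip_fsize_eq hstrip_refl by auto
  then show ?case by simp
next
  case (Suc k)
  define A where "A = (\<lambda>f r. {g. hstrip g f \<and> fsize g = p \<and> (\<forall>i<r. g i = f i)})"
  define C where "C = {r'. r \<le> r' \<and> f (Suc r') < f r'}"
  have sf: "shape f" by (rule Suc.prems)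
  have finA: "finite (A h s)" if "shape h" for h s
    by (rule finite_subset[OF _ finite_lower_strips[OF that, of "fsize h - p"]])
       (auto simp: A_def lower_strips_def dest: fsize_mono[OF _ that])
  obtain B where "\<forall>i\<ge>B. f i = 0" using sf by (auto simp: shape_def)
  then have "C \<subseteq> {..<B}" by (auto simp: C_def) (metis leI less_zeroE)
  then have finC: "finite C" using finite_subset by blast
  have "{T \<in> SYT_within D f. max_from_row f r T} =
     (\<Union>r'\<in>C. {T \<in> SYT_within D f. T (r', f r' - 1) = fsize f})" (is "?L = ?R")
  proof (intro set_eqI iffI)
    fix T assume T: "T \<in> ?L"
    then obtain r' c where r': "r \<le> r'" "c < f r'" "T (r', c) = fsize f" by (auto simp: max_from_row_def)
    have "T \<in> fSYT f" using T by (simp add: SYT_within_def)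
    from fSYT_max_corner[OF sf this r'(2,3)] show "T \<in> ?R" using T r' by (auto simp: C_def)
  next
    fix T assume "T \<in> ?R"
    then obtain r' where r': "r' \<in> C" "T \<in> SYT_within D f" "T (r', f r' - 1) = fsize f" by blast
    moreover have "f r' - 1 < f r'" using r'(1) by (simp add: C_def)
    moreover have "r \<le> r'" using r'(1) by (simp add: C_def)
    ultimately have "max_from_row f r T" unfolding max_from_row_def by blast
    with r'(2) show "T \<in> ?L" by simp
  qed
  then have "card {T \<in> SYT_within D f. Suc k = 0 \<or> max_from_row f r T} = card ?R" by simp
  also have "\<dots> = (\<Sum>r'\<in>C. card {T \<in> SYT_within D f. T (r', f r' - 1) = fsize f})"
  proof (rule card_UN_disjoint[OF finC])
    show "\<forall>r'\<in>C. finite {T \<in> SYT_within D f. T (r', f r' - 1) = fsize f}"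
      using finite_fSYT[OF sf] by (auto simp: SYT_within_def)
    show "\<forall>r1\<in>C. \<forall>r2\<in>C. r1 \<noteq> r2 \<longrightarrow> {T \<in> SYT_within D f. T (r1, f r1 - 1) = fsize f} \<inter>
        {T \<in> SYT_within D f. T (r2, f r2 - 1) = fsize f} = {}"
    proof (intro ballI impI)
      fix r1 r2 assume a: "r1 \<in> C" "r2 \<in> C" "r1 \<noteq> r2"
      then have c: "f r1 - 1 < f r1" "f r2 - 1 < f r2" by (auto simp: C_def)
      have "T (r1, f r1 - 1) \<noteq> T (r2, f r2 - 1)" if "T \<in> SYT_within D f" for T
        using that fSYT_inj[of T f "f r1 - 1" r1 "f r2 - 1" r2] c a(3) unfolding SYT_within_def by blast
      then show "{T \<in> SYT_within D f. T (r1, f r1 - 1) = fsize f} \<inter>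
        {T \<in> SYT_within D f. T (r2, f r2 - 1) = fsize f} = {}"
        by (intro equals0I) (metis (mono_tags, lifting) IntD1 IntD2 mem_Collect_eq)
    qed
  qed
  also have "\<dots> = (\<Sum>r'\<in>C. \<Sum>g\<in>A (remove_corner f r') r'. card (SYT_within D g))"
  proof (intro sum.cong refl)
    fix r' assume "r' \<in> C"
    then have r': "f (Suc r') < f r'" by (simp add: C_def)
    let ?g = "remove_corner f r'"
    have sz: "fsize ?g = p + k" using fsize_remove_corner[OF sf r'] Suc.prems by simp
    \<comment> \<open>Inside the block a descent at \<open>p + k\<close> is forbidden, so the
      previous entry must lie in row \<open>r'\<close> or above. Only the first entry of the block,
      \<open>k = 0\<close>, is unrestricted, since then \<open>p\<close> is 0 or belongs to
      \<open>D\<close>.\<close>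
    have "fsize ?g = 0 \<or> fsize ?g \<in> D \<or> max_from_row ?g r' T \<longleftrightarrow> k = 0 \<or> max_from_row ?g r' T" for T
    proof (cases "k = 0")
      case True
      then show ?thesis using p sz by auto
    next
      case False
      then have "p + k \<in> {p<..<p + Suc k}" by auto
      then have "p + k \<notin> D" using Suc.prems(1) by blast
      then show ?thesis using False sz by auto
    qed
    then have "card {T \<in> SYT_within D f. T (r', f r' - 1) = fsize f} =
       card {T \<in> SYT_within D ?g. k = 0 \<or> max_from_row ?g r' T}"
      by (simp only: card_SYT_max_in_row[OF sf r'])
    also have "\<dots> = (\<Sum>g\<in>A ?g r'. card (SYT_within D g))"
      unfolding A_def using Suc.prems(1) by (intro Suc.IH shape_remove_corner sf r' sz) auto
    finally show "card {T \<in> SYT_within D f. T (r', f r' - 1) = fsize f} = (\<Sum>g\<in>A ?g r'. card (SYT_within D g))" .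
  qed
  also have "\<dots> = (\<Sum>g\<in>(\<Union>r'\<in>C. A (remove_corner f r') r'). card (SYT_within D g))"
    using strips_fixing_rows_split(2)[OF sf, of p _ _ r] Suc.prems finC finA shape_remove_corner[OF sf]
    by (intro sum.UNION_disjoint[symmetric]) (auto simp: A_def C_def)
  also have "(\<Union>r'\<in>C. A (remove_corner f r') r') = A f r"
    using strips_fixing_rows_split(1)[OF sf, of p r] Suc.prems by (simp add: A_def C_def)
  finally show ?case by (simp add: A_def)
qed

lemma card_SYT_within_split:
  assumes "p = 0 \<or> p \<in> D" "D \<inter> {p<..<p + k} = {}" "shape f" "fsize f = p + k"
  shows "card (SYT_within D f) = (\<Sum>g\<in>lower_strips f k. card (SYT_within D g))"
proof -
  have "{T \<in> SYT_within D f. k = 0 \<or> max_from_row f 0 T} = SYT_within D f"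
  proof -
    have "max_from_row f 0 T" if "k \<noteq> 0" "T \<in> fSYT f" for T
      using that fSYT_surj[of T f "fsize f"] assms(4) by (auto simp: max_from_row_def)
    then show ?thesis by (auto simp: SYT_within_def)
  qed
  moreover have "{g. hstrip g f \<and> fsize g = p \<and> (\<forall>i<0. g i = f i)} = lower_strips f k"
    using assms(4) by (auto simp: lower_strips_def)
  ultimately show ?thesis using card_SYT_within_strips[OF assms, of 0] by simp
qed

section \<open>Words and pairs of tableaux\<close>

definition words_within :: "nat set \<Rightarrow> nat multiset \<Rightarrow> nat list set" where
  "words_within D M = {\<sigma> \<in> permutations_of_multiset M. Des \<sigma> \<subseteq> D}"

lemma finite_words_within: "finite (words_within D M)"
  by (simp add: words_within_def)

lemma Des_iff: "i \<in> Des \<sigma> \<longleftrightarrow> 1 \<le> i \<and> i < length \<sigma> \<and> \<sigma> ! i < \<sigma> ! (i - 1)"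
  by (auto simp: Des_def letter_def)

lemma Des_append_within_iff:
  assumes p: "p = 0 \<or> p \<in> D" and D: "D \<inter> {p<..<p + k} = {}"
    and len: "length \<sigma> = p" "length \<tau> = k"
  shows "Des (\<sigma> @ \<tau>) \<subseteq> D \<longleftrightarrow> Des \<sigma> \<subseteq> D \<and> sorted \<tau>"
proof
  assume L: "Des (\<sigma> @ \<tau>) \<subseteq> D"
  have "Des \<sigma> \<subseteq> Des (\<sigma> @ \<tau>)" by (auto simp: Des_iff nth_append)
  moreover have "\<tau> ! i \<le> \<tau> ! Suc i" if i: "Suc i < length \<tau>" for i
  proof (rule ccontr)
    assume "\<not> \<tau> ! i \<le> \<tau> ! Suc i"
    then have "p + Suc i \<in> Des (\<sigma> @ \<tau>)" using i len by (auto simp: Des_iff nth_append)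
    then have "p + Suc i \<in> D \<inter> {p<..<p + k}" using L i len by auto
    with D show False by blast
  qed
  ultimately show "Des \<sigma> \<subseteq> D \<and> sorted \<tau>" using L by (auto simp: sorted_iff_nth_Suc)
next
  assume R: "Des \<sigma> \<subseteq> D \<and> sorted \<tau>"
  show "Des (\<sigma> @ \<tau>) \<subseteq> D"
  proof
    fix i assume i: "i \<in> Des (\<sigma> @ \<tau>)"
    consider "i < p" | "i = p" | "p < i" by linarith
    then show "i \<in> D"
    proof cases
      case 1
      then have "i < length \<sigma>" "i - 1 < length \<sigma>" using len by auto
      then have "i \<in> Des \<sigma>" using i by (simp add: Des_iff nth_append)
      then show ?thesis using R by blast
    next
      case 2
      then show ?thesis using i p by (auto simp: Des_iff)
    next
      case 3
      then have a: "\<not> i < p" "\<not> i - 1 < p" by auto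
      have "i < p + k" "(\<sigma> @ \<tau>) ! i < (\<sigma> @ \<tau>) ! (i - 1)" using i len by (auto simp: Des_iff)
      then have "\<tau> ! (i - p) < \<tau> ! (i - 1 - p)" "i - p < length \<tau>"
        using a len 3 by (simp_all only: nth_append if_False)
      moreover have "\<tau> ! (i - 1 - p) \<le> \<tau> ! (i - p)"
        using R 3 \<open>i - p < length \<tau>\<close> by (intro sorted_nth_mono) auto
      ultimately show ?thesis by simp
    qed
  qed
qed

text \<open>The last \<open>k\<close> letters are weakly increasing, hence determined by their
  content \<open>G\<close>, and a descent at the cut is permitted, so the two pieces are
  independent.\<close>

lemma card_words_within_split:
  assumes p: "p = 0 \<or> p \<in> D" and D: "D \<inter> {p<..<p + k} = {}" and M: "size M = p + k"
  shows "card (words_within D M) = (\<Sum>G | G \<subseteq># M \<and> size G = k. card (words_within D (M - G)))"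
proof -
  let ?S = "{G. G \<subseteq># M \<and> size G = k}"
  have "bij_betw (\<lambda>\<sigma>. (mset (drop p \<sigma>), take p \<sigma>)) (words_within D M) (SIGMA G:?S. words_within D (M - G))"
  proof (rule bij_betw_byWitness[where f' = "\<lambda>(G, \<sigma>). \<sigma> @ sorted_list_of_multiset G"])
    have A: "sorted_list_of_multiset (mset (drop p \<sigma>)) = drop p \<sigma> \<and>
       (mset (drop p \<sigma>), take p \<sigma>) \<in> (SIGMA G:?S. words_within D (M - G))" if "\<sigma> \<in> words_within D M" for \<sigma>
    proof -
      have \<sigma>: "mset \<sigma> = M" "Des \<sigma> \<subseteq> D"
        using that by (auto simp: words_within_def permutations_of_multiset_def)
      have len: "length \<sigma> = p + k" using \<sigma> M by (metis size_mset)
      have split: "Des (take p \<sigma>) \<subseteq> D \<and> sorted (drop p \<sigma>)"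
        using Des_append_within_iff[OF p D, of "take p \<sigma>" "drop p \<sigma>"] len \<sigma>(2) by simp
      have "M = mset (take p \<sigma>) + mset (drop p \<sigma>)"
        using \<sigma>(1) by (metis append_take_drop_id mset_append)
      then show ?thesis using split len
        by (simp add: sorted_sort_id words_within_def permutations_of_multiset_def)
    qed
    then show "\<forall>\<sigma>\<in>words_within D M.
        (case (mset (drop p \<sigma>), take p \<sigma>) of (G, \<sigma>) \<Rightarrow> \<sigma> @ sorted_list_of_multiset G) = \<sigma>"
      by simp
    show "(\<lambda>\<sigma>. (mset (drop p \<sigma>), take p \<sigma>)) ` words_within D M \<subseteq> (SIGMA G:?S. words_within D (M - G))"
      using A by blast
    have B: "length \<sigma> = p \<and> \<sigma> @ sorted_list_of_multiset G \<in> words_within D M"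
      if "G \<in> ?S" "\<sigma> \<in> words_within D (M - G)" for G \<sigma>
    proof -
      have \<sigma>: "mset \<sigma> = M - G" "Des \<sigma> \<subseteq> D" and G: "G \<subseteq># M" "size G = k"
        using that by (auto simp: words_within_def permutations_of_multiset_def)
      have "length \<sigma> = size (M - G)" using \<sigma>(1) by (metis size_mset)
      then have len: "length \<sigma> = p" using G M by (simp add: size_Diff_submset)
      have "length (sorted_list_of_multiset G) = k" using G(2) by (metis mset_sorted_list_of_multiset size_mset)
      then have "Des (\<sigma> @ sorted_list_of_multiset G) \<subseteq> D"
        using Des_append_within_iff[OF p D len] \<sigma>(2) by simp
      then show ?thesis using len \<sigma>(1) G(1) by (simp add: words_within_def permutations_of_multiset_def)
    qed
    then show "\<forall>x\<in>SIGMA G:?S. words_within D (M - G).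
        (mset (drop p (case x of (G, \<sigma>) \<Rightarrow> \<sigma> @ sorted_list_of_multiset G)),
         take p (case x of (G, \<sigma>) \<Rightarrow> \<sigma> @ sorted_list_of_multiset G)) = x"
      by auto
    show "(\<lambda>(G, \<sigma>). \<sigma> @ sorted_list_of_multiset G) ` (SIGMA G:?S. words_within D (M - G)) \<subseteq> words_within D M"
      using B by auto
  qed
  then have "card (words_within D M) = card (SIGMA G:?S. words_within D (M - G))"
    by (rule bij_betw_same_card)
  also have "\<dots> = (\<Sum>G\<in>?S. card (words_within D (M - G)))"
    by (intro card_SigmaI ballI finite_words_within finite_subset[OF _ finite_submultisets[of M]]) auto
  finally show ?thesis .
qed

definition shapes :: "nat \<Rightarrow> (nat \<Rightarrow> nat) set" where
  "shapes n = {f. shape f \<and> fsize f = n}"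

lemma shape_le_fsize:
  assumes f: "shape f"
  shows "f i \<le> fsize f" "fsize f \<le> i \<Longrightarrow> f i = 0"
proof -
  have "(\<lambda>c. (i, c)) ` {..<f i} \<subseteq> fcells f" by (auto simp: fcells_def)
  from card_mono[OF finite_fcells[OF f] this] show "f i \<le> fsize f"
    by (simp add: card_image inj_on_def fsize_def)
  show "f i = 0" if "fsize f \<le> i"
  proof (rule ccontr)
    assume "f i \<noteq> 0"
    then have "0 < f j" if "j \<le> i" for j using shape_antimonoD[OF f that] by simp
    then have "(\<lambda>j. (j, 0)) ` {..i} \<subseteq> fcells f" by (auto simp: fcells_def)
    from card_mono[OF finite_fcells[OF f] this] have "Suc i \<le> fsize f"
      by (simp add: card_image inj_on_def fsize_def)
    with that show False by simp
  qed
qed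

lemma finite_shapes: "finite (shapes n)"
proof (rule finite_subset)
  show "shapes n \<subseteq> {g. \<forall>i. g i \<le> (if i < n then n else 0)}"
    using shape_le_fsize by (fastforce simp: shapes_def not_less)
  show "finite {g. \<forall>i. g i \<le> (if i < n then n else 0)}"
    by (rule finite_bounded_shapes[of n]) simp
qed

lemma last_block:
  fixes D :: "nat set"
  assumes n: "0 < n"
  obtains p k where "n = p + k" "0 < k" "p = 0 \<or> p \<in> D" "D \<inter> {p<..<p + k} = {}"
proof -
  define p where "p = (if D \<inter> {1..<n} = {} then 0 else Max (D \<inter> {1..<n}))"
  have fin: "finite (D \<inter> {1..<n})" by simp
  have "p \<in> D \<inter> {1..<n}" if "D \<inter> {1..<n} \<noteq> {}"
    using Max_in[OF fin that] that by (simp add: p_def)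
  then have p: "p = 0 \<or> p \<in> D" "p < n" using n by (auto simp: p_def)
  have "D \<inter> {p<..<n} = {}"
  proof (rule equals0I)
    fix i assume i: "i \<in> D \<inter> {p<..<n}"
    then have "i \<in> D \<inter> {1..<n}" by auto
    then have "i \<le> p" using Max_ge[OF fin] by (auto simp: p_def)
    with i show False by simp
  qed
  with p that[of p "n - p"] show ?thesis by simp
qed

text \<open>Cutting off the last block deletes \<open>G\<close> from the content and leaves tableaux
  of a smaller shape \<open>g\<close>. The Pieri rule trades the deleted content for a strip added
  to \<open>g\<close>, and by \<open>card_SYT_within_split\<close> summing over the \<open>g\<close>
  below \<open>f\<close> restores the standard tableaux of shape \<open>f\<close>.\<close>

theorem card_words_within:
  assumes "\<forall>x\<in>#M. 0 < x"
  shows "card (words_within D M) = (\<Sum>f\<in>shapes (size M). card (tabs f M) * card (SYT_within D f))"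
  using assms
proof (induction "size M" arbitrary: M rule: less_induct)
  case less
  show ?case
  proof (cases "M = {#}")
    case True
    have s: "shape (\<lambda>_. 0)" by (auto simp: shape_def antimono_def)
    have z: "fsize (\<lambda>_. 0) = 0" using fsize_eq_0_iff[OF s] by simp
    have "shapes 0 = {\<lambda>_. 0}" using s z fsize_eq_0_iff by (auto simp: shapes_def)
    moreover have "fcells (\<lambda>_. 0) = {}" by (simp add: fcells_def)
    then have "SYT_within D (\<lambda>_. 0) = {\<lambda>_. undefined}"
      using z by (auto simp: SYT_within_def fSYT_def fSSYT_def fDes_def bij_betw_def)
    moreover have "words_within D {#} = {[]}" by (auto simp: words_within_def Des_def)
    ultimately show ?thesis by (simp add: True tabs_empty s)
  next
    case False
    define n where "n = size M"
    have "0 < n" using False by (simp add: n_def nonempty_has_size)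
    then obtain p k where k: "n = p + k" "0 < k" and p: "p = 0 \<or> p \<in> D" and Dk: "D \<inter> {p<..<p + k} = {}"
      by (rule last_block)
    let ?y = "\<lambda>g. card (SYT_within D g)"
    let ?S = "{G. G \<subseteq># M \<and> size G = k}"
    have "card (words_within D M) = (\<Sum>G\<in>?S. card (words_within D (M - G)))"
      by (rule card_words_within_split[OF p Dk]) (use n_def k in simp)
    also have "\<dots> = (\<Sum>G\<in>?S. \<Sum>g\<in>shapes p. card (tabs g (M - G)) * ?y g)"
    proof (intro sum.cong refl)
      fix G assume G: "G \<in> ?S"
      then have sz: "size (M - G) = p" using k n_def by (simp add: size_Diff_submset)
      have "card (words_within D (M - G)) = (\<Sum>g\<in>shapes (size (M - G)). card (tabs g (M - G)) * ?y g)"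
        by (rule less.hyps) (use sz n_def k less.prems in \<open>auto dest: in_diffD\<close>)
      then show "card (words_within D (M - G)) = (\<Sum>g\<in>shapes p. card (tabs g (M - G)) * ?y g)"
        by (simp only: sz)
    qed
    also have "\<dots> = (\<Sum>g\<in>shapes p. (\<Sum>G\<in>?S. card (tabs g (M - G))) * ?y g)"
      unfolding sum_distrib_right by (rule sum.swap)
    also have "\<dots> = (\<Sum>g\<in>shapes p. (\<Sum>f\<in>upper_strips g k. card (tabs f M)) * ?y g)"
      using less.prems by (intro sum.cong refl arg_cong2[of _ _ _ _ "(*)"] pieri[symmetric]) (auto simp: shapes_def)
    also have "\<dots> = (\<Sum>g\<in>shapes p. \<Sum>f\<in>{f \<in> shapes n. hstrip g f}. card (tabs f M) * ?y g)"
    proof (intro sum.cong refl)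
      fix g assume "g \<in> shapes p"
      then have "upper_strips g k = {f \<in> shapes n. hstrip g f}"
        using k by (auto simp: upper_strips_def shapes_def intro: shape_larger)
      then show "(\<Sum>f\<in>upper_strips g k. card (tabs f M)) * ?y g =
          (\<Sum>f\<in>{f \<in> shapes n. hstrip g f}. card (tabs f M) * ?y g)"
        by (simp add: sum_distrib_right)
    qed
    also have "\<dots> = (\<Sum>f\<in>shapes n. \<Sum>g\<in>{g \<in> shapes p. hstrip g f}. card (tabs f M) * ?y g)"
      by (rule sum.swap_restrict) (rule finite_shapes)+
    also have "\<dots> = (\<Sum>f\<in>shapes n. card (tabs f M) * ?y f)"
    proof (intro sum.cong refl)
      fix f assume f: "f \<in> shapes n"
      then have "{g \<in> shapes p. hstrip g f} = lower_strips f k"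
        using k by (auto simp: lower_strips_def shapes_def intro: shape_smaller)
      moreover have "?y f = (\<Sum>g\<in>lower_strips f k. ?y g)"
        by (rule card_SYT_within_split[OF p Dk]) (use f k in \<open>auto simp: shapes_def\<close>)
      ultimately show "(\<Sum>g\<in>{g \<in> shapes p. hstrip g f}. card (tabs f M) * ?y g) = card (tabs f M) * ?y f"
        by (simp add: sum_distrib_left)
    qed
    finally show ?thesis by (simp add: n_def)
  qed
qed

text \<open>Inclusion and exclusion without signs: by induction on \<open>D\<close>, all proper
  subsets cancel from the two sums, so the argument stays within the natural numbers.\<close>

lemma sum_Pow_determines:
  fixes F G :: "'a set \<Rightarrow> nat"
  assumes "\<And>D. finite D \<Longrightarrow> (\<Sum>E\<in>Pow D. F E) = (\<Sum>E\<in>Pow D. G E)" and "finite D"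
  shows "F D = G D"
  using assms(2)
proof (induction D rule: finite_psubset_induct)
  case (psubset D)
  have fin: "finite (Pow D)" using psubset.hyps by simp
  have "(\<Sum>E\<in>Pow D. H E) = H D + (\<Sum>E\<in>Pow D - {D}. H E)" for H :: "'a set \<Rightarrow> nat"
    by (rule sum.remove[OF fin]) simp
  moreover have "(\<Sum>E\<in>Pow D - {D}. F E) = (\<Sum>E\<in>Pow D - {D}. G E)"
    by (intro sum.cong refl psubset.IH) auto
  ultimately show ?case using assms(1)[OF psubset.hyps] by (metis add_right_imp_eq)
qed

lemma card_subset_group:
  assumes "finite A" "finite D"
  shows "card {a \<in> A. h a \<subseteq> D} = (\<Sum>E\<in>Pow D. card {a \<in> A. h a = E})"
proof -
  have "{a \<in> A. h a \<subseteq> D} = (\<Union>E\<in>Pow D. {a \<in> A. h a = E})" by auto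
  also have "card \<dots> = (\<Sum>E\<in>Pow D. card {a \<in> A. h a = E})"
    using assms by (intro card_UN_disjoint) auto
  finally show ?thesis .
qed

theorem card_words_Des:
  assumes "\<forall>x\<in>#M. 0 < x" and "finite D"
  shows "card {\<sigma> \<in> permutations_of_multiset M. Des \<sigma> = D} =
    (\<Sum>f\<in>shapes (size M). card (tabs f M) * card {T \<in> fSYT f. fDes f T = D})"
  using assms(2)
proof (rule sum_Pow_determines[rotated])
  fix D :: "nat set" assume D: "finite D"
  have "(\<Sum>E\<in>Pow D. card {\<sigma> \<in> permutations_of_multiset M. Des \<sigma> = E}) = card (words_within D M)"
    unfolding words_within_def using D by (simp add: card_subset_group)
  also have "\<dots> = (\<Sum>f\<in>shapes (size M). card (tabs f M) * card (SYT_within D f))"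
    by (rule card_words_within) (rule assms)
  also have "\<dots> = (\<Sum>f\<in>shapes (size M). card (tabs f M) * (\<Sum>E\<in>Pow D. card {T \<in> fSYT f. fDes f T = E}))"
    unfolding SYT_within_def using D finite_fSYT
    by (intro sum.cong refl arg_cong2[of _ _ _ _ "(*)"] card_subset_group) (auto simp: shapes_def)
  also have "\<dots> = (\<Sum>E\<in>Pow D. \<Sum>f\<in>shapes (size M). card (tabs f M) * card {T \<in> fSYT f. fDes f T = E})"
    unfolding sum_distrib_left by (rule sum.swap)
  finally show "(\<Sum>E\<in>Pow D. card {\<sigma> \<in> permutations_of_multiset M. Des \<sigma> = E}) =
    (\<Sum>E\<in>Pow D. \<Sum>f\<in>shapes (size M). card (tabs f M) * card {T \<in> fSYT f. fDes f T = E})" .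
qed

lemma fDes_subset: "T \<in> fSYT f \<Longrightarrow> fDes f T \<subseteq> {..fsize f}"
  using fSYT_le(2) by (fastforce simp: fDes_def fcells_def)

lemma sum_conv_card_Pow:
  fixes w :: "'b set \<Rightarrow> 'c::comm_ring_1"
  assumes "finite A" "finite P" "\<And>a. a \<in> A \<Longrightarrow> h a \<subseteq> P"
  shows "(\<Sum>a\<in>A. w (h a)) = (\<Sum>E\<in>Pow P. of_nat (card {a \<in> A. h a = E}) * w E)"
proof -
  have "(\<Sum>a\<in>A. w (h a)) = (\<Sum>E\<in>Pow P. \<Sum>a\<in>{a \<in> A. h a = E}. w (h a))"
    by (rule sum.group[symmetric]) (use assms in auto)
  also have "\<dots> = (\<Sum>E\<in>Pow P. of_nat (card {a \<in> A. h a = E}) * w E)"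
    by (intro sum.cong refl) simp
  finally show ?thesis .
qed

lemma Des_subset: "\<sigma> \<in> permutations_of_multiset M \<Longrightarrow> Des \<sigma> \<subseteq> {..size M}"
proof -
  assume "\<sigma> \<in> permutations_of_multiset M"
  then have "length \<sigma> = size M" by (metis permutations_of_multisetD size_mset)
  then show ?thesis by (auto simp: Des_iff)
qed

theorem sum_words_Des:
  fixes w :: "nat set \<Rightarrow> 'a::comm_ring_1"
  assumes "\<forall>x\<in>#M. 0 < x"
  shows "(\<Sum>\<sigma>\<in>permutations_of_multiset M. w (Des \<sigma>)) =
    (\<Sum>f\<in>shapes (size M). of_nat (card (tabs f M)) * (\<Sum>T\<in>fSYT f. w (fDes f T)))"
proof -
  let ?P = "Pow {..size M}"
  have "(\<Sum>\<sigma>\<in>permutations_of_multiset M. w (Des \<sigma>)) =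
     (\<Sum>E\<in>?P. of_nat (card {\<sigma> \<in> permutations_of_multiset M. Des \<sigma> = E}) * w E)"
    by (intro sum_conv_card_Pow Des_subset) auto
  also have "\<dots> = (\<Sum>E\<in>?P. of_nat (\<Sum>f\<in>shapes (size M). card (tabs f M) * card {T \<in> fSYT f. fDes f T = E}) * w E)"
    by (intro sum.cong refl) (subst card_words_Des[OF assms], auto intro: finite_subset)
  also have "\<dots> = (\<Sum>E\<in>?P. \<Sum>f\<in>shapes (size M). of_nat (card (tabs f M)) * (of_nat (card {T \<in> fSYT f. fDes f T = E}) * w E))"
    by (simp add: sum_distrib_right mult.assoc)
  also have "\<dots> = (\<Sum>f\<in>shapes (size M). of_nat (card (tabs f M)) * (\<Sum>E\<in>?P. of_nat (card {T \<in> fSYT f. fDes f T = E}) * w E))"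
    unfolding sum_distrib_left by (rule sum.swap)
  also have "\<dots> = (\<Sum>f\<in>shapes (size M). of_nat (card (tabs f M)) * (\<Sum>T\<in>fSYT f. w (fDes f T)))"
  proof (intro sum.cong refl arg_cong2[of _ _ _ _ "(*)"] sum_conv_card_Pow[symmetric])
    fix f T assume "f \<in> shapes (size M)"
    then show "finite (fSYT f)" "T \<in> fSYT f \<Longrightarrow> fDes f T \<subseteq> {..size M}"
      using finite_fSYT fDes_subset[of T f] by (auto simp: shapes_def)
  qed simp
  finally show ?thesis .
qed

text \<open>The source of symmetry. The recursion of \<open>card_words_within_split\<close> sees
  \<open>M\<close> only through its submultisets and their sizes; the order of the letters has
  disappeared, so any bijection of letters carries the recursion along.\<close>

lemma card_words_within_image_mset:
  assumes \<pi>: "bij \<pi>"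
  shows "card (words_within D (image_mset \<pi> M)) = card (words_within D M)"
proof (induction "size M" arbitrary: M rule: less_induct)
  case less
  show ?case
  proof (cases "M = {#}")
    case False
    then have "0 < size M" by (simp add: nonempty_has_size)
    then obtain p k where k: "size M = p + k" "0 < k" and p: "p = 0 \<or> p \<in> D" and D: "D \<inter> {p<..<p + k} = {}"
      by (rule last_block)
    have inv: "image_mset (inv \<pi>) (image_mset \<pi> G) = G" "image_mset \<pi> (image_mset (inv \<pi>) G) = G" for G
      using \<pi> by (simp_all add: multiset.map_comp bij_is_inj surj_iff[THEN iffD1, OF bij_is_surj])
    have "card (words_within D (image_mset \<pi> M)) =
       (\<Sum>G | G \<subseteq># image_mset \<pi> M \<and> size G = k. card (words_within D (image_mset \<pi> M - G)))"
      by (rule card_words_within_split[OF p D]) (simp add: k)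
    also have "\<dots> = (\<Sum>G | G \<subseteq># M \<and> size G = k. card (words_within D (M - G)))"
    proof (rule sum.reindex_bij_witness[where i = "image_mset \<pi>" and j = "image_mset (inv \<pi>)"])
      fix G assume G: "G \<in> {G. G \<subseteq># image_mset \<pi> M \<and> size G = k}"
      then show "image_mset \<pi> (image_mset (inv \<pi>) G) = G" by (simp only: inv)
      have sub: "image_mset (inv \<pi>) G \<subseteq># M"
        using image_mset_subseteq_mono[of G "image_mset \<pi> M" "inv \<pi>"] G by (simp only: inv mem_Collect_eq)
      with G show "image_mset (inv \<pi>) G \<in> {G. G \<subseteq># M \<and> size G = k}" by simp
      have "image_mset \<pi> (M - image_mset (inv \<pi>) G) = image_mset \<pi> M - G"
        by (simp only: image_mset_Diff[OF sub] inv)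
      moreover have "size (M - image_mset (inv \<pi>) G) < size M"
        using sub G k by (simp add: size_Diff_submset)
      ultimately show "card (words_within D (M - image_mset (inv \<pi>) G)) =
          card (words_within D (image_mset \<pi> M - G))"
        using less.hyps[of "M - image_mset (inv \<pi>) G"] by simp
    next
      fix G assume G: "G \<in> {G. G \<subseteq># M \<and> size G = k}"
      then show "image_mset (inv \<pi>) (image_mset \<pi> G) = G" by (simp only: inv)
      show "image_mset \<pi> G \<in> {G. G \<subseteq># image_mset \<pi> M \<and> size G = k}"
        using G by (simp add: image_mset_subseteq_mono)
    qed
    also have "\<dots> = card (words_within D M)"
      by (rule card_words_within_split[OF p D k(1), symmetric])
    finally show ?thesis .
  qed simp
qed

lemma sum_words_Des_image_mset:
  fixes w :: "nat set \<Rightarrow> 'a::comm_ring_1"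
  assumes "bij \<pi>"
  shows "(\<Sum>\<sigma>\<in>permutations_of_multiset (image_mset \<pi> M). w (Des \<sigma>)) =
    (\<Sum>\<sigma>\<in>permutations_of_multiset M. w (Des \<sigma>))"
proof -
  have card_eq: "card {\<sigma> \<in> permutations_of_multiset (image_mset \<pi> M). Des \<sigma> = E} =
      card {\<sigma> \<in> permutations_of_multiset M. Des \<sigma> = E}" if "finite E" for E
    using that
  proof (rule sum_Pow_determines[rotated])
    fix D :: "nat set" assume D: "finite D"
    show "(\<Sum>E\<in>Pow D. card {\<sigma> \<in> permutations_of_multiset (image_mset \<pi> M). Des \<sigma> = E}) =
        (\<Sum>E\<in>Pow D. card {\<sigma> \<in> permutations_of_multiset M. Des \<sigma> = E})"
      using card_words_within_image_mset[OF assms, of D M] D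
      unfolding words_within_def by (simp add: card_subset_group)
  qed
  have *: "of_nat (card {\<sigma> \<in> permutations_of_multiset (image_mset \<pi> M). Des \<sigma> = E}) * w E =
      of_nat (card {\<sigma> \<in> permutations_of_multiset M. Des \<sigma> = E}) * w E" if "E \<in> Pow {..size M}" for E
  proof -
    have "finite E" using that finite_subset[of E "{..size M}"] by simp
    then show ?thesis by (simp only: card_eq)
  qed
  have "(\<Sum>\<sigma>\<in>permutations_of_multiset (image_mset \<pi> M). w (Des \<sigma>)) =
     (\<Sum>E\<in>Pow {..size M}. of_nat (card {\<sigma> \<in> permutations_of_multiset (image_mset \<pi> M). Des \<sigma> = E}) * w E)"
    using Des_subset[of _ "image_mset \<pi> M"] by (intro sum_conv_card_Pow) auto
  also have "\<dots> = (\<Sum>E\<in>Pow {..size M}. of_nat (card {\<sigma> \<in> permutations_of_multiset M. Des \<sigma> = E}) * w E)"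
    by (rule sum.cong[OF refl *])
  also have "\<dots> = (\<Sum>\<sigma>\<in>permutations_of_multiset M. w (Des \<sigma>))"
    by (intro sum_conv_card_Pow[symmetric] Des_subset) auto
  finally show ?thesis .
qed

section \<open>Schur expansions\<close>

definition row_len :: "nat list \<Rightarrow> nat \<Rightarrow> nat" where
  "row_len \<mu> r = (if r < length \<mu> then \<mu> ! r else 0)"

lemma cells_conv_fcells: "cells \<mu> = fcells (row_len \<mu>)"
  by (auto simp: cells_def fcells_def row_len_def split: if_splits)

lemma SSYT_conv_fSSYT: "SSYT \<mu> = fSSYT (row_len \<mu>)"
  by (simp only: SSYT_def fSSYT_def cells_conv_fcells)

lemma sum_list_conv_fsize: "sum_list \<mu> = fsize (row_len \<mu>)"
proof -
  have "\<forall>i\<ge>length \<mu>. row_len \<mu> i = 0" by (simp add: row_len_def)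
  then have "fsize (row_len \<mu>) = (\<Sum>i<length \<mu>. row_len \<mu> i)" by (rule fsize_conv_sum)
  also have "\<dots> = (\<Sum>i<length \<mu>. \<mu> ! i)" by (rule sum.cong) (auto simp: row_len_def)
  finally show ?thesis by (simp add: sum_list_sum_nth atLeast0LessThan)
qed

lemma SYT_conv_fSYT: "SYT \<mu> = fSYT (row_len \<mu>)"
  by (simp only: SYT_def fSYT_def SSYT_conv_fSSYT cells_conv_fcells sum_list_conv_fsize)

lemma Des_tab_conv_fDes: "Des_tab \<mu> T = fDes (row_len \<mu>) T"
  by (simp only: Des_tab_def fDes_def cells_conv_fcells)

lemma schur_conv_tabs: "schur \<mu> M = of_nat (card (tabs (row_len \<mu>) M))"
  by (simp only: schur_def tabs_def content_def SSYT_conv_fSSYT cells_conv_fcells)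

lemma shape_row_len:
  assumes "is_partition \<mu>" shows "shape (row_len \<mu>)"
  unfolding shape_def
proof
  show "antimono (row_len \<mu>)"
    unfolding antimono_iff_le_Suc
  proof
    fix i show "row_len \<mu> (Suc i) \<le> row_len \<mu> i"
      using assms sorted_wrt_nth_less[of "(\<ge>)" \<mu> i "Suc i"] by (auto simp: row_len_def is_partition_def)
  qed
  show "\<exists>B. \<forall>i\<ge>B. row_len \<mu> i = 0" by (intro exI[of _ "length \<mu>"]) (simp add: row_len_def)
qed

lemma row_len_inj:
  assumes "is_partition \<mu>" "is_partition \<nu>" "row_len \<mu> = row_len \<nu>"
  shows "\<mu> = \<nu>"
proof -
  have pos: "row_len \<kappa> r \<noteq> 0 \<longleftrightarrow> r < length \<kappa>" if "is_partition \<kappa>" for \<kappa> r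
    using that by (auto simp: row_len_def is_partition_def)
  have "r < length \<mu> \<longleftrightarrow> r < length \<nu>" for r
    using pos[OF assms(1)] pos[OF assms(2)] assms(3) by simp
  then have len: "length \<mu> = length \<nu>" by (metis less_irrefl nat_neq_iff)
  show ?thesis
  proof (rule nth_equalityI[OF len])
    fix r assume "r < length \<mu>"
    then show "\<mu> ! r = \<nu> ! r" using fun_cong[OF assms(3), of r] len by (simp add: row_len_def)
  qed
qed

lemma row_len_surj:
  assumes f: "shape f"
  shows "\<exists>\<mu>. is_partition \<mu> \<and> row_len \<mu> = f"
proof -
  define L where "L = (LEAST i. f i = 0)"
  have "\<exists>i. f i = 0" using f by (auto simp: shape_def)
  then have "f L = 0" unfolding L_def by (rule LeastI_ex)
  then have 0: "f i = 0" if "L \<le> i" for i using shape_antimonoD[OF f that] by simp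
  have pos: "0 < f i" if "i < L" for i using not_less_Least that unfolding L_def by auto
  have "is_partition (map f [0..<L])"
    using pos shape_antimonoD[OF f] by (auto simp: is_partition_def sorted_wrt_iff_nth_less)
  moreover have "row_len (map f [0..<L]) = f" using 0 by (auto simp: row_len_def fun_eq_iff)
  ultimately show ?thesis by blast
qed

lemma bij_betw_row_len: "bij_betw row_len {\<mu>. partition_of n \<mu>} (shapes n)"
proof (rule bij_betwI')
  show "(row_len \<mu> = row_len \<nu>) = (\<mu> = \<nu>)" if "\<mu> \<in> {\<mu>. partition_of n \<mu>}" "\<nu> \<in> {\<mu>. partition_of n \<mu>}" for \<mu> \<nu>
    using that row_len_inj by (auto simp: partition_of_def)
  show "row_len \<mu> \<in> shapes n" if "\<mu> \<in> {\<mu>. partition_of n \<mu>}" for \<mu>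
    using that shape_row_len by (auto simp: partition_of_def shapes_def sum_list_conv_fsize)
  show "\<exists>\<mu>\<in>{\<mu>. partition_of n \<mu>}. f = row_len \<mu>" if "f \<in> shapes n" for f
    using that row_len_surj[of f] by (auto simp: partition_of_def shapes_def sum_list_conv_fsize)
qed

lemma finite_partition_of: "finite {\<mu>. partition_of n \<mu>}"
  using bij_betw_finite[OF bij_betw_row_len] finite_shapes by blast

text \<open>After the reduction to descent sets, equal numbers of words for each descent set
  suffice. A permutation of the positive integers fixes 0, so it also preserves which multisets
  occur at all.\<close>

theorem symmetric_H_tilde:
  assumes q: "q \<noteq> 0" and mn: "m < n"
  shows "symmetric_series (H_tilde n m q t u v)"
  unfolding symmetric_series_def
proof (intro allI impI)
  fix \<pi> :: "nat \<Rightarrow> nat" and M assume \<pi>: "\<pi> permutes {1..}"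
  have "0 < \<pi> x \<longleftrightarrow> 0 < x" for x
    using permutes_in_image[OF \<pi>, of x] by (simp add: Suc_le_eq)
  then have cond: "(size (image_mset \<pi> M) = n \<and> (\<forall>x\<in>#image_mset \<pi> M. 0 < x)) \<longleftrightarrow>
      (size M = n \<and> (\<forall>x\<in>#M. 0 < x))" by simp
  show "H_tilde n m q t u v (image_mset \<pi> M) = H_tilde n m q t u v M"
  proof (cases "size M = n \<and> (\<forall>x\<in>#M. 0 < x)")
    case True
    have "size (image_mset \<pi> M) = n" "\<forall>x\<in>#image_mset \<pi> M. 0 < x" "size M = n" "\<forall>x\<in>#M. 0 < x"
      using cond True by blast+
    then show ?thesis
      unfolding H_tilde_conv_des_weight[OF q mn]
      by (simp only: words_content sum_words_Des_image_mset[OF permutes_bij[OF \<pi>]])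
  next
    case False
    with cond have F: "\<not> (size (image_mset \<pi> M) = n \<and> (\<forall>x\<in>#image_mset \<pi> M. 0 < x))" by blast
    show ?thesis
      unfolding H_tilde_def words_content_empty[OF F] words_content_empty[OF False] by (rule refl)
  qed
qed

definition H_coeff :: "nat \<Rightarrow> nat \<Rightarrow> 'a::field \<Rightarrow> 'a \<Rightarrow> 'a \<Rightarrow> 'a \<Rightarrow> nat list \<Rightarrow> 'a" where
  "H_coeff n m q t u v \<mu> =
     (if partition_of n \<mu> then \<Sum>T\<in>SYT \<mu>. des_weight n m q t u v (Des_tab \<mu> T) else 0)"

theorem schur_expansion_H_tilde:
  assumes q: "q \<noteq> 0" and mn: "m < n"
  shows "schur_expansion (H_tilde n m q t u v) (H_coeff n m q t u v)"
  unfolding schur_expansion_def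
proof (intro conjI allI impI)
  let ?c = "H_coeff n m q t u v"
  have sub: "{\<mu>. ?c \<mu> \<noteq> 0} \<subseteq> {\<mu>. partition_of n \<mu>}" by (auto simp: H_coeff_def)
  then show "finite {\<mu>. ?c \<mu> \<noteq> 0}" using finite_partition_of finite_subset by blast
  show "is_partition \<mu>" if "?c \<mu> \<noteq> 0" for \<mu> using that sub by (auto simp: partition_of_def)
  fix M
  have red: "(\<Sum>\<mu> | ?c \<mu> \<noteq> 0. ?c \<mu> * schur \<mu> M) = (\<Sum>\<mu> | partition_of n \<mu>. ?c \<mu> * schur \<mu> M)"
    by (rule sum.mono_neutral_left) (use finite_partition_of sub in auto)
  show "H_tilde n m q t u v M = (\<Sum>\<mu> | ?c \<mu> \<noteq> 0. ?c \<mu> * schur \<mu> M)"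
  proof (cases "size M = n \<and> (\<forall>x\<in>#M. 0 < x)")
    case True
    then have M: "size M = n" "\<forall>x\<in>#M. 0 < x" by auto
    let ?w = "des_weight n m q t u v"
    have "H_tilde n m q t u v M = (\<Sum>\<sigma>\<in>permutations_of_multiset M. ?w (Des \<sigma>))"
      unfolding H_tilde_conv_des_weight[OF q mn] words_content[OF M] ..
    also have "\<dots> = (\<Sum>f\<in>shapes n. of_nat (card (tabs f M)) * (\<Sum>T\<in>fSYT f. ?w (fDes f T)))"
      unfolding sum_words_Des[OF M(2)] M(1) ..
    also have "\<dots> = (\<Sum>\<mu> | partition_of n \<mu>. of_nat (card (tabs (row_len \<mu>) M)) *
        (\<Sum>T\<in>fSYT (row_len \<mu>). ?w (fDes (row_len \<mu>) T)))"
      by (rule sum.reindex_bij_betw[OF bij_betw_row_len, symmetric])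
    also have "\<dots> = (\<Sum>\<mu> | partition_of n \<mu>. ?c \<mu> * schur \<mu> M)"
      by (intro sum.cong refl) (simp add: H_coeff_def schur_conv_tabs SYT_conv_fSYT Des_tab_conv_fDes)
    finally show ?thesis by (simp only: red)
  next
    case False
    have "schur \<mu> M = (0 :: 'a)" if "partition_of n \<mu>" for \<mu>
    proof -
      have s: "shape (row_len \<mu>)" "fsize (row_len \<mu>) = n"
        using that shape_row_len by (auto simp: partition_of_def sum_list_conv_fsize)
      have "tabs (row_len \<mu>) M = {}"
      proof (rule equals0I)
        fix T assume "T \<in> tabs (row_len \<mu>) M"
        then have T: "T \<in> fSSYT (row_len \<mu>)" "content (row_len \<mu>) T = M" by (auto simp: tabs_def)
        have "size M = n" using size_content[of "row_len \<mu>" T] T s by simp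
        moreover have "\<forall>x\<in>#M. 0 < x"
          using T(1) set_mset_content[OF s(1), of T] unfolding T(2) by (auto simp: fSSYT_iff fcells_def)
        ultimately show False using False by blast
      qed
      then show ?thesis by (simp add: schur_conv_tabs)
    qed
    then have "(\<Sum>\<mu> | partition_of n \<mu>. ?c \<mu> * schur \<mu> M) = 0" by simp
    moreover have "H_tilde n m q t u v M = 0"
      unfolding H_tilde_def words_content_empty[OF False] by simp
    ultimately show ?thesis by (simp only: red)
  qed
qed

section \<open>Linear independence of the Schur functions\<close>

definition row_tab :: "(nat \<Rightarrow> nat) \<Rightarrow> nat \<times> nat \<Rightarrow> nat" where
  "row_tab f p = (if p \<in> fcells f then Suc (fst p) else undefined)"

lemma row_tab_fSSYT: "row_tab f \<in> fSSYT f"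
  by (auto simp: fSSYT_iff row_tab_def fcells_def)

lemma fSSYT_gt_row:
  assumes f: "shape f" and T: "T \<in> fSSYT f" shows "c < f r \<Longrightarrow> r < T (r, c)"
proof (induction r)
  case 0
  then show ?case using T by (simp add: fSSYT_iff)
next
  case (Suc r)
  have c: "c < f r" using Suc.prems shape_antimonoD[OF f, of r "Suc r"] by simp
  have "T (r, c) < T (Suc r, c)" by (rule fSSYT_col[OF T c Suc.prems]) simp
  with Suc.IH[OF c] show ?case by simp
qed

lemma card_cells_le:
  assumes "shape f"
  shows "card {p \<in> fcells f. T p \<le> k} = size (filter_mset (\<lambda>y. y \<le> k) (content f T))"
  unfolding content_def filter_mset_image_mset using finite_fcells[OF assms] by simp

lemma card_cells_rows_less: "card {p \<in> fcells f. fst p < k} = (\<Sum>r<k. f r)"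
proof -
  have "{p \<in> fcells f. fst p < k} = (SIGMA r:{..<k}. {..<f r})" by (auto simp: fcells_def)
  then show ?thesis by simp
qed

lemma card_row_tab_le:
  assumes "shape f"
  shows "size (filter_mset (\<lambda>y. y \<le> k) (content f (row_tab f))) = (\<Sum>r<k. f r)"
proof -
  have "{p \<in> fcells f. row_tab f p \<le> k} = {p \<in> fcells f. fst p < k}" by (auto simp: row_tab_def)
  then show ?thesis using card_cells_le[OF assms, of "row_tab f" k] card_cells_rows_less by simp
qed

text \<open>The Kostka matrix is unitriangular with respect to the dominance order, because the entries
  of row \<open>r\<close> (counted from 0) of a semistandard tableau are larger than \<open>r\<close>.\<close>

lemma tabs_row_tab_dominance:
  assumes f: "shape f" and g: "shape g" and T: "T \<in> tabs g (content f (row_tab f))"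
  shows "(\<Sum>r<k. f r) \<le> (\<Sum>r<k. g r)"
proof -
  have T': "T \<in> fSSYT g" "content g T = content f (row_tab f)" using T by (auto simp: tabs_def)
  have "(\<Sum>r<k. f r) = card {p \<in> fcells g. T p \<le> k}"
    by (simp only: card_cells_le[OF g] T'(2) card_row_tab_le[OF f])
  also have "\<dots> \<le> card {p \<in> fcells g. fst p < k}"
  proof (rule card_mono)
    show "{p \<in> fcells g. T p \<le> k} \<subseteq> {p \<in> fcells g. fst p < k}"
      using fSSYT_gt_row[OF g T'(1)] by (force simp: fcells_def)
  qed (simp add: finite_fcells g)
  finally show ?thesis by (simp only: card_cells_rows_less)
qed

text \<open>The diagonal entry 1 of the Kostka matrix: the cells with entry at most \<open>k\<close>
  lie in the first \<open>k\<close> rows and are as numerous as these, so they are exactly these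
  rows, for every \<open>k\<close>.\<close>

lemma tabs_row_tab:
  assumes f: "shape f"
  shows "tabs f (content f (row_tab f)) = {row_tab f}"
proof
  show "{row_tab f} \<subseteq> tabs f (content f (row_tab f))" by (simp add: tabs_def row_tab_fSSYT)
  show "tabs f (content f (row_tab f)) \<subseteq> {row_tab f}"
  proof
    fix T assume "T \<in> tabs f (content f (row_tab f))"
    then have T: "T \<in> fSSYT f" "content f T = content f (row_tab f)" by (auto simp: tabs_def)
    have gt: "fst p < T p" if "p \<in> fcells f" for p
      using that fSSYT_gt_row[OF f T(1)] by (auto simp: fcells_def)
    have "{p \<in> fcells f. T p \<le> k} = {p \<in> fcells f. fst p < k}" for k
    proof (rule card_subset_eq)
      show "finite {p \<in> fcells f. fst p < k}" by (simp add: finite_fcells f)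
      show "{p \<in> fcells f. T p \<le> k} \<subseteq> {p \<in> fcells f. fst p < k}" using gt by force
      show "card {p \<in> fcells f. T p \<le> k} = card {p \<in> fcells f. fst p < k}"
        by (simp only: card_cells_le[OF f] T(2) card_row_tab_le[OF f] card_cells_rows_less)
    qed
    then have "T p \<le> Suc (fst p)" if "p \<in> fcells f" for p using that by blast
    then have "T p = Suc (fst p)" if "p \<in> fcells f" for p using that gt[of p] by (simp add: le_antisym Suc_leI)
    moreover have "T p = undefined" if "p \<notin> fcells f" for p
      using that fSSYT_undefined[OF T(1)] by (cases p) (auto simp: fcells_def)
    ultimately have "T = row_tab f" by (auto simp: row_tab_def fun_eq_iff)
    then show "T \<in> {row_tab f}" by simp
  qed
qed

text \<open>If some coefficient were nonzero, choose a dominance-maximal \<open>\<kappa>\<close>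
  among the partitions with nonzero coefficient. At the content of its \<open>row_tab\<close> every
  other such Schur function vanishes and \<open>schur \<kappa>\<close> is 1, so the sum there equals
  \<open>d \<kappa>\<close>.\<close>

lemma schur_linear_independent:
  fixes d :: "nat list \<Rightarrow> 'a::field"
  assumes fin: "finite S" and part: "\<And>\<mu>. \<mu> \<in> S \<Longrightarrow> is_partition \<mu>"
    and zero: "\<And>M. (\<Sum>\<mu>\<in>S. d \<mu> * schur \<mu> M) = 0" and "\<nu> \<in> S"
  shows "d \<nu> = 0"
proof (rule ccontr)
  assume "d \<nu> \<noteq> 0"
  define S' where "S' = {\<mu> \<in> S. d \<mu> \<noteq> 0}"
  have S': "finite S'" "S' \<noteq> {}" using fin \<open>\<nu> \<in> S\<close> \<open>d \<nu> \<noteq> 0\<close> by (auto simp: S'_def)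
  \<comment> \<open>One more than the largest length: partial sums up to this length determine all
    nonzero rows.\<close>
  define B where "B = Suc (Max (length ` S'))"
  define dom where "dom = (\<lambda>\<mu> k. \<Sum>r<k. row_len \<mu> r)"
  \<comment> \<open>The total of the partial sums is a numerical stand-in for the dominance order:
    it increases strictly when one of the partial sums does and none decreases, so a maximiser is
    maximal for dominance.\<close>
  obtain \<kappa> where \<kappa>: "\<kappa> \<in> S'" "\<And>\<mu>. \<mu> \<in> S' \<Longrightarrow> (\<Sum>k<B. dom \<mu> k) \<le> (\<Sum>k<B. dom \<kappa> k)"
  proof -
    let ?F = "\<lambda>\<mu>. \<Sum>k<B. dom \<mu> k"
    have fin: "finite (?F ` S')" and "?F ` S' \<noteq> {}" using S' by auto
    then obtain \<kappa> where \<kappa>: "\<kappa> \<in> S'" "Max (?F ` S') = ?F \<kappa>" using Max_in by blast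
    show ?thesis
      by (rule that[OF \<kappa>(1)]) (use Max_ge[OF fin] \<kappa>(2) in auto)
  qed
  define M where "M = content (row_len \<kappa>) (row_tab (row_len \<kappa>))"
  have sh: "shape (row_len \<mu>)" if "\<mu> \<in> S'" for \<mu> using that part by (auto simp: S'_def intro: shape_row_len)
  have "schur \<mu> M = (0 :: 'a)" if \<mu>: "\<mu> \<in> S'" "\<mu> \<noteq> \<kappa>" for \<mu>
  proof (rule ccontr)
    assume "schur \<mu> M \<noteq> (0 :: 'a)"
    then obtain T where "T \<in> tabs (row_len \<mu>) M" unfolding schur_conv_tabs by (metis card.empty ex_in_conv of_nat_0)
    then have le: "dom \<kappa> k \<le> dom \<mu> k" for k
      unfolding dom_def M_def using tabs_row_tab_dominance sh \<kappa>(1) \<mu>(1) by blast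
    have eq: "dom \<kappa> k = dom \<mu> k" if "k < B" for k
    proof (rule ccontr)
      assume "dom \<kappa> k \<noteq> dom \<mu> k"
      then have "dom \<kappa> k < dom \<mu> k" using le[of k] by simp
      then have "(\<Sum>k<B. dom \<kappa> k) < (\<Sum>k<B. dom \<mu> k)"
        using le that by (intro sum_strict_mono_ex1) auto
      with \<kappa>(2)[OF \<mu>(1)] show False by simp
    qed
    have "row_len \<kappa> r = row_len \<mu> r" for r
    proof (cases "Suc r < B")
      case True
      then show ?thesis using eq[of r] eq[of "Suc r"] by (simp add: dom_def)
    next
      case False
      have len: "length \<mu>' \<le> r" if "\<mu>' \<in> S'" for \<mu>'
      proof -
        have "length \<mu>' \<le> Max (length ` S')" using S' that by (intro Max_ge) auto
        then show ?thesis using False by (simp add: B_def)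
      qed
      from len[OF \<kappa>(1)] len[OF \<mu>(1)] show ?thesis by (simp add: row_len_def)
    qed
    then have "\<kappa> = \<mu>" using \<kappa>(1) \<mu>(1) part by (intro row_len_inj) (auto simp: S'_def)
    with \<mu>(2) show False by simp
  qed
  moreover have "schur \<kappa> M = (1 :: 'a)"
    unfolding schur_conv_tabs M_def tabs_row_tab[OF sh[OF \<kappa>(1)]] by simp
  moreover have "(\<Sum>\<mu>\<in>S. d \<mu> * schur \<mu> M) = (\<Sum>\<mu>\<in>S'. d \<mu> * schur \<mu> M)"
    by (rule sum.mono_neutral_right) (auto simp: S'_def fin)
  ultimately have "(\<Sum>\<mu>\<in>S. d \<mu> * schur \<mu> M) = d \<kappa>"
    using S'(1) \<kappa>(1) by (simp add: sum.remove)
  then show False using zero[of M] \<kappa>(1) by (simp add: S'_def)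
qed

theorem schur_expansion_unique:
  fixes F :: "'a::field series"
  assumes c: "schur_expansion F c" and d: "schur_expansion F d"
  shows "c = d"
proof
  fix \<nu>
  define S where "S = {\<mu>. c \<mu> \<noteq> 0} \<union> {\<mu>. d \<mu> \<noteq> 0}"
  have S: "finite S" "\<And>\<mu>. \<mu> \<in> S \<Longrightarrow> is_partition \<mu>"
    using c d by (auto simp: S_def schur_expansion_def)
  have F: "F M = (\<Sum>\<mu>\<in>S. e \<mu> * schur \<mu> M)" if e: "schur_expansion F e" "{\<mu>. e \<mu> \<noteq> 0} \<subseteq> S" for e M
  proof -
    have "F M = (\<Sum>\<mu> | e \<mu> \<noteq> 0. e \<mu> * schur \<mu> M)" using e(1) unfolding schur_expansion_def by blast
    also have "\<dots> = (\<Sum>\<mu>\<in>S. e \<mu> * schur \<mu> M)"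
      by (rule sum.mono_neutral_left) (use S(1) e(2) in auto)
    finally show ?thesis .
  qed
  have "(\<Sum>\<mu>\<in>S. (c \<mu> - d \<mu>) * schur \<mu> M) = 0" for M
    using F[OF c, of M] F[OF d, of M] by (simp add: left_diff_distrib sum_subtractf S_def)
  then have "c \<nu> - d \<nu> = 0" if "\<nu> \<in> S" using schur_linear_independent[OF S, of "\<lambda>\<mu>. c \<mu> - d \<mu>"] that by blast
  then show "c \<nu> = d \<nu>" by (cases "\<nu> \<in> S") (auto simp: S_def)
qed

theorem theorem4p1:
  fixes n m :: nat and q t u v :: "'a::field"
  assumes "1 \<le> n" and "m \<le> n - 1" and "q \<noteq> 0" and "t \<noteq> 0"
  shows "symmetric_series (H_tilde n m q t u v) \<and>
    (\<exists>!c. schur_expansion (H_tilde n m q t u v) c) \<and>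
    (\<forall>\<mu>. partition_of n \<mu> \<longrightarrow>
       schur_coeff (H_tilde n m q t u v) \<mu> =
       (\<Sum>T \<in> SYT \<mu>.
          q ^ rlmaj_tab (m + 1) n \<mu> T * t ^ maj_tab 1 m \<mu> T
          * (\<Prod>i = 1..card (Des_tab \<mu> T \<inter> {m+1..n}). 1 + u * q powi (- int i))
          * (\<Prod>j = 1..card (Des_tab \<mu> T \<inter> {1..m}). 1 + v * t powi (- int j))))"
proof -
  let ?H = "H_tilde n m q t u v"
  have mn: "m < n" using assms by simp
  have exp: "schur_expansion ?H (H_coeff n m q t u v)"
    by (rule schur_expansion_H_tilde[OF assms(3) mn])
  then have ex1: "\<exists>!c. schur_expansion ?H c" using schur_expansion_unique by blast
  have "(THE c. schur_expansion ?H c) = H_coeff n m q t u v"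
    by (rule the_equality) (use exp schur_expansion_unique in blast)+
  then have "schur_coeff ?H = H_coeff n m q t u v"
    by (simp add: schur_coeff_def fun_eq_iff)
  then show ?thesis
    using symmetric_H_tilde[OF assms(3) mn] ex1
    by (simp add: H_coeff_def des_weight_def maj_tab_def rlmaj_tab_def)
qed

end
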